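(* Let $p,q>1$, $\sigma\in(0,\frac1p)$ and $\alpha=\frac{p-1+p\sigma}{pq}$. There exists $\varepsilon>0$ such that $u=\kappa_{q,-\alpha}\wedge\varepsilon$ (pointwise minimum) is $\Delta_p^\sigma$-superharmonic, i.e. $\Delta_p^\sigma u\ge0$ on $\mathbb Z$. In particular, for this $\varepsilon$, $$w:=\frac{\Delta_p^\sigma(\kappa_{q,-\alpha}\wedge\varepsilon)}{(\kappa_{q,-\alpha}\wedge\varepsilon)^{p-1}}$$ is an optimal Hardy weight. Moreover, $w(x)\asymp|x|^{-p\sigma}$ as $|x|\to\infty$.
   Context: Notation: $C(\mathbb Z)$ is the space of real functions on $\mathbb Z$, $C_c(\mathbb Z)$ those of finite support; $1_y$ is the indicator function of $\{y\}$; $t^{\langle p-1\rangle}:=|t|^{p-1}\operatorname{sgn}(t)$ with $\operatorname{sgn}(0)=0$. $a\asymp b$ means $C_1b\le a\le C_2b$ for positive constants $C_1,C_2$. Kernels. Let $\Delta_2f(x)=2f(x)-f(x+1)-f(x-1)$ on $\mathbb Z$ and $p_t(x,y)=e^{-t\Delta_2}1_y(x)$ its heat kernel. For $r>1$ and $\beta\in(-\frac1r,\frac2r)$, $\beta\ne0$, put $$\kappa_{r,\beta}(x,y):=\frac1{|\Gamma(-\frac{r\beta}2)|}\int_0^\infty p_t(x,y)\frac{dt}{t^{1+\frac{r\beta}2}}\quad\text{for }|x-y|>\tfrac{r\beta}2,\qquad \kappa_{r,\beta}(x,x):=0\text{ if }\beta>0.$$ It depends only on $x-y$: $\kappa_{r,\beta}(x,y)=\kappa_{r,\beta}(x-y,0)=:\kappa_{r,\beta}(x-y)$.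 Explicitly, for $|x|>\frac{r\beta}2$, $$\kappa_{r,\beta}(x)=c_{r,\beta}\frac{\Gamma(|x|-\frac{r\beta}2)}{\Gamma(|x|+1+\frac{r\beta}2)},\qquad c_{r,\beta}=\frac{4^{\frac{r\beta}2}\Gamma(\frac{1+r\beta}2)}{\sqrt\pi\,|\Gamma(-\frac{r\beta}2)|}.$$ In particular $\kappa_{q,-\alpha}$ is a strictly positive function on $\mathbb Z$. Operator. $\kappa_{p,\sigma}$ is regarded as a graph (symmetric, summable edge weights) over $(\mathbb Z,1)$. Let $\mathcal F_p$ be the set of $f\in C(\mathbb Z)$ with $\sum_y\kappa_{p,\sigma}(x-y)|f(x)-f(y)|^{p-1}<\infty$ for all $x$. The fractional $p$-Laplacian is $\Delta_p^\sigma f(x)=\sum_{y\in\mathbb Z}\kappa_{p,\sigma}(x-y)\,(f(x)-f(y))^{\langle p-1\rangle}$ for $f\in\mathcal F_p$. The $p$-energy is $\mathcal E_p(\varphi)=\frac12\sum_{x,y\in\mathbb Z}\kappa_{p,\sigma}(x-y)|\varphi(x)-\varphi(y)|^p$, $\varphi\in C_c(\mathbb Z)$. Weights. $w\in C(\mathbb Z)$ is a ($p$-)Hardy-type weight if $\mathcal E_p(\varphi)\ge\sum_xw(x)|\varphi(x)|^p$ for all $\varphi\in C_c(\mathbb Z)$; it is a Hardy weight if moreover $w(x)>0$ for all $x\in\mathbb Z$. A Hardy-type weight $w$ is $p$-critical if there is no Hardy-type weight $\tilde w$ with $\tilde w\ge w$, $\tilde w\ne w$. This is equivalent to the existence of an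 Agmon ground state: a positive $u\in\mathcal F_p$, unique up to positive multiples, with $\Delta_p^\sigma u\ge wu^{p-1}$ (then in fact $\Delta_p^\sigma u=wu^{p-1}$). A $p$-critical $w$ is $p$-null-critical if its Agmon ground state $u$ satisfies $\sum_x|w(x)|u(x)^p=\infty$. A Hardy(-type) weight is optimal if it is $p$-critical and $p$-null-critical. *)

theory Defs
  imports "HOL-Analysis.Analysis"
begin

definition laplacian2 :: "(int \<Rightarrow> real) \<Rightarrow> int \<Rightarrow> real" where
  "laplacian2 f x = 2 * f x - f (x + 1) - f (x - 1)"

text \<open>The heat semigroup as the operator exponential series. The Laplacian is bounded on bounded
  functions, so the series converges absolutely at every point for bounded \<open>f\<close>.\<close>
definition heat_semigroup :: "real \<Rightarrow> (int \<Rightarrow> real) \<Rightarrow> int \<Rightarrow> real" where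
  "heat_semigroup t f x = (\<Sum>n. (- t) ^ n / fact n * (laplacian2 ^^ n) f x)"

definition heat_kernel :: "real \<Rightarrow> int \<Rightarrow> int \<Rightarrow> real" where
  "heat_kernel t x y = heat_semigroup t (indicator {y}) x"

text \<open>Intended for \<open>r > 1\<close> and \<open>-1/r < \<beta> < 2/r\<close>, \<open>\<beta> \<noteq> 0\<close>. In this range the
  \<open>else\<close> branch is reached exactly when \<open>x = y\<close> and \<open>\<beta> > 0\<close>, and the integral in the other
  branch converges.\<close>
definition kappa2 :: "real \<Rightarrow> real \<Rightarrow> int \<Rightarrow> int \<Rightarrow> real" where
  "kappa2 r \<beta> x y =
     (if of_int \<bar>x - y\<bar> > r * \<beta> / 2
      then 1 / \<bar>Gamma (- (r * \<beta> / 2))\<bar> *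
           (LINT t:{0<..}|lborel. heat_kernel t x y / t powr (1 + r * \<beta> / 2))
      else 0)"

definition kappa :: "real \<Rightarrow> real \<Rightarrow> int \<Rightarrow> real" where
  "kappa r \<beta> x = kappa2 r \<beta> x 0"

definition signed_powr :: "real \<Rightarrow> real \<Rightarrow> real" where
  "signed_powr t a = \<bar>t\<bar> powr a * sgn t"

definition F_space :: "real \<Rightarrow> real \<Rightarrow> (int \<Rightarrow> real) set" where
  "F_space p \<sigma> =
     {f. \<forall>x. (\<lambda>y. kappa p \<sigma> (x - y) * \<bar>f x - f y\<bar> powr (p - 1)) summable_on UNIV}"

text \<open>Meaningful for \<open>f \<in> F_space p \<sigma>\<close> only: \<open>infsum\<close> is \<open>0\<close> on non-summable families.\<close>
definition frac_laplacian :: "real \<Rightarrow> real \<Rightarrow> (int \<Rightarrow> real) \<Rightarrow> int \<Rightarrow> real" where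
  "frac_laplacian p \<sigma> f x =
     (\<Sum>\<^sub>\<infinity>y\<in>UNIV. kappa p \<sigma> (x - y) * signed_powr (f x - f y) (p - 1))"

definition superharmonic :: "real \<Rightarrow> real \<Rightarrow> (int \<Rightarrow> real) \<Rightarrow> bool" where
  "superharmonic p \<sigma> u \<longleftrightarrow> u \<in> F_space p \<sigma> \<and> (\<forall>x. frac_laplacian p \<sigma> u x \<ge> 0)"

definition finitely_supported :: "(int \<Rightarrow> real) set" where
  "finitely_supported = {\<phi>. finite {x. \<phi> x \<noteq> 0}}"

text \<open>Used for finitely supported \<open>\<phi>\<close>, where the family is summable because the edge weights are.\<close>
definition p_energy :: "real \<Rightarrow> real \<Rightarrow> (int \<Rightarrow> real) \<Rightarrow> real" where
  "p_energy p \<sigma> \<phi> =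
     1 / 2 * (\<Sum>\<^sub>\<infinity>(x, y)\<in>UNIV. kappa p \<sigma> (x - y) * \<bar>\<phi> x - \<phi> y\<bar> powr p)"

definition hardy_type_weight :: "real \<Rightarrow> real \<Rightarrow> (int \<Rightarrow> real) \<Rightarrow> bool" where
  "hardy_type_weight p \<sigma> w \<longleftrightarrow>
     (\<forall>\<phi>\<in>finitely_supported. p_energy p \<sigma> \<phi> \<ge> (\<Sum>\<^sub>\<infinity>x\<in>UNIV. w x * \<bar>\<phi> x\<bar> powr p))"

definition hardy_weight :: "real \<Rightarrow> real \<Rightarrow> (int \<Rightarrow> real) \<Rightarrow> bool" where
  "hardy_weight p \<sigma> w \<longleftrightarrow> hardy_type_weight p \<sigma> w \<and> (\<forall>x. w x > 0)"

definition p_critical :: "real \<Rightarrow> real \<Rightarrow> (int \<Rightarrow> real) \<Rightarrow> bool" where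
  "p_critical p \<sigma> w \<longleftrightarrow> hardy_type_weight p \<sigma> w \<and>
     \<not> (\<exists>w'. hardy_type_weight p \<sigma> w' \<and> (\<forall>x. w' x \<ge> w x) \<and> w' \<noteq> w)"

definition positive_supersolution ::
    "real \<Rightarrow> real \<Rightarrow> (int \<Rightarrow> real) \<Rightarrow> (int \<Rightarrow> real) \<Rightarrow> bool" where
  "positive_supersolution p \<sigma> w u \<longleftrightarrow> (\<forall>x. u x > 0) \<and> u \<in> F_space p \<sigma> \<and>
     (\<forall>x. frac_laplacian p \<sigma> u x \<ge> w x * u x powr (p - 1))"

definition agmon_ground_state ::
    "real \<Rightarrow> real \<Rightarrow> (int \<Rightarrow> real) \<Rightarrow> (int \<Rightarrow> real) \<Rightarrow> bool" where
  "agmon_ground_state p \<sigma> w u \<longleftrightarrow> positive_supersolution p \<sigma> w u \<and>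
     (\<forall>v. positive_supersolution p \<sigma> w v \<longrightarrow> (\<exists>c>0. \<forall>x. v x = c * u x))"

text \<open>Ground states are unique up to positive multiples, so the choice of \<open>u\<close> does not matter.
  The series has nonnegative terms: it is infinite iff it is not summable.\<close>
definition p_null_critical :: "real \<Rightarrow> real \<Rightarrow> (int \<Rightarrow> real) \<Rightarrow> bool" where
  "p_null_critical p \<sigma> w \<longleftrightarrow> p_critical p \<sigma> w \<and>
     (\<exists>u. agmon_ground_state p \<sigma> w u \<and> \<not> (\<lambda>x. \<bar>w x\<bar> * u x powr p) summable_on UNIV)"

definition optimal_hardy_weight :: "real \<Rightarrow> real \<Rightarrow> (int \<Rightarrow> real) \<Rightarrow> bool" where
  "optimal_hardy_weight p \<sigma> w \<longleftrightarrow>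
     hardy_weight p \<sigma> w \<and> p_critical p \<sigma> w \<and> p_null_critical p \<sigma> w"

end

theory Submission
  imports Defs "HOL-Real_Asymp.Real_Asymp"
begin

text \<open>
Write \<open>\<tau> = p\<sigma> < 1\<close>, \<open>\<kappa> = kappa p \<sigma>\<close> and \<open>G = kappa q (-\<alpha>)\<close>. The value of \<open>\<alpha>\<close> makes \<open>G\<close> decay like
\<open>\<bar>x\<bar> powr (-\<gamma>)\<close> with \<open>\<gamma> p = 1 - \<tau>\<close>. This is the exponent at which the energy of
\<open>\<bar>x\<bar> powr (-\<gamma>)\<close> diverges only logarithmically. The proof has four ingredients.

The kernels. Bessel's recurrences for the heat kernel give a two-term recurrence for its Mellin
transform, hence for \<open>kappa\<close> (\<open>kappa_rec\<close>). The recurrence says that \<open>kappa\<close> is a quotient of Gamma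
functions up to a constant factor, and the product formula for \<open>Gamma\<close> turns it into precise power
asymptotics (\<open>gamma_ratio_recurrence_LIMSEQ\<close>).

Criticality. For a positive function \<open>u\<close> put \<open>w = \<Delta>u / u powr (p-1)\<close>. Picone's inequality says that
the energy of \<open>\<phi>\<close> minus \<open>\<Sum>w\<bar>\<phi>\<bar> powr p\<close> is a sum of nonnegative remainders, one for each pair of
points (\<open>ground_state_representation\<close>). Thus \<open>w\<close> is a Hardy-type weight. If finitely supported
functions that agree with \<open>u\<close> on larger and larger sets make this difference arbitrarily small, then
no larger weight is possible. Moreover the remainder of any other positive supersolution vanishes
for every pair, and the equality case of Picone's inequality makes that supersolution
proportional to \<open>u\<close> (\<open>null_sequence_imp_critical\<close>). When \<open>u powr p\<close> is at most of order
\<open>\<bar>x\<bar> powr (\<tau>-1)\<close>, logarithmic cutoffs produce such functions (\<open>null_sequence_exists\<close>).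

The sign of the Laplacian. \<open>\<bar>x\<bar> powr \<tau> \<sdot> \<Delta>G(x) / G(x) powr (p-1)\<close> is an integral of step functions in
the scaled distance \<open>z = \<bar>x-y\<bar>/x\<close>. These converge pointwise, and the two neighbours at equal distance
nearly cancel close to the diagonal, which yields an integrable majorant. So the expression
converges to some \<open>A\<close> by dominated convergence (\<open>scaled_laplacian_convergent\<close>). That \<open>A\<close> is positive
needs no evaluation of the limiting integral: \<open>\<Sum>G\<Delta>G\<close> over \<open>\<bar>x\<bar> \<le> N\<close> is asymptotically \<open>2 A\<close> times
a constant times \<open>log N\<close>, but by Green's formula it is at least the energy of \<open>G\<close> inside the
interval, which grows at least like a positive multiple of \<open>log N\<close> (\<open>scaled_laplacian_limit_pos\<close>).

Truncation. Let \<open>X\<close> be so large that \<open>\<Delta>G > 0\<close> for \<open>\<bar>x\<bar> \<ge> X\<close>, and let \<open>\<epsilon> = G(X)\<close>. Where \<open>G \<ge> \<epsilon>\<close>, the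
function \<open>min G \<epsilon>\<close> attains its maximum, so its Laplacian is positive. Elsewhere truncating \<open>G\<close>
only increases the Laplacian, and by a term of lower order. This yields \<open>w > 0\<close> and the
two-sided bound on \<open>w\<close>. Finally \<open>w u powr p\<close> is at least of order \<open>1/\<bar>x\<bar>\<close>, which is not summable.
\<close>

section \<open>The heat kernel on the integers and the kernels it subordinates\<close>

text \<open>Nearest-neighbour walks of length \<open>n\<close> from \<open>0\<close> to \<open>x\<close>. Since \<open>laplacian2\<close> is \<open>2\<close> minus the adjacency
operator, the heat kernel is \<open>exp (-2t)\<close> times the exponential generating function of these counts,
a series with nonnegative terms.\<close>

fun walks :: "nat \<Rightarrow> int \<Rightarrow> real" where
  "walks 0 x = (if x = 0 then 1 else 0)"
| "walks (Suc n) x = walks n (x - 1) + walks n (x + 1)"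

lemma walks_nonneg: "0 \<le> walks n x"
  by (induction n arbitrary: x) auto

lemma walks_le: "walks n x \<le> 2 ^ n"
proof (induction n arbitrary: x)
  case (Suc n)
  show ?case using Suc[of "x - 1"] Suc[of "x + 1"] by simp
qed auto

lemma walks_uminus: "walks n (- x) = walks n x"
proof (induction n arbitrary: x)
  case (Suc n)
  have "- x - 1 = - (x + 1)" "- x + 1 = - (x - 1)" by simp_all
  then show ?case using Suc by (simp only: walks.simps)
qed auto

text \<open>In terms of Laurent polynomials, the walks of length \<open>n\<close> have generating polynomial
\<open>(z + 1/z)^n\<close>, and multiplication by the end point \<open>x\<close> is the derivation \<open>z d/dz\<close>. The identity is the
chain rule for this derivation. It becomes the Bessel recurrence for the heat kernel.\<close>

lemma walks_position_identity:
  "of_int x * walks (Suc n) x = real (Suc n) * (walks n (x - 1) - walks n (x + 1))"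
proof (induction n arbitrary: x)
  case (Suc n)
  have "of_int x * walks (Suc (Suc n)) x =
      of_int (x - 1) * walks (Suc n) (x - 1) + of_int (x + 1) * walks (Suc n) (x + 1)
      + (walks (Suc n) (x - 1) - walks (Suc n) (x + 1))"
    unfolding walks.simps(2)[of "Suc n" x] by (simp add: algebra_simps)
  also have "\<dots> = real (Suc n) * (walks n (x - 1 - 1) - walks n (x - 1 + 1))
      + real (Suc n) * (walks n (x + 1 - 1) - walks n (x + 1 + 1))
      + (walks (Suc n) (x - 1) - walks (Suc n) (x + 1))"
    by (simp only: Suc)
  also have "\<dots> = real (Suc (Suc n)) * (walks (Suc n) (x - 1) - walks (Suc n) (x + 1))"
    by (simp add: algebra_simps)
  finally show ?case .
qed auto

text \<open>Binomial expansion of \<open>(2 - adjacency)^n\<close>, with the factorials distributed so that the right-hand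
side is the \<open>n\<close>-th term of a Cauchy product. Both sides satisfy the recurrence
\<open>(n+1) c(n+1) = adjacency c(n) - 2 c(n)\<close>.\<close>

lemma laplacian2_power_indicator:
  "(- 1) ^ n / fact n * (laplacian2 ^^ n) (indicator {0}) x =
   (\<Sum>j\<le>n. walks j x / fact j * ((- 2) ^ (n - j) / fact (n - j)))" (is "?l n x = ?c n x")
proof (induction n arbitrary: x)
  case 0
  show ?case by (simp add: indicator_def)
next
  case (Suc n)
  define a where "a j x = walks j x / fact j" for j x
  define b where "b j = (- 2 :: real) ^ j / fact j" for j
  have a: "real (Suc j) * a (Suc j) x = a j (x - 1) + a j (x + 1)" for j x
    by (simp add: a_def field_simps del: of_nat_Suc)
  have b: "real (Suc j) * b (Suc j) = - 2 * b j" for j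
    by (simp add: b_def field_simps del: of_nat_Suc)
  have "real (Suc n) * ?c (Suc n) x = (\<Sum>j\<le>Suc n. real (Suc n) * (a j x * b (Suc n - j)))"
    unfolding sum_distrib_left a_def b_def ..
  also have "\<dots> = (\<Sum>j\<le>Suc n. real j * a j x * b (Suc n - j) + a j x * (real (Suc n - j) * b (Suc n - j)))"
    by (intro sum.cong) (auto simp: of_nat_diff algebra_simps)
  also have "\<dots> = (\<Sum>j\<le>Suc n. real j * a j x * b (Suc n - j))
      + (\<Sum>j\<le>Suc n. a j x * (real (Suc n - j) * b (Suc n - j)))"
    by (rule sum.distrib)
  also have "(\<Sum>j\<le>Suc n. real j * a j x * b (Suc n - j)) = (\<Sum>j\<le>n. (a j (x - 1) + a j (x + 1)) * b (n - j))"
    unfolding sum.atMost_Suc_shift by (simp add: a[symmetric] del: of_nat_Suc)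
  also have "(\<Sum>j\<le>Suc n. a j x * (real (Suc n - j) * b (Suc n - j))) = (\<Sum>j\<le>n. a j x * (- 2 * b (n - j)))"
    unfolding sum.atMost_Suc using b by (simp add: Suc_diff_le del: of_nat_Suc)
  also have "(\<Sum>j\<le>n. (a j (x - 1) + a j (x + 1)) * b (n - j)) + (\<Sum>j\<le>n. a j x * (- 2 * b (n - j)))
      = ?c n (x - 1) + ?c n (x + 1) - 2 * ?c n x"
    by (simp add: a_def b_def algebra_simps sum.distrib sum_distrib_left sum_negf)
  also have "\<dots> = ?l n (x - 1) + ?l n (x + 1) - 2 * ?l n x"
    by (simp only: Suc)
  also have "\<dots> = real (Suc n) * ?l (Suc n) x"
    by (simp add: laplacian2_def field_simps del: of_nat_Suc)
  finally have "real (Suc n) * ?c (Suc n) x = real (Suc n) * ?l (Suc n) x" .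
  then have "real (Suc n) = 0 \<or> ?c (Suc n) x = ?l (Suc n) x"
    by (rule mult_cancel_left[THEN iffD1])
  moreover have "real (Suc n) \<noteq> 0" by simp
  ultimately have "?c (Suc n) x = ?l (Suc n) x" by blast
  then show ?case by (rule sym)
qed

text \<open>The modified Bessel function \<open>I\<close> of order \<open>\<bar>x\<bar>\<close> at \<open>2t\<close>.\<close>

definition walk_gf :: "int \<Rightarrow> real \<Rightarrow> real" where
  "walk_gf x t = (\<Sum>n. walks n x / fact n * t ^ n)"

lemma summable_norm_walks: "summable (\<lambda>n. norm (walks n x / fact n * t ^ n))"
proof (rule summable_comparison_test)
  show "\<exists>N. \<forall>n\<ge>N. norm (norm (walks n x / fact n * t ^ n)) \<le> (2 * \<bar>t\<bar>) ^ n /\<^sub>R fact n"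
    using walks_le walks_nonneg
    by (auto simp: abs_mult power_mult_distrib power_abs divide_simps intro!: mult_right_mono)
  show "summable (\<lambda>n. (2 * \<bar>t\<bar>) ^ n /\<^sub>R fact n)"
    by (rule summable_exp_generic)
qed

lemma summable_walks: "summable (\<lambda>n. walks n x / fact n * t ^ n)"
  using summable_norm_walks by (rule summable_norm_cancel)

lemma heat_kernel_eq: "heat_kernel t x 0 = exp (- 2 * t) * walk_gf x t"
proof -
  have e: "summable (\<lambda>n. norm ((- 2 * t) ^ n / fact n))"
    using summable_exp[of "\<bar>- 2 * t\<bar>"] by (simp add: power_abs abs_mult divide_inverse mult.commute)
  have e': "(\<Sum>n. (- 2 * t) ^ n / fact n) = exp (- 2 * t)"
    unfolding exp_def by (simp add: divide_inverse mult.commute)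
  have "walk_gf x t * exp (- 2 * t) =
      (\<Sum>k. \<Sum>i\<le>k. walks i x / fact i * t ^ i * ((- 2 * t) ^ (k - i) / fact (k - i)))"
    unfolding walk_gf_def e'[symmetric]
    by (rule Cauchy_product[OF summable_norm_walks e])
  also have "\<dots> = (\<Sum>k. t ^ k * (\<Sum>i\<le>k. walks i x / fact i * ((- 2) ^ (k - i) / fact (k - i))))"
  proof (rule suminf_cong)
    fix k
    have "t ^ i * (- 2 * t) ^ (k - i) = t ^ k * (- 2) ^ (k - i)" if "i \<le> k" for i
    proof -
      have "t ^ i * (- 2 * t) ^ (k - i) = (t ^ i * t ^ (k - i)) * (- 2) ^ (k - i)"
        unfolding power_mult_distrib[of "- 2" t] by simp
      then show ?thesis using that by (simp add: power_add[symmetric])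
    qed
    then show "(\<Sum>i\<le>k. walks i x / fact i * t ^ i * ((- 2 * t) ^ (k - i) / fact (k - i))) =
        t ^ k * (\<Sum>i\<le>k. walks i x / fact i * ((- 2) ^ (k - i) / fact (k - i)))"
      unfolding sum_distrib_left
      by (intro sum.cong refl) (auto simp: divide_simps mult.assoc mult.left_commute)
  qed
  also have "\<dots> = heat_kernel t x 0"
    unfolding heat_kernel_def heat_semigroup_def laplacian2_power_indicator[symmetric]
    by (intro suminf_cong) (simp add: power_minus[of t] mult.assoc)
  finally show ?thesis by (simp add: mult.commute)
qed

lemma walk_gf_deriv:
  "(walk_gf x has_real_derivative walk_gf (x - 1) t + walk_gf (x + 1) t) (at t)"
proof -
  have "((\<lambda>t. \<Sum>n. walks n x / fact n * t ^ n) has_real_derivative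
      (\<Sum>n. diffs (\<lambda>n. walks n x / fact n) n * t ^ n)) (at t)"
    by (rule termdiffs_strong_converges_everywhere) (rule summable_walks)
  moreover have "(\<Sum>n. diffs (\<lambda>n. walks n x / fact n) n * t ^ n) =
      (\<Sum>n. walks n (x - 1) / fact n * t ^ n + walks n (x + 1) / fact n * t ^ n)"
    by (intro suminf_cong) (simp add: diffs_def divide_simps algebra_simps del: of_nat_Suc)
  ultimately show ?thesis
    unfolding walk_gf_def[abs_def] suminf_add[OF summable_walks summable_walks] by (simp only:)
qed

lemma walk_gf_position_identity: "t * (walk_gf (x - 1) t - walk_gf (x + 1) t) = of_int x * walk_gf x t"
proof -
  have s: "summable (\<lambda>n. of_int x * (walks n x / fact n * t ^ n))"
    by (intro summable_mult summable_walks)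
  have "of_int x * walk_gf x t = (\<Sum>n. of_int x * (walks n x / fact n * t ^ n))"
    unfolding walk_gf_def by (rule suminf_mult[symmetric]) (rule summable_walks)
  also have "\<dots> = (\<Sum>n. of_int x * (walks (Suc n) x / fact (Suc n) * t ^ Suc n))"
    using suminf_split_head[OF s] by simp
  also have "\<dots> = (\<Sum>n. t * (walks n (x - 1) / fact n * t ^ n - walks n (x + 1) / fact n * t ^ n))"
  proof (rule suminf_cong)
    fix n
    have "of_int x * (walks (Suc n) x / fact (Suc n) * t ^ Suc n)
        = (of_int x * walks (Suc n) x) * (t ^ Suc n / fact (Suc n))" by simp
    also have "\<dots> = t * (walks n (x - 1) / fact n * t ^ n - walks n (x + 1) / fact n * t ^ n)"
      unfolding walks_position_identity by (simp add: divide_simps algebra_simps del: of_nat_Suc)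
    finally show "of_int x * (walks (Suc n) x / fact (Suc n) * t ^ Suc n) =
        t * (walks n (x - 1) / fact n * t ^ n - walks n (x + 1) / fact n * t ^ n)" .
  qed
  also have "\<dots> = t * (walk_gf (x - 1) t - walk_gf (x + 1) t)"
    unfolding walk_gf_def suminf_diff[OF summable_walks summable_walks]
    by (intro suminf_mult summable_diff summable_walks)
  finally show ?thesis by simp
qed

lemma walk_gf_uminus: "walk_gf (- x) t = walk_gf x t"
  by (simp add: walk_gf_def walks_uminus)

lemma walk_gf_nonneg: "0 \<le> t \<Longrightarrow> 0 \<le> walk_gf x t"
  unfolding walk_gf_def by (intro suminf_nonneg summable_walks) (auto simp: walks_nonneg)

lemma walk_gf_ge: "0 \<le> t \<Longrightarrow> walks n x / fact n * t ^ n \<le> walk_gf x t"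
  unfolding walk_gf_def
  using sum_le_suminf[OF summable_walks, of "{n}" x t] by (auto simp: walks_nonneg)

lemma walk_gf_le:
  assumes "0 \<le> t"
  shows "walk_gf x t \<le> exp (2 * t)"
proof -
  have s: "summable (\<lambda>n. (2 * t) ^ n / fact n)"
    using summable_exp[of "2 * t"] by (simp add: divide_inverse mult.commute)
  have "walk_gf x t \<le> (\<Sum>n. (2 * t) ^ n / fact n)"
    unfolding walk_gf_def using walks_le assms
    by (intro suminf_le summable_walks s) (auto simp: power_mult_distrib divide_simps intro!: mult_right_mono)
  also have "\<dots> = exp (2 * t)"
    unfolding exp_def by (simp add: divide_inverse mult.commute)
  finally show ?thesis .
qed

text \<open>A walk that ends away from \<open>0\<close> has positive length, so the series has no constant term. The bound
makes the Mellin integral converge at \<open>0\<close> for the exponents that occur off the diagonal.\<close>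

lemma walk_gf_le_linear:
  assumes "0 \<le> t" "t \<le> 1" "x \<noteq> 0"
  shows "walk_gf x t \<le> t * exp 2"
proof -
  have s: "summable (\<lambda>n. t * (walks n x / fact n * 1 ^ n))"
    by (intro summable_mult summable_walks)
  have "walks n x / fact n * t ^ n \<le> t * (walks n x / fact n * 1 ^ n)" for n
  proof (cases n)
    case 0
    then show ?thesis using assms by simp
  next
    case (Suc k)
    have "t ^ n \<le> t * 1"
      unfolding Suc power_Suc using assms by (intro mult_left_mono power_le_one) auto
    then have "walks n x / fact n * t ^ n \<le> walks n x / fact n * (t * 1)"
      by (intro mult_left_mono) (auto simp: walks_nonneg)
    then show ?thesis by (simp add: mult_ac)
  qed
  then have "walk_gf x t \<le> (\<Sum>n. t * (walks n x / fact n * 1 ^ n))"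
    unfolding walk_gf_def by (intro suminf_le summable_walks s)
  also have "\<dots> = t * walk_gf x 1"
    unfolding walk_gf_def by (intro suminf_mult summable_walks)
  also have "\<dots> \<le> t * exp 2"
    using walk_gf_le[of 1 x] assms by (intro mult_left_mono) auto
  finally show ?thesis .
qed


text \<open>The heat kernel \<open>p_t(x,0)\<close> as a function of \<open>x\<close> and \<open>t\<close>.\<close>

definition heat :: "int \<Rightarrow> real \<Rightarrow> real" where
  "heat x t = exp (- 2 * t) * walk_gf x t"

lemma heat_deriv:
  "(heat x has_real_derivative heat (x - 1) t + heat (x + 1) t - 2 * heat x t) (at t)"
  unfolding heat_def[abs_def]
  by (rule derivative_eq_intros walk_gf_deriv refl)+ (simp add: algebra_simps)

lemma heat_position_identity: "t * (heat (x - 1) t - heat (x + 1) t) = of_int x * heat x t"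
  using arg_cong[OF walk_gf_position_identity[of t x], of "\<lambda>z. exp (- 2 * t) * z"]
  by (simp add: heat_def algebra_simps)

lemma heat_uminus: "heat (- x) t = heat x t"
  by (simp add: heat_def walk_gf_uminus)

lemma continuous_on_heat [continuous_intros]: "continuous_on A (heat x)"
  using heat_deriv DERIV_isCont continuous_at_imp_continuous_on by blast

lemma heat_nonneg: "0 \<le> t \<Longrightarrow> 0 \<le> heat x t"
  by (simp add: heat_def walk_gf_nonneg)

lemma heat_le_1: "0 \<le> t \<Longrightarrow> heat x t \<le> 1"
  using mult_left_mono[OF walk_gf_le[of t x], of "exp (- 2 * t)"]
  by (simp add: heat_def exp_minus)

lemma heat_le_linear:
  assumes "0 \<le> t" "x \<noteq> 0"
  shows "heat x t \<le> exp 2 * t"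
proof (cases "t \<le> 1")
  case False
  have "heat x t \<le> 1" using assms by (intro heat_le_1)
  also have "1 \<le> exp 2 * t"
    using False mult_mono[of 1 "exp 2" 1 t] by simp
  finally show ?thesis .
next
  case a: True
  have "exp (- 2 * t) * walk_gf x t \<le> 1 * (t * exp 2)"
    using a assms by (intro mult_mono walk_gf_le_linear walk_gf_nonneg) auto
  then show ?thesis by (simp add: heat_def mult.commute)
qed

lemma heat_0_pos: "0 \<le> t \<Longrightarrow> 0 < heat 0 t"
  using walk_gf_ge[of t 0 0] by (simp add: heat_def)

lemma heat_1_pos: "0 < t \<Longrightarrow> 0 < heat 1 t"
  using walk_gf_ge[of t 1 1] by (simp add: heat_def)

text \<open>The difference \<open>d = heat 0 - heat 1\<close> satisfies \<open>d' = -4d + heat 1 / t\<close>, and the inhomogeneity is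
nonnegative.\<close>

lemma heat_1_le_heat_0:
  assumes "0 \<le> t"
  shows "heat 1 t \<le> heat 0 t"
proof (cases "t = 0")
  case True
  have "walk_gf x 0 = walks 0 x" for x
    unfolding walk_gf_def using powser_zero[of "\<lambda>n. walks n x / fact n"] by simp
  then show ?thesis using True by (simp add: heat_def)
next
  case False
  \<comment> \<open>The integrating factor of the equation for \<open>d\<close>.\<close>
  define f where "f s = exp (4 * s) * (heat 0 s - heat 1 s)" for s
  have "f 0 \<le> f t"
  proof (rule DERIV_nonneg_imp_nondecreasing[OF assms])
    fix s assume s: "0 \<le> s" "s \<le> t"
    have d: "(f has_real_derivative exp (4 * s) * (heat 0 s - heat 2 s)) (at s)"
      unfolding f_def[abs_def]
      by (rule derivative_eq_intros heat_deriv refl)+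
         (simp add: algebra_simps heat_uminus[of 1, simplified])
    have "0 \<le> heat 0 s - heat 2 s"
    proof (cases "s = 0")
      case True
      then show ?thesis
        using heat_nonneg[of 0 0] heat_le_linear[of 0 2] by simp
    next
      case False
      then show ?thesis
        using heat_position_identity[of s 1] heat_nonneg[of s 1] s zero_le_mult_iff[of s "heat 0 s - heat 2 s"] by simp
    qed
    then show "\<exists>y. (f has_real_derivative y) (at s) \<and> 0 \<le> y"
      using d by (intro exI conjI) auto
  qed
  moreover have "f 0 \<ge> 0"
    using heat_nonneg[of 0 0] heat_le_linear[of 0 1] by (simp add: f_def)
  ultimately have "0 \<le> exp (4 * t) * (heat 0 t - heat 1 t)" by (simp add: f_def)
  then show ?thesis by (simp add: zero_le_mult_iff)
qed

text \<open>The heat equation and the Bessel recurrence involve the neighbours \<open>x-1\<close> and \<open>x+2\<close>. In the sum of two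
adjacent values these cancel, and a first-order system in \<open>heat x\<close> and \<open>heat (x+1)\<close> remains. Integrated
over \<open>(0,\<infinity>)\<close> it is the recurrence for the kernels.\<close>

lemma heat_sum_deriv:
  assumes "0 < t"
  shows "((\<lambda>t. t powr (- \<rho>) * (heat x t + heat (x + 1) t)) has_real_derivative
    t powr (- \<rho> - 1) * ((of_int x - \<rho>) * heat x t - (of_int x + 1 + \<rho>) * heat (x + 1) t)) (at t)"
proof -
  have m1: "t * heat (x - 1) t = of_int x * heat x t + t * heat (x + 1) t"
    using heat_position_identity[of t x] by (simp add: algebra_simps)
  have m2: "t * heat (x + 2) t = t * heat x t - (of_int x + 1) * heat (x + 1) t"
    using heat_position_identity[of t "x + 1"] by (simp add: algebra_simps)
  have p: "t powr (- \<rho>) = t * t powr (- \<rho> - 1)"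
    using assms by (simp add: powr_diff)
  have "t powr (- \<rho>) * (heat (x - 1) t + heat (x + 1) t - 2 * heat x t + (heat x t + heat (x + 2) t - 2 * heat (x + 1) t))
      = t powr (- \<rho> - 1) * (t * heat (x - 1) t - t * heat (x + 1) t - t * heat x t + t * heat (x + 2) t)"
    unfolding p by (simp add: algebra_simps)
  also have "\<dots> = t powr (- \<rho> - 1) * (of_int x * heat x t - (of_int x + 1) * heat (x + 1) t)"
    unfolding m1 m2 by (simp add: algebra_simps)
  finally have e: "t powr (- \<rho>) * (heat (x - 1) t + heat (x + 1) t - 2 * heat x t + (heat x t + heat (x + 2) t - 2 * heat (x + 1) t))
    = t powr (- \<rho> - 1) * (of_int x * heat x t - (of_int x + 1) * heat (x + 1) t)" .
  have "((\<lambda>t. t powr (- \<rho>)) has_real_derivative - \<rho> * t powr (- \<rho> - 1)) (at t)"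
    using assms by (auto intro!: derivative_eq_intros)
  from DERIV_mult[OF this DERIV_add[OF heat_deriv[of x] heat_deriv[of "x + 1"]]]
  show ?thesis
  proof (rule DERIV_cong)
    have i: "x + 1 - 1 = x" "x + 1 + 1 = x + 2" by simp_all
    show "- \<rho> * t powr (- \<rho> - 1) * (heat x t + heat (x + 1) t) +
        (heat (x - 1) t + heat (x + 1) t - 2 * heat x t + (heat (x + 1 - 1) t + heat (x + 1 + 1) t - 2 * heat (x + 1) t)) * t powr (- \<rho>) =
        t powr (- \<rho> - 1) * ((of_int x - \<rho>) * heat x t - (of_int x + 1 + \<rho>) * heat (x + 1) t)"
      unfolding i mult.commute[of _ "t powr (- \<rho>)"] e by (simp add: algebra_simps)
  qed
qed

text \<open>By \<open>heat_sum_deriv\<close> with \<open>\<rho> = -1/2\<close>, the derivative of \<open>sqrt t * (heat 0 + heat 1)\<close> is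
\<open>(heat 0 - heat 1) / (2 sqrt t)\<close>, and for \<open>t \<ge> 1\<close> this is at most minus the derivative of \<open>heat 0 / 4\<close>.
This gives the decay rate without Fourier analysis.\<close>

lemma heat_decay_0:
  assumes "1 \<le> t"
  shows "heat 0 t + heat 1 t \<le> 3 * t powr (- 1 / 2)"
proof -
  define f where "f s = s powr (1 / 2) * (heat 0 s + heat 1 s) + heat 0 s / 4" for s
  have "f t \<le> f 1"
  proof (rule DERIV_nonpos_imp_nonincreasing[OF assms])
    fix s :: real assume s: "1 \<le> s" "s \<le> t"
    have d: "(f has_real_derivative s powr (- 1 / 2) * (1/2 * (heat 0 s - heat 1 s)) + (2 * heat 1 s - 2 * heat 0 s) / 4) (at s)"
      using DERIV_add[OF heat_sum_deriv[of s "- 1/2" 0] DERIV_cdivide[OF heat_deriv[of 0], of 4]] s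
      unfolding f_def[abs_def] by (simp add: heat_uminus[of 1, simplified] algebra_simps)
    have "s powr (- 1 / 2) * (1/2 * (heat 0 s - heat 1 s)) \<le> 1 * (1/2 * (heat 0 s - heat 1 s))"
      using s heat_1_le_heat_0[of s] powr_mono[of "-1/2" 0 s]
      by (intro mult_right_mono) auto
    then show "\<exists>y. (f has_real_derivative y) (at s) \<and> y \<le> 0"
      using d by (intro exI[of _ "s powr (- 1 / 2) * (1/2 * (heat 0 s - heat 1 s)) + (2 * heat 1 s - 2 * heat 0 s) / 4"] conjI)
        argo+
  qed
  also have "f 1 \<le> 3"
    using heat_le_1[of 1 0] heat_le_1[of 1 1] by (simp add: f_def)
  finally have "t powr (1 / 2) * (heat 0 t + heat 1 t) \<le> 3"
    using heat_nonneg[of t 0] assms by (simp add: f_def)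
  then show ?thesis
    using assms by (simp add: powr_minus field_simps)
qed

lemma heat_decay:
  assumes "1 \<le> t" "0 \<le> x"
  shows "heat x t \<le> 3 * t powr (- 1 / 2)"
proof -
  have "heat (int n) t \<le> heat 0 t + heat 1 t" for n
  proof (induction n rule: less_induct)
    case (less n)
    consider "n = 0" | "n = 1" | k where "n = k + 2" by (metis One_nat_def add_2_eq_Suc' not0_implies_Suc)
    then show ?case
    proof cases
      case (3 k)
      have "0 \<le> t * (heat (int k) t - heat (int k + 2) t)"
        using heat_position_identity[of t "int k + 1"] heat_nonneg[of t "int k + 1"] assms by (simp add: algebra_simps)
      then have "heat (int k + 2) t \<le> heat (int k) t"
        using assms by (simp add: zero_le_mult_iff)
      with less[of k] 3 show ?thesis by (simp add: algebra_simps)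
    qed (use heat_nonneg[of t] assms in auto)
  qed
  from this[of "nat x"] heat_decay_0[OF assms(1)] assms(2) show ?thesis by simp
qed


lemma set_integrable_powr_at_0:
  fixes c e :: real
  assumes "- 1 < e" "0 < c"
  shows "set_integrable lborel {0<..<c} (\<lambda>t. t powr e)"
proof -
  define F where "F t = t powr (e + 1) / (e + 1)" for t :: real
  have "set_integrable lborel (einterval 0 c) (\<lambda>t. t powr e)"
  proof (rule interval_integral_FTC_nonneg[where F = F and A = 0 and B = "F c"])
    fix t :: real assume "0 < ereal t" "ereal t < ereal c"
    then have t: "0 < t" by simp
    show "(F has_real_derivative t powr e) (at t)"
      unfolding F_def[abs_def] using t assms by (auto intro!: derivative_eq_intros)
    show "isCont (\<lambda>t. t powr e) t" using t by (auto intro!: continuous_intros)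
  next
    have "(F \<longlongrightarrow> F 0) (at_right 0)" "(F \<longlongrightarrow> F c) (at_left c)"
      unfolding F_def[abs_def] using assms
      by (auto intro!: tendsto_eq_intros simp: eventually_at_right_less)
         (auto intro: eventually_at_rightI[of 0 1])
    then show "((F \<circ> real_of_ereal) \<longlongrightarrow> 0) (at_right 0)" "((F \<circ> real_of_ereal) \<longlongrightarrow> F c) (at_left (ereal c))"
      using assms by (auto simp: ereal_tendsto_simps F_def zero_ereal_def)
  qed (use assms in auto)
  moreover have "einterval 0 c = {0<..<c}"
    by (auto simp: einterval_def zero_ereal_def)
  ultimately show ?thesis by simp
qed

lemma set_integrable_powr_at_top:
  fixes c e :: real
  assumes "e < - 1" "0 < c"
  shows "set_integrable lborel {c<..} (\<lambda>t. t powr e)"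
proof -
  define F where "F t = t powr (e + 1) / (e + 1)" for t :: real
  have "set_integrable lborel (einterval c \<infinity>) (\<lambda>t. t powr e)"
  proof (rule interval_integral_FTC_nonneg[where F = F and A = "F c" and B = 0])
    fix t :: real assume "ereal c < ereal t"
    then have t: "0 < t" using assms by simp
    show "(F has_real_derivative t powr e) (at t)"
      unfolding F_def[abs_def] using t assms by (auto intro!: derivative_eq_intros)
    show "isCont (\<lambda>t. t powr e) t" using t by (auto intro!: continuous_intros)
  next
    have "(F \<longlongrightarrow> F c) (at_right c)"
      unfolding F_def[abs_def] using assms by (auto intro!: tendsto_eq_intros)
    then show "((F \<circ> real_of_ereal) \<longlongrightarrow> F c) (at_right (ereal c))"
      by (simp add: ereal_tendsto_simps)
    have "((\<lambda>t :: real. t powr (e + 1)) \<longlongrightarrow> 0) at_top"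
      using assms by (intro tendsto_neg_powr filterlim_ident) auto
    from tendsto_divide[OF this tendsto_const[of "e + 1"]]
    show "((F \<circ> real_of_ereal) \<longlongrightarrow> 0) (at_left \<infinity>)"
      using assms by (simp add: ereal_tendsto_simps F_def[abs_def])
  qed (use assms in auto)
  moreover have "einterval c \<infinity> = {c<..}"
    by (auto simp: einterval_def)
  ultimately show ?thesis by simp
qed

text \<open>Up to a Gamma factor this is the kernel \<open>kappa\<close>, with \<open>\<rho> = r\<beta>/2\<close>.\<close>

definition heat_mellin :: "real \<Rightarrow> int \<Rightarrow> real" where
  "heat_mellin \<rho> x = (LINT t:{0<..}|lborel. heat x t / t powr (1 + \<rho>))"

lemma heat_mellin_integrable:
  assumes "- (1 / 2) < \<rho>" "\<rho> < 0 \<or> \<rho> < 1 \<and> x \<noteq> 0" "0 \<le> x"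
  shows "set_integrable lborel {0<..} (\<lambda>t. heat x t / t powr (1 + \<rho>))"
proof -
  have m: "set_borel_measurable lborel A (\<lambda>t. heat x t / t powr (1 + \<rho>))" if "A \<in> sets borel" for A
  proof -
    have "heat x \<in> borel_measurable borel"
      by (intro borel_measurable_continuous_onI continuous_on_heat)
    then show ?thesis
      unfolding set_borel_measurable_def using that by measurable
  qed
  \<comment> \<open>Integrability at \<open>0\<close>: for \<open>\<rho> < 0\<close> the trivial bound on the heat kernel suffices, for \<open>\<rho> \<ge> 0\<close> the linear one is needed.\<close>
  obtain C e where C: "0 \<le> C" "- 1 < e" "\<And>t. 0 < t \<Longrightarrow> heat x t / t powr (1 + \<rho>) \<le> C * t powr e"
  proof (cases "\<rho> < 0")
    case True
    show ?thesis
    proof (rule that[of 1 "- (1 + \<rho>)"])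
      show "heat x t / t powr (1 + \<rho>) \<le> 1 * t powr (- (1 + \<rho>))" if "0 < t" for t
        unfolding powr_minus_divide using that heat_le_1[of t x] by (simp add: divide_right_mono)
    qed (use True in auto)
  next
    case False
    show ?thesis
    proof (rule that[of "exp 2" "- \<rho>"])
      show "heat x t / t powr (1 + \<rho>) \<le> exp 2 * t powr (- \<rho>)" if "0 < t" for t
      proof -
        have "heat x t / t powr (1 + \<rho>) \<le> exp 2 * t / t powr (1 + \<rho>)"
          using False assms that by (intro divide_right_mono heat_le_linear) auto
        also have "\<dots> = exp 2 * t powr (- \<rho>)"
          using that by (simp add: powr_add powr_minus field_simps)
        finally show ?thesis .
      qed
    qed (use False assms in auto)
  qed
  have "set_integrable lborel {0<..<2} (\<lambda>t. heat x t / t powr (1 + \<rho>))"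
  proof (rule set_integrable_bound[OF _ m])
    show "set_integrable lborel {0<..<2} (\<lambda>t. C * t powr e)"
      using C(2) by (intro set_integrable_mult_right set_integrable_powr_at_0) auto
    show "AE t in lborel. t \<in> {0<..<2} \<longrightarrow> norm (heat x t / t powr (1 + \<rho>)) \<le> norm (C * t powr e)"
      using C heat_nonneg by (auto simp: abs_mult)
  qed auto
  moreover have "set_integrable lborel {1<..} (\<lambda>t. heat x t / t powr (1 + \<rho>))"
  proof (rule set_integrable_bound[OF _ m])
    show "set_integrable lborel {1<..} (\<lambda>t. 3 * t powr (- \<rho> - 3 / 2))"
    proof (intro set_integrable_mult_right set_integrable_powr_at_top)
      show "- \<rho> - 3 / 2 < - 1" using assms(1) by argo
    qed simp_all
    have "heat x t / t powr (1 + \<rho>) \<le> 3 * t powr (- \<rho> - 3 / 2)" if "1 < t" for t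
    proof -
      have "heat x t / t powr (1 + \<rho>) \<le> (3 * t powr (- 1 / 2)) / t powr (1 + \<rho>)"
        using that assms by (intro divide_right_mono heat_decay) auto
      also have "\<dots> = 3 * t powr (- 1 / 2 - (1 + \<rho>))" by (simp only: powr_diff times_divide_eq_right)
      also have "\<dots> = 3 * t powr (- \<rho> - 3 / 2)" by (simp add: algebra_simps)
      finally show ?thesis .
    qed
    then show "AE t in lborel. t \<in> {1<..} \<longrightarrow> norm (heat x t / t powr (1 + \<rho>)) \<le> norm (3 * t powr (- \<rho> - 3 / 2))"
      using heat_nonneg by (auto simp: abs_mult)
  qed auto
  ultimately have "set_integrable lborel ({0<..<2} \<union> {1<..}) (\<lambda>t. heat x t / t powr (1 + \<rho>))"
    by (rule set_integrable_Un) auto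
  moreover have "{0<..<2} \<union> {1<..} = {0::real<..}" by auto
  ultimately show ?thesis by simp
qed

lemma heat_mellin_pos:
  assumes "- (1 / 2) < \<rho>" "\<rho> < 0 \<and> x = 0 \<or> \<rho> < 1 \<and> x = 1"
  shows "0 < heat_mellin \<rho> x"
proof -
  let ?f = "\<lambda>t. heat x t / t powr (1 + \<rho>)"
  have i: "set_integrable lborel {0<..} ?f"
    using assms by (intro heat_mellin_integrable) auto
  have p: "0 < t \<Longrightarrow> heat x t \<noteq> 0" for t
    using assms heat_0_pos[of t] heat_1_pos[of t] by auto
  have "0 \<le> heat_mellin \<rho> x"
    unfolding heat_mellin_def set_lebesgue_integral_def
    by (intro integral_nonneg_AE) (auto simp: indicator_def heat_nonneg)
  moreover have "heat_mellin \<rho> x \<noteq> 0"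
  proof
    assume "heat_mellin \<rho> x = 0"
    then have "AE t in lborel. indicator {0<..} t *\<^sub>R ?f t = 0"
      using i unfolding heat_mellin_def set_lebesgue_integral_def set_integrable_def
      by (subst (asm) integral_nonneg_eq_0_iff_AE) (auto simp: indicator_def heat_nonneg)
    then have "AE t in lborel. t \<notin> {0::real<..<1}"
      by eventually_elim (use p in \<open>auto simp: indicator_def split: if_splits\<close>)
    then have "emeasure lborel {0::real<..<1} = 0"
      by (subst (asm) AE_iff_measurable[of "{0<..<1}"]) auto
    then show False by simp
  qed
  ultimately show ?thesis by simp
qed

text \<open>The fundamental theorem of calculus for \<open>heat_sum_deriv\<close>. The boundary terms vanish because of the
decay of order \<open>-1/2\<close> at infinity and, for \<open>\<rho> \<ge> 0\<close>, the linear bound at \<open>0\<close>.\<close>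

lemma heat_mellin_rec:
  assumes \<rho>: "- (1 / 2) < \<rho>" "\<rho> < 0 \<or> \<rho> < 1 \<and> x \<noteq> 0" and x: "0 \<le> x"
  shows "(of_int x + 1 + \<rho>) * heat_mellin \<rho> (x + 1) = (of_int x - \<rho>) * heat_mellin \<rho> x"
proof -
  let ?f = "\<lambda>x t. heat x t / t powr (1 + \<rho>)"
  let ?F = "\<lambda>t. t powr (- \<rho>) * (heat x t + heat (x + 1) t)"
  let ?g = "\<lambda>t. (of_int x - \<rho>) * ?f x t - (of_int x + 1 + \<rho>) * ?f (x + 1) t"
  have e: "einterval 0 \<infinity> = {0<..}" by (auto simp: einterval_def zero_ereal_def)
  have i: "set_integrable lborel {0<..} (?f x)" "set_integrable lborel {0<..} (?f (x + 1))"
    using assms by (auto intro!: heat_mellin_integrable)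
  have "(LBINT t=0..\<infinity>. ?g t) = 0 - 0"
  proof (rule interval_integral_FTC_integrable[where F = ?F])
    fix t :: real assume "0 < ereal t"
    then have t: "0 < t" by (simp add: zero_ereal_def)
    have "t powr (- \<rho> - 1) * ((of_int x - \<rho>) * heat x t - (of_int x + 1 + \<rho>) * heat (x + 1) t) = ?g t"
      using t by (simp add: powr_diff powr_add powr_minus field_simps)
    with heat_sum_deriv[OF t, of \<rho> x] show "(?F has_vector_derivative ?g t) (at t)"
      by (simp add: has_real_derivative_iff_has_vector_derivative)
    show "isCont ?g t"
      using t DERIV_isCont[OF heat_deriv] by (auto intro!: continuous_intros)
  next
    show "set_integrable lborel (einterval 0 \<infinity>) ?g"
      unfolding e using i by (intro set_integral_diff set_integrable_mult_right) auto
    have "(?F \<longlongrightarrow> 0) (at_right 0)"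
    proof (rule tendsto_sandwich[of "\<lambda>_. 0" _ _ "\<lambda>t. 2 * exp 2 * t powr (if \<rho> < 0 then - \<rho> else 1 - \<rho>)"])
      have ev: "eventually (\<lambda>t :: real. 0 < t) (at_right 0)"
        by (simp add: eventually_at_right_less)
      show "eventually (\<lambda>t. 0 \<le> ?F t) (at_right 0)"
        using ev by eventually_elim (auto intro!: mult_nonneg_nonneg add_nonneg_nonneg heat_nonneg)
      show "eventually (\<lambda>t. ?F t \<le> 2 * exp 2 * t powr (if \<rho> < 0 then - \<rho> else 1 - \<rho>)) (at_right 0)"
        using ev
      proof eventually_elim
        case (elim t)
        show ?case
        proof (cases "\<rho> < 0")
          case True
          have "1 \<le> exp (2 :: real)" by simp
          then have "heat x t + heat (x + 1) t \<le> 2 * exp 2"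
            using elim heat_le_1[of t x] heat_le_1[of t "x + 1"] by linarith
          then have "t powr (- \<rho>) * (heat x t + heat (x + 1) t) \<le> t powr (- \<rho>) * (2 * exp 2)"
            by (intro mult_left_mono) auto
          then show ?thesis using True by (simp add: mult_ac)
        next
          case False
          have "heat x t + heat (x + 1) t \<le> 2 * exp 2 * t"
            using elim heat_le_linear[of t x] heat_le_linear[of t "x + 1"] False assms by auto
          then have "t powr (- \<rho>) * (heat x t + heat (x + 1) t) \<le> t powr (- \<rho>) * (2 * exp 2 * t)"
            by (intro mult_left_mono) auto
          also have "\<dots> = 2 * exp 2 * t powr (1 - \<rho>)"
            using elim by (simp add: powr_diff powr_minus field_simps)
          finally show ?thesis using False by simp
        qed
      qed
      show "((\<lambda>t. 2 * exp 2 * t powr (if \<rho> < 0 then - \<rho> else 1 - \<rho>)) \<longlongrightarrow> 0) (at_right 0)"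
        using assms by (auto intro!: tendsto_eq_intros simp: eventually_at_right_less)
           (auto intro!: eventually_at_rightI[of 0 1])
    qed auto
    then show "((?F \<circ> real_of_ereal) \<longlongrightarrow> 0) (at_right 0)"
      by (simp add: ereal_tendsto_simps zero_ereal_def)
    have "(?F \<longlongrightarrow> 0) at_top"
    proof (rule tendsto_sandwich[of "\<lambda>_. 0" _ _ "\<lambda>t. 6 * t powr (- \<rho> - 1 / 2)"])
      have ev: "eventually (\<lambda>t :: real. 1 \<le> t) at_top" by simp
      show "eventually (\<lambda>t. 0 \<le> ?F t) at_top"
        using ev by eventually_elim (auto intro!: mult_nonneg_nonneg add_nonneg_nonneg heat_nonneg)
      show "eventually (\<lambda>t. ?F t \<le> 6 * t powr (- \<rho> - 1 / 2)) at_top"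
        using ev
      proof eventually_elim
        case (elim t)
        have "heat x t + heat (x + 1) t \<le> 6 * t powr (- 1 / 2)"
          using heat_decay[of t x] heat_decay[of t "x + 1"] elim x by simp
        then have "t powr (- \<rho>) * (heat x t + heat (x + 1) t) \<le> t powr (- \<rho>) * (6 * t powr (- 1 / 2))"
          by (intro mult_left_mono) auto
        also have "\<dots> = 6 * t powr (- \<rho> + - 1 / 2)"
          by (simp only: powr_add mult_ac)
        finally show ?case by simp
      qed
      have "((\<lambda>t. t powr (- \<rho> - 1 / 2)) \<longlongrightarrow> 0) at_top"
        using assms by (intro tendsto_neg_powr filterlim_ident) auto
      from tendsto_mult_right_zero[OF this] show "((\<lambda>t. 6 * t powr (- \<rho> - 1 / 2)) \<longlongrightarrow> 0) at_top" .
    qed auto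
    then show "((?F \<circ> real_of_ereal) \<longlongrightarrow> 0) (at_left \<infinity>)"
      by (simp add: ereal_tendsto_simps)
  qed auto
  then have "(LINT t:{0<..}|lborel. ?g t) = 0"
    by (simp add: interval_lebesgue_integral_def e)
  also have "(LINT t:{0<..}|lborel. ?g t) =
      (of_int x - \<rho>) * heat_mellin \<rho> x - (of_int x + 1 + \<rho>) * heat_mellin \<rho> (x + 1)"
    unfolding heat_mellin_def
    using set_integral_diff(2)[OF set_integrable_mult_right[OF i(1)] set_integrable_mult_right[OF i(2)]]
    by (simp only: set_integral_mult_right)
  finally show ?thesis by simp
qed

lemma kappa_eq_heat_mellin:
  "kappa r \<beta> x = (if of_int \<bar>x\<bar> > r * \<beta> / 2
     then 1 / \<bar>Gamma (- (r * \<beta> / 2))\<bar> * heat_mellin (r * \<beta> / 2) \<bar>x\<bar> else 0)"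
proof -
  have "heat_kernel t x 0 = heat \<bar>x\<bar> t" for t
    by (auto simp: heat_kernel_eq heat_def walk_gf_uminus abs_if)
  then show ?thesis by (simp add: kappa_def kappa2_def heat_mellin_def)
qed


text \<open>The recurrence is solved by a quotient of Pochhammer symbols, and Gauss' product for \<open>Gamma\<close>
describes the growth of each of them.\<close>

lemma gamma_ratio_recurrence_LIMSEQ:
  fixes g :: "nat \<Rightarrow> real"
  assumes rec: "\<And>n. (real n + B) * g (Suc n) = (real n + A) * g n" and AB: "0 < A" "0 < B"
  shows "(\<lambda>n. real n powr (B - A) * g n) \<longlonglongrightarrow> g 0 * Gamma B / Gamma A"
proof -
  have pos: "0 < pochhammer A n" "0 < pochhammer B n" for n
    using AB by (auto intro: pochhammer_pos)
  have g: "g n = g 0 * pochhammer A n / pochhammer B n" for n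
  proof (induction n)
    case (Suc n)
    have "g (Suc n) = (real n + A) * g n / (real n + B)"
      using rec[of n] AB by (simp add: field_simps)
    then show ?case
      using Suc pos AB by (simp add: pochhammer_Suc field_simps)
  qed simp
  have G: "0 < Gamma A" using AB(1) by (rule Gamma_real_pos)
  have "(\<lambda>n. g 0 * (Gamma_series B n / Gamma_series A n) * ((real n + B) / (real n + A)))
      \<longlonglongrightarrow> g 0 * (Gamma B / Gamma A) * 1"
  proof (intro tendsto_mult tendsto_divide tendsto_const Gamma_series_LIMSEQ)
    show "(\<lambda>n. (real n + B) / (real n + A)) \<longlonglongrightarrow> 1" by real_asymp
  qed (use G in auto)
  moreover have "eventually (\<lambda>n. g 0 * (Gamma_series B n / Gamma_series A n) * ((real n + B) / (real n + A))
      = real n powr (B - A) * g n) sequentially"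
  proof (rule eventually_sequentiallyI)
    fix n :: nat assume n: "1 \<le> n"
    have p: "pochhammer z (n + 1) = pochhammer z n * (real n + z)" for z :: real
      by (simp add: pochhammer_Suc add.commute)
    have "Gamma_series B n / Gamma_series A n * ((real n + B) / (real n + A))
        = (real n powr B / real n powr A) * (pochhammer A n / pochhammer B n)"
    proof -
      have "(f * Y / (b * v)) / (f * X / (a * u)) * (v / u) = Y / X * (a / b)"
        if "f \<noteq> 0" "X \<noteq> 0" "a \<noteq> 0" "b \<noteq> 0" "u \<noteq> 0" "v \<noteq> 0" for f X Y a b u v :: real
        using that by (simp add: divide_simps)
      from this[of "fact n" "real n powr A" "pochhammer A n" "pochhammer B n" "real n + A" "real n + B" "real n powr B"]
      show ?thesis
        unfolding Gamma_series_def p using n AB pos[of n] by (simp add: powr_def)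
    qed
    from arg_cong[OF this, of "\<lambda>z. g 0 * z"]
    show "g 0 * (Gamma_series B n / Gamma_series A n) * ((real n + B) / (real n + A))
      = real n powr (B - A) * g n"
      unfolding g[of n] powr_diff by (simp add: mult_ac)
  qed
  ultimately show ?thesis
    by (auto intro: Lim_transform_eventually)
qed

lemma kappa_uminus: "kappa r \<beta> (- x) = kappa r \<beta> x"
  by (simp add: kappa_eq_heat_mellin)

lemma kappa_rec:
  assumes "- (1 / 2) < r * \<beta> / 2" "r * \<beta> / 2 < 0 \<or> r * \<beta> / 2 < 1 \<and> 0 < n"
  shows "(real n + 1 + r * \<beta> / 2) * kappa r \<beta> (int (Suc n)) = (real n - r * \<beta> / 2) * kappa r \<beta> (int n)"
proof -
  have "r * \<beta> / 2 < real n" "r * \<beta> / 2 < real (Suc n)" using assms by auto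
  then show ?thesis
    using heat_mellin_rec[of "r * \<beta> / 2" "int n"] assms
    by (simp add: kappa_eq_heat_mellin add.commute)
qed

lemma kappa_pos_diagonal:
  assumes "0 < - (r * \<beta> / 2)" "- (r * \<beta> / 2) < 1 / 2"
  shows "0 < kappa r \<beta> 0"
  using assms heat_mellin_pos[of "r * \<beta> / 2" 0] Gamma_real_pos[of "- (r * \<beta> / 2)"]
  by (simp add: kappa_eq_heat_mellin)

lemma kappa_pos_off_diagonal:
  assumes "0 < r * \<beta> / 2" "r * \<beta> / 2 < 1"
  shows "0 < kappa r \<beta> 1"
proof -
  have "- (r * \<beta> / 2) \<notin> \<int>"
  proof
    assume "- (r * \<beta> / 2) \<in> \<int>"
    then obtain k where "- (r * \<beta> / 2) = of_int k" by (rule Ints_cases)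
    then have "- 1 < real_of_int k" "real_of_int k < 0" using assms by linarith+
    then have "- 1 < k" "k < 0" by linarith+
    then show False by simp
  qed
  then have "Gamma (- (r * \<beta> / 2)) \<noteq> 0"
    by (auto simp: Gamma_eq_zero_iff elim: nonpos_Ints_cases)
  then show ?thesis
    using assms heat_mellin_pos[of "r * \<beta> / 2" 1]
    by (simp add: kappa_eq_heat_mellin)
qed

section \<open>Picone's inequality for pairs of numbers\<close>

lemma powr_mean_value:
  fixes u v p :: real
  assumes "0 \<le> u" "u < v" "0 < p"
  obtains \<xi> where "u < \<xi>" "\<xi> < v" "v powr p - u powr p = (v - u) * (p * \<xi> powr (p - 1))"
proof (rule mvt[OF assms(2), of "\<lambda>x. x powr p" "\<lambda>x. (*) (p * x powr (p - 1))"])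
  show "continuous_on {u..v} (\<lambda>x. x powr p)"
    using assms by (intro continuous_on_powr') (auto intro!: continuous_intros)
  show "((\<lambda>x. x powr p) has_derivative (*) (p * x powr (p - 1))) (at x)" if "u < x" "x < v" for x
    using has_real_derivative_powr[of x p] that assms by (simp add: has_field_derivative_def)
qed (use that in \<open>auto simp: mult.commute\<close>)

text \<open>Normalise to \<open>x + y = 1\<close>, where \<open>z \<le> z powr r\<close>.\<close>

lemma powr_add_le:
  fixes x y r :: real
  assumes "0 \<le> x" "0 \<le> y" "0 < r" "r \<le> 1"
  shows "(x + y) powr r \<le> x powr r + y powr r"
proof (cases "x + y = 0")
  case False
  define s where "s = x + y"
  have s: "0 < s" using False assms by (simp add: s_def)
  have le: "z / s \<le> (z / s) powr r" if "0 \<le> z" "z \<le> s" for z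
    using powr_mono'[of r 1 "z / s"] that s assms by (simp add: powr_one)
  have "1 = x / s + y / s" using s by (simp add: s_def add_divide_distrib[symmetric])
  also have "\<dots> \<le> (x / s) powr r + (y / s) powr r"
    using assms by (intro add_mono le) (auto simp: s_def)
  also have "\<dots> = (x powr r + y powr r) / s powr r"
    using assms s by (simp add: powr_divide add_divide_distrib)
  finally show ?thesis using s by (simp add: s_def[symmetric] field_simps)
qed (use assms in auto)

lemma powr_diff_abs_le:
  fixes x y r :: real
  assumes "0 \<le> x" "0 \<le> y" "0 < r" "r \<le> 1"
  shows "\<bar>x powr r - y powr r\<bar> \<le> \<bar>x - y\<bar> powr r"
proof -
  have *: "x powr r - y powr r \<le> (x - y) powr r" "y powr r \<le> x powr r" if "0 \<le> y" "y \<le> x" for x y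
    using powr_add_le[of y "x - y" r] powr_mono2[of r y x] that assms by auto
  show ?thesis
    using *[of x y] *[of y x] assms by (cases "y \<le> x") auto
qed

text \<open>Strict convexity of \<open>\<bar>z\<bar> powr p\<close>, as a tangent line inequality. The base point \<open>s\<close> may be \<open>0\<close>.\<close>

lemma abs_powr_tangent:
  fixes z s p :: real
  assumes "1 < p" "0 \<le> s" "z \<noteq> s"
  shows "s powr p + p * s powr (p - 1) * (z - s) < \<bar>z\<bar> powr p"
proof (cases "s = 0 \<or> z \<le> 0")
  case True
  show ?thesis
  proof (cases "s = 0")
    case True
    then show ?thesis using assms by simp
  next
    case False
    have e: "s powr p = s * s powr (p - 1)" using assms False by (simp add: powr_diff)
    have "s powr (p - 1) * (s * (1 - p) + p * z) < 0"
      using assms False \<open>s = 0 \<or> z \<le> 0\<close>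
      by (intro mult_pos_neg add_neg_nonpos) (auto intro: mult_pos_neg mult_nonneg_nonpos)
    then have "s powr p + p * s powr (p - 1) * (z - s) < 0"
      unfolding e by (simp add: algebra_simps)
    then show ?thesis by (smt (verit) powr_ge_zero)
  qed
next
  case False
  then have z: "0 < z" "0 < s" using assms by auto
  show ?thesis
  proof (cases "z < s")
    case True
    obtain \<xi> where x: "z < \<xi>" "\<xi> < s" "s powr p - z powr p = (s - z) * (p * \<xi> powr (p - 1))"
      using powr_mean_value[of z s p] z True assms by auto
    have "(s - z) * (p * \<xi> powr (p - 1)) < (s - z) * (p * s powr (p - 1))"
      using x z assms by (intro mult_strict_left_mono powr_less_mono2) auto
    then show ?thesis using x(3) z by (simp add: algebra_simps)
  next
    case False
    then obtain \<xi> where x: "s < \<xi>" "\<xi> < z" "z powr p - s powr p = (z - s) * (p * \<xi> powr (p - 1))"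
      using powr_mean_value[of s z p] z assms by auto
    have "(z - s) * (p * s powr (p - 1)) < (z - s) * (p * \<xi> powr (p - 1))"
      using x z assms by (intro mult_strict_left_mono powr_less_mono2) auto
    then show ?thesis using x(3) z by (simp add: algebra_simps)
  qed
qed

lemma abs_powr_tangent_le:
  fixes z s p :: real
  assumes "1 < p" "0 \<le> s"
  shows "s powr p + p * s powr (p - 1) * (z - s) \<le> \<bar>z\<bar> powr p"
  using abs_powr_tangent[of p s z] assms by (cases "z = s") auto

lemma signed_powr_0 [simp]: "signed_powr 0 r = 0"
  by (simp add: signed_powr_def)

lemma signed_powr_uminus: "signed_powr (- t) r = - signed_powr t r"
  by (simp add: signed_powr_def sgn_minus)

lemma signed_powr_nonneg: "0 \<le> t \<Longrightarrow> signed_powr t r = t powr r"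
  by (cases "t = 0") (auto simp: signed_powr_def)

lemma signed_powr_abs: "\<bar>signed_powr t r\<bar> = \<bar>t\<bar> powr r"
  by (cases "t = 0") (auto simp: signed_powr_def abs_mult)

lemma signed_powr_mono:
  assumes "0 \<le> r" "x \<le> y"
  shows "signed_powr x r \<le> signed_powr y r"
proof -
  consider "0 \<le> x" | "x < 0" "0 \<le> y" | "y < 0" using assms by linarith
  then show ?thesis
  proof cases
    case 1
    then show ?thesis using assms by (simp add: signed_powr_nonneg powr_mono2)
  next
    case 2
    then have "signed_powr x r = - ((- x) powr r)"
      using signed_powr_uminus[of "- x" r] by (simp add: signed_powr_nonneg)
    then show ?thesis using 2 by (simp add: signed_powr_nonneg order.trans[of _ 0])
  next
    case 3
    then show ?thesis
      using assms signed_powr_uminus[of "- x" r] signed_powr_uminus[of "- y" r] powr_mono2[of r "- y" "- x"]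
      by (simp add: signed_powr_nonneg)
  qed
qed

lemma signed_powr_mult: "0 \<le> c \<Longrightarrow> signed_powr (c * t) r = c powr r * signed_powr t r"
  by (cases "c = 0") (auto simp: signed_powr_def abs_mult sgn_mult powr_mult)

lemma isCont_signed_powr: "0 < r \<Longrightarrow> isCont (\<lambda>t. signed_powr t r) t"
proof -
  assume r: "0 < r"
  have e: "signed_powr t r = (max 0 t) powr r - (max 0 (- t)) powr r" for t
    using signed_powr_uminus[of "- t" r] by (cases "0 \<le> t") (auto simp: signed_powr_nonneg max_def)
  have "continuous_on UNIV (\<lambda>t. (max 0 t) powr r - (max 0 (- t)) powr r)"
    using r by (intro continuous_on_diff continuous_on_powr' continuous_intros) auto
  then show ?thesis unfolding e[abs_def] by (simp add: continuous_on_eq_continuous_at)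
qed

text \<open>Write \<open>d = a - b\<close> and \<open>z = (as - bt)/d\<close>. Then \<open>a s = d z + b t\<close>, so \<open>s\<close> is a convex combination of
\<open>z\<close> and \<open>t\<close>, and the claim is Jensen's inequality for \<open>\<bar>z\<bar> powr p\<close>. It is strict unless
\<open>z = s = t\<close>.\<close>

lemma picone_strict_ordered:
  fixes a b s t p :: real
  assumes "1 < p" "0 < b" "b \<le> a" "0 \<le> s" "0 \<le> t" "s \<noteq> t"
  shows "(a - b) powr (p - 1) * (a * s powr p - b * t powr p) < \<bar>a * s - b * t\<bar> powr p"
proof (cases "a = b")
  case True
  have "0 < \<bar>a * s - b * t\<bar>"
    using assms True by (simp add: right_diff_distrib[symmetric])
  then show ?thesis using True by simp
next
  case False
  define d where "d = a - b"
  have d: "0 < d" using assms False by (simp add: d_def)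
  define z where "z = (a * s - b * t) / d"
  have dz: "d * z = a * s - b * t" using d by (simp add: z_def)
  have "d * (s powr p + p * s powr (p - 1) * (z - s)) \<le> d * \<bar>z\<bar> powr p"
    using d assms by (intro mult_left_mono abs_powr_tangent_le) auto
  moreover have "b * (s powr p + p * s powr (p - 1) * (t - s)) < b * t powr p"
    using assms abs_powr_tangent[of p s t] by (intro mult_strict_left_mono) auto
  moreover have "d * (s powr p + p * s powr (p - 1) * (z - s)) + b * (s powr p + p * s powr (p - 1) * (t - s))
      = (d + b) * s powr p + p * s powr (p - 1) * ((d * z) - d * s + b * t - b * s)"
    by (simp add: algebra_simps)
  moreover have "\<dots> = a * s powr p"
    unfolding dz by (simp add: d_def algebra_simps)
  ultimately have "a * s powr p - b * t powr p < d * \<bar>z\<bar> powr p"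
    by linarith
  then have "d powr (p - 1) * (a * s powr p - b * t powr p) < d powr (p - 1) * (d * \<bar>z\<bar> powr p)"
    using d by (intro mult_strict_left_mono) auto
  also have "\<dots> = d powr p * \<bar>z\<bar> powr p"
    using d by (simp add: powr_diff)
  also have "\<dots> = \<bar>d * z\<bar> powr p"
    using d by (simp add: abs_mult powr_mult)
  finally show ?thesis unfolding dz by (simp only: d_def)
qed

lemma picone_strict:
  fixes a b s t p :: real
  assumes "1 < p" "0 < a" "0 < b" "0 \<le> s" "0 \<le> t" "s \<noteq> t"
  shows "signed_powr (a - b) (p - 1) * (a * s powr p - b * t powr p) < \<bar>a * s - b * t\<bar> powr p"
proof (cases "b \<le> a")
  case True
  then show ?thesis
    using picone_strict_ordered[of p b a s t] assms by (simp add: signed_powr_nonneg)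
next
  case False
  then have "signed_powr (a - b) (p - 1) = - ((b - a) powr (p - 1))"
    using signed_powr_uminus[of "b - a" "p - 1"] by (simp add: signed_powr_nonneg)
  then show ?thesis
    using picone_strict_ordered[of p a b t s] assms False
    by (simp add: abs_minus_commute algebra_simps)
qed

lemma picone_refl:
  fixes a b s p :: real
  assumes "1 < p" "0 \<le> s"
  shows "signed_powr (a - b) (p - 1) * (a * s powr p - b * s powr p) = \<bar>a * s - b * s\<bar> powr p"
proof -
  have "signed_powr (a - b) (p - 1) * (a - b) = \<bar>a - b\<bar> powr p"
  proof (cases "a = b")
    case False
    have "signed_powr (a - b) (p - 1) * (a - b) = \<bar>a - b\<bar> powr (p - 1) * ((a - b) * sgn (a - b))"
      by (simp add: signed_powr_def)
    also have "\<dots> = \<bar>a - b\<bar> powr p"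
      unfolding abs_sgn[symmetric] using False by (simp add: powr_diff)
    finally show ?thesis .
  qed simp
  then have "signed_powr (a - b) (p - 1) * (a - b) * s powr p = \<bar>(a - b) * s\<bar> powr p"
    using assms by (simp add: abs_mult powr_mult)
  then show ?thesis by (simp add: algebra_simps)
qed

text \<open>Substitute \<open>s = \<bar>x\<bar>/a\<close> and \<open>t = \<bar>y\<bar>/b\<close> in the homogeneous form. The equality case will identify
ground states.\<close>

lemma picone:
  fixes a b x y p :: real
  assumes "1 < p" "0 < a" "0 < b"
  shows "signed_powr (a - b) (p - 1) * (\<bar>x\<bar> powr p / a powr (p - 1) - \<bar>y\<bar> powr p / b powr (p - 1))
    \<le> \<bar>x - y\<bar> powr p"
    and "0 \<le> x \<Longrightarrow> 0 \<le> y \<Longrightarrow>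
      signed_powr (a - b) (p - 1) * (\<bar>x\<bar> powr p / a powr (p - 1) - \<bar>y\<bar> powr p / b powr (p - 1))
        = \<bar>x - y\<bar> powr p \<Longrightarrow> x / a = y / b"
proof -
  have e: "c * (\<bar>z\<bar> / c) powr p = \<bar>z\<bar> powr p / c powr (p - 1)" if "0 < c" for c z :: real
    using that by (simp add: powr_divide powr_diff)
  let ?L = "signed_powr (a - b) (p - 1) * (\<bar>x\<bar> powr p / a powr (p - 1) - \<bar>y\<bar> powr p / b powr (p - 1))"
  have st: "?L < \<bar>\<bar>x\<bar> - \<bar>y\<bar>\<bar> powr p" if "\<bar>x\<bar> / a \<noteq> \<bar>y\<bar> / b"
    using picone_strict[of p a b "\<bar>x\<bar> / a" "\<bar>y\<bar> / b"] assms that by (simp add: e)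
  have "?L \<le> \<bar>\<bar>x\<bar> - \<bar>y\<bar>\<bar> powr p"
  proof (cases "\<bar>x\<bar> / a = \<bar>y\<bar> / b")
    case True
    have "a * (\<bar>x\<bar> / a) = \<bar>x\<bar>" using assms by simp
    moreover have "b * (\<bar>x\<bar> / a) = \<bar>y\<bar>" unfolding True using assms by simp
    moreover have "b * (\<bar>x\<bar> / a) powr p = \<bar>y\<bar> powr p / b powr (p - 1)"
      unfolding True using e[OF assms(3)] .
    ultimately show ?thesis
      using picone_refl[of p "\<bar>x\<bar> / a" a b] assms e[OF assms(2), of x] by simp
  qed (use st in auto)
  also have "\<dots> \<le> \<bar>x - y\<bar> powr p"
    using assms by (intro powr_mono2) auto
  finally show "?L \<le> \<bar>x - y\<bar> powr p" .
  show "x / a = y / b" if "0 \<le> x" "0 \<le> y" "?L = \<bar>x - y\<bar> powr p"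
    using st that by auto
qed

lemma powr_Hoelder_bounded:
  fixes p :: real
  assumes "1 < p"
  obtains C where "0 \<le> C" "\<And>x y. 0 \<le> x \<Longrightarrow> x \<le> 2 \<Longrightarrow> 0 \<le> y \<Longrightarrow> y \<le> 2 \<Longrightarrow>
     \<bar>x powr (p - 1) - y powr (p - 1)\<bar> \<le> C * \<bar>x - y\<bar> powr (min p 2 - 1)"
proof (cases "p \<le> 2")
  case True
  then show ?thesis
    using that[of 1] powr_diff_abs_le[of _ _ "p - 1"] assms by auto
next
  case False
  define C where "C = (p - 1) * 2 powr (p - 2)"
  have *: "y powr (p - 1) - x powr (p - 1) \<le> C * (y - x)" "x powr (p - 1) \<le> y powr (p - 1)"
    if xy: "0 \<le> x" "x < y" "y \<le> 2" for x y
  proof -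
    obtain \<xi> where x: "x < \<xi>" "\<xi> < y" "y powr (p - 1) - x powr (p - 1) = (y - x) * ((p - 1) * \<xi> powr (p - 1 - 1))"
      using powr_mean_value[of x y "p - 1"] xy False by auto
    have "(y - x) * ((p - 1) * \<xi> powr (p - 1 - 1)) \<le> (y - x) * ((p - 1) * 2 powr (p - 1 - 1))"
      using x xy False by (intro mult_left_mono powr_mono2) auto
    then show "y powr (p - 1) - x powr (p - 1) \<le> C * (y - x)"
      unfolding x(3) by (simp add: C_def algebra_simps)
    show "x powr (p - 1) \<le> y powr (p - 1)" using xy False by (intro powr_mono2) auto
  qed
  show ?thesis
  proof (rule that[of C])
    show "0 \<le> C" using False by (simp add: C_def)
    fix x y :: real assume "0 \<le> x" "x \<le> 2" "0 \<le> y" "y \<le> 2"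
    then have "\<bar>x powr (p - 1) - y powr (p - 1)\<bar> \<le> C * \<bar>x - y\<bar>"
      using *[of x y] *[of y x] by (cases x y rule: linorder_cases) auto
    then show "\<bar>x powr (p - 1) - y powr (p - 1)\<bar> \<le> C * \<bar>x - y\<bar> powr (min p 2 - 1)"
      using False by (simp add: min_def)
  qed
qed

text \<open>First-order Taylor expansion. The remainder has order \<open>min p 2\<close> because the derivative of
\<open>\<bar>z\<bar> powr p\<close> is only Hoelder continuous at \<open>0\<close> when \<open>p < 2\<close>. All that matters later is that
\<open>min p 2 > 1\<close>.\<close>

lemma abs_powr_taylor:
  fixes p :: real
  assumes "1 < p"
  obtains C where "0 \<le> C" "\<And>A B. 0 \<le> A \<Longrightarrow> A \<le> 1 \<Longrightarrow> \<bar>B\<bar> \<le> 1 \<Longrightarrow>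
     \<bar>A + B\<bar> powr p \<le> A powr p + p * A powr (p - 1) * B + C * \<bar>B\<bar> powr (min p 2)"
proof -
  obtain C where C: "0 \<le> C" "\<And>x y. 0 \<le> x \<Longrightarrow> x \<le> 2 \<Longrightarrow> 0 \<le> y \<Longrightarrow> y \<le> 2 \<Longrightarrow>
     \<bar>x powr (p - 1) - y powr (p - 1)\<bar> \<le> C * \<bar>x - y\<bar> powr (min p 2 - 1)"
    using powr_Hoelder_bounded[OF assms] by blast
  define m where "m = min p 2"
  have m: "1 < m" "m \<le> p" using assms by (auto simp: m_def)
  have mm: "\<bar>B\<bar> * \<bar>B\<bar> powr (m - 1) = \<bar>B\<bar> powr m" for B
    using m by (cases "B = 0") (auto simp: powr_diff)
  show ?thesis
  proof (rule that[of "p * C + p + 1"])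
    show "0 \<le> p * C + p + 1" using C assms by simp
    fix A B :: real assume AB: "0 \<le> A" "A \<le> 1" "\<bar>B\<bar> \<le> 1"
    show "\<bar>A + B\<bar> powr p \<le> A powr p + p * A powr (p - 1) * B + (p * C + p + 1) * \<bar>B\<bar> powr (min p 2)"
    proof (cases "A + B < 0")
      case True
      have B: "B < 0" "A \<le> \<bar>B\<bar>" using True AB by auto
      have Bm: "\<bar>B\<bar> powr p \<le> \<bar>B\<bar> powr m" using AB m by (intro powr_mono') auto
      have "\<bar>A + B\<bar> powr p \<le> \<bar>B\<bar> powr p" using True AB assms by (intro powr_mono2) auto
      also note Bm
      finally have 1: "\<bar>A + B\<bar> powr p \<le> \<bar>B\<bar> powr m" .
      have "A powr (p - 1) * \<bar>B\<bar> \<le> \<bar>B\<bar> powr (p - 1) * \<bar>B\<bar>"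
        using B AB assms by (intro mult_right_mono powr_mono2) auto
      also have "\<dots> = \<bar>B\<bar> powr p" using B by (simp add: powr_diff)
      also note Bm
      finally have "p * (A powr (p - 1) * \<bar>B\<bar>) \<le> p * \<bar>B\<bar> powr m"
        using assms by (intro mult_left_mono) auto
      moreover have "0 \<le> p * C * \<bar>B\<bar> powr m" using C assms by simp
      moreover have "0 \<le> A powr p" by simp
      moreover have "p * (A powr (p - 1) * \<bar>B\<bar>) = - (p * A powr (p - 1) * B)" using B by simp
      ultimately have "\<bar>A + B\<bar> powr p \<le> A powr p + p * A powr (p - 1) * B + (p * C * \<bar>B\<bar> powr m + p * \<bar>B\<bar> powr m + \<bar>B\<bar> powr m)"
        using 1 by linarith
      then show ?thesis unfolding m_def[symmetric] by (simp add: algebra_simps)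
    next
      case False
      have key: "\<exists>\<xi>. (A + B) powr p - A powr p = B * (p * \<xi> powr (p - 1)) \<and> 0 \<le> \<xi> \<and> \<xi> \<le> 2 \<and> \<bar>\<xi> - A\<bar> \<le> \<bar>B\<bar>"
      proof (cases B "0 :: real" rule: linorder_cases)
        case less
        then obtain \<xi> where "A + B < \<xi>" "\<xi> < A" "A powr p - (A + B) powr p = - B * (p * \<xi> powr (p - 1))"
          using powr_mean_value[of "A + B" A p] False assms by auto
        then show ?thesis using False AB less by (intro exI[of _ \<xi>]) (auto simp: algebra_simps)
      next
        case equal
        then show ?thesis using AB by (intro exI[of _ A]) auto
      next
        case greater
        then obtain \<xi> where "A < \<xi>" "\<xi> < A + B" "(A + B) powr p - A powr p = B * (p * \<xi> powr (p - 1))"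
          using powr_mean_value[of A "A + B" p] AB assms by auto
        then show ?thesis using False AB greater by (intro exI[of _ \<xi>]) auto
      qed
      then obtain \<xi> where x: "(A + B) powr p - A powr p = B * (p * \<xi> powr (p - 1))" "0 \<le> \<xi>" "\<xi> \<le> 2" "\<bar>\<xi> - A\<bar> \<le> \<bar>B\<bar>"
        by blast
      have "B * (\<xi> powr (p - 1) - A powr (p - 1)) \<le> \<bar>B\<bar> * \<bar>\<xi> powr (p - 1) - A powr (p - 1)\<bar>"
        by (metis abs_ge_self abs_mult)
      also have "\<dots> \<le> \<bar>B\<bar> * (C * \<bar>\<xi> - A\<bar> powr (m - 1))"
        unfolding m_def using x AB by (intro mult_left_mono C) auto
      also have "\<dots> \<le> \<bar>B\<bar> * (C * \<bar>B\<bar> powr (m - 1))"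
        using x m C by (intro mult_left_mono powr_mono2) auto
      also have "\<dots> = C * \<bar>B\<bar> powr m" using mm[of B] by (simp add: mult_ac)
      finally have "p * (B * (\<xi> powr (p - 1) - A powr (p - 1))) \<le> p * (C * \<bar>B\<bar> powr m)"
        using assms by (intro mult_left_mono) auto
      moreover have "0 \<le> (p + 1) * \<bar>B\<bar> powr m" using assms by simp
      ultimately show ?thesis using x(1) False unfolding m_def[symmetric] by (simp add: algebra_simps)
    qed
  qed
qed

text \<open>The reverse of Picone's inequality up to an error. By homogeneity let \<open>a = 1 \<ge> b\<close>, and put
\<open>\<delta> = s - t\<close>. Expand \<open>\<bar>s - bt\<bar> powr p\<close> around \<open>(1-b)s\<close> and \<open>t powr p\<close> around \<open>s\<close>. The terms of order zero
and one in \<open>\<delta>\<close> cancel exactly.\<close>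

lemma picone_remainder_le:
  fixes p :: real
  assumes p: "1 < p"
  obtains C where "0 \<le> C" "\<And>a b s t. 0 < a \<Longrightarrow> 0 < b \<Longrightarrow> 0 \<le> s \<Longrightarrow> s \<le> 1 \<Longrightarrow> 0 \<le> t \<Longrightarrow> t \<le> 1 \<Longrightarrow>
     \<bar>a * s - b * t\<bar> powr p - signed_powr (a - b) (p - 1) * (a * s powr p - b * t powr p)
       \<le> C * max a b powr p * \<bar>s - t\<bar> powr (min p 2)"
proof -
  obtain C where C: "0 \<le> C" "\<And>A B. 0 \<le> A \<Longrightarrow> A \<le> 1 \<Longrightarrow> \<bar>B\<bar> \<le> 1 \<Longrightarrow>
     \<bar>A + B\<bar> powr p \<le> A powr p + p * A powr (p - 1) * B + C * \<bar>B\<bar> powr (min p 2)"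
    using abs_powr_taylor[OF p] by blast
  have unit: "\<bar>s - b * t\<bar> powr p - (1 - b) powr (p - 1) * (s powr p - b * t powr p)
       \<le> 2 * C * \<bar>s - t\<bar> powr (min p 2)"
    if h: "0 < b" "b \<le> 1" "0 \<le> s" "s \<le> 1" "0 \<le> t" "t \<le> 1" for b s t
  proof -
    define \<delta> where "\<delta> = s - t"
    define M where "M = \<bar>\<delta>\<bar> powr (min p 2)"
    have d: "\<bar>\<delta>\<bar> \<le> 1" using h by (auto simp: \<delta>_def)
    have bd: "\<bar>b * \<delta>\<bar> \<le> \<bar>\<delta>\<bar>" using h by (simp add: abs_mult mult_left_le_one_le)
    have e: "s - b * t = (1 - b) * s + b * \<delta>" by (simp add: \<delta>_def algebra_simps)
    have "\<bar>(1 - b) * s + b * \<delta>\<bar> powr p \<le>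
        ((1 - b) * s) powr p + p * ((1 - b) * s) powr (p - 1) * (b * \<delta>) + C * \<bar>b * \<delta>\<bar> powr (min p 2)"
      using h d bd by (intro C) (auto intro: mult_le_one)
    also have "C * \<bar>b * \<delta>\<bar> powr (min p 2) \<le> C * M"
      unfolding M_def using bd C p by (intro mult_left_mono powr_mono2) auto
    finally have 1: "\<bar>s - b * t\<bar> powr p \<le> (1 - b) powr p * s powr p
        + p * ((1 - b) powr (p - 1) * s powr (p - 1)) * (b * \<delta>) + C * M"
      unfolding e using h by (simp add: powr_mult)
    have "\<bar>s + - \<delta>\<bar> powr p \<le> s powr p + p * s powr (p - 1) * (- \<delta>) + C * \<bar>- \<delta>\<bar> powr (min p 2)"
      using h d by (intro C) auto
    then have "t powr p \<le> s powr p - p * s powr (p - 1) * \<delta> + C * M"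
      using h by (simp add: \<delta>_def M_def algebra_simps abs_minus_commute)
    then have "((1 - b) powr (p - 1) * b) * t powr p
        \<le> ((1 - b) powr (p - 1) * b) * (s powr p - p * s powr (p - 1) * \<delta> + C * M)"
      using h by (intro mult_left_mono) auto
    moreover have "((1 - b) powr (p - 1) * b) * (C * M) \<le> 1 * (C * M)"
      using h p C by (intro mult_right_mono mult_le_one) (auto simp: M_def powr_le1)
    moreover have e2: "(1 - b) powr p = (1 - b) powr (p - 1) * (1 - b)"
      using h p by (cases "b = 1") (auto simp: powr_diff)
    ultimately show ?thesis
      using 1[unfolded e2] unfolding M_def[symmetric] \<delta>_def[symmetric] by (simp add: algebra_simps)
  qed
  have ord: "\<bar>a * s - b * t\<bar> powr p - signed_powr (a - b) (p - 1) * (a * s powr p - b * t powr p)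
       \<le> 2 * C * a powr p * \<bar>s - t\<bar> powr (min p 2)"
    if h: "0 < b" "b \<le> a" "0 \<le> s" "s \<le> 1" "0 \<le> t" "t \<le> 1" for a b s t
  proof -
    have a: "0 < a" using h by simp
    have "\<bar>s - (b / a) * t\<bar> powr p - (1 - b / a) powr (p - 1) * (s powr p - (b / a) * t powr p)
       \<le> 2 * C * \<bar>s - t\<bar> powr (min p 2)"
      using h a by (intro unit) auto
    then have "a powr p * (\<bar>s - (b / a) * t\<bar> powr p - (1 - b / a) powr (p - 1) * (s powr p - (b / a) * t powr p))
       \<le> a powr p * (2 * C * \<bar>s - t\<bar> powr (min p 2))"
      by (intro mult_left_mono) auto
    moreover have "a powr p * \<bar>s - (b / a) * t\<bar> powr p = \<bar>a * s - b * t\<bar> powr p"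
    proof -
      have "a powr p * \<bar>s - (b / a) * t\<bar> powr p = \<bar>a * (s - (b / a) * t)\<bar> powr p"
        using a by (simp add: powr_mult abs_mult)
      also have "a * (s - (b / a) * t) = a * s - b * t" using a by (simp add: field_simps)
      finally show ?thesis .
    qed
    moreover have "a powr p * ((1 - b / a) powr (p - 1) * (s powr p - (b / a) * t powr p))
        = (a - b) powr (p - 1) * (a * s powr p - b * t powr p)"
    proof -
      have "a powr p * ((1 - b / a) powr (p - 1) * (s powr p - (b / a) * t powr p))
         = (a powr (p - 1) * (1 - b / a) powr (p - 1)) * (a * (s powr p - (b / a) * t powr p))"
        using a by (simp add: powr_diff)
      also have "a powr (p - 1) * (1 - b / a) powr (p - 1) = (a * (1 - b / a)) powr (p - 1)"
        using a h by (simp add: powr_mult)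
      also have "a * (1 - b / a) = a - b" using a by (simp add: field_simps)
      also have "a * (s powr p - (b / a) * t powr p) = a * s powr p - b * t powr p"
        using a by (simp add: field_simps)
      finally show ?thesis .
    qed
    ultimately show ?thesis
      using h by (simp add: signed_powr_nonneg right_diff_distrib mult_ac)
  qed
  show ?thesis
  proof (rule that[of "2 * C"])
    show "0 \<le> 2 * C" using C by simp
    fix a b s t :: real
    assume h: "0 < a" "0 < b" "0 \<le> s" "s \<le> 1" "0 \<le> t" "t \<le> 1"
    show "\<bar>a * s - b * t\<bar> powr p - signed_powr (a - b) (p - 1) * (a * s powr p - b * t powr p)
       \<le> 2 * C * max a b powr p * \<bar>s - t\<bar> powr (min p 2)"
    proof (cases "b \<le> a")
      case True
      then show ?thesis using ord[of b a s t] h by (simp add: max_def)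
    next
      case False
      have "signed_powr (a - b) (p - 1) * (a * s powr p - b * t powr p)
          = signed_powr (b - a) (p - 1) * (b * t powr p - a * s powr p)"
        using signed_powr_uminus[of "b - a" "p - 1"] by (simp add: algebra_simps)
      then show ?thesis
        using ord[of a b t s] h False by (simp add: max_def abs_minus_commute)
    qed
  qed
qed

section \<open>Hardy weights, supersolutions and criticality\<close>

text \<open>Comparison of a sum over the integers with a series over the naturals that majorises both halves.\<close>

lemma infsum_int_le:
  fixes f :: "int \<Rightarrow> real"
  assumes f: "\<And>x. 0 \<le> f x" "\<And>x. f x \<le> g (nat \<bar>x\<bar>)" and g: "summable g"
  shows "f summable_on UNIV" "infsum f UNIV \<le> 2 * suminf g"
proof -
  have g0: "0 \<le> g n" for n using f[of "int n"] by (simp add: order.trans)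
  have part: "sum f F \<le> suminf g" if "finite F" "inj_on (\<lambda>x. nat \<bar>x\<bar>) F" for F
  proof -
    have "sum f F \<le> (\<Sum>x\<in>F. g (nat \<bar>x\<bar>))" by (intro sum_mono f)
    also have "\<dots> = sum g ((\<lambda>x. nat \<bar>x\<bar>) ` F)" using that by (simp add: sum.reindex)
    also have "\<dots> \<le> suminf g" using that g g0 by (intro sum_le_suminf) auto
    finally show ?thesis .
  qed
  have le: "sum f F \<le> 2 * suminf g" if "finite F" for F
  proof -
    have "sum f F = sum f (F \<inter> {0..}) + sum f (F \<inter> {..<0})"
      using that by (subst sum.union_disjoint[symmetric]) (auto intro!: sum.cong)
    also have "\<dots> \<le> suminf g + suminf g"
      using that by (intro add_mono part) (auto simp: inj_on_def)
    finally show ?thesis by simp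
  qed
  show s: "f summable_on UNIV"
    using f le by (intro nonneg_bdd_above_summable_on) (auto simp: bdd_above_def)
  show "infsum f UNIV \<le> 2 * suminf g"
    using s le by (intro infsum_le_finite_sums) auto
qed

lemma infsum_int_sums:
  fixes h :: "int \<Rightarrow> real"
  assumes h: "h summable_on UNIV" and h0: "h 0 = 0"
  shows "(\<lambda>n. h (int (Suc n)) + h (- int (Suc n))) sums infsum h UNIV"
proof -
  define P N where "P = range (\<lambda>n. int (Suc n))" and "N = range (\<lambda>n. - int (Suc n))"
  have U: "UNIV = {0} \<union> (P \<union> N)"
  proof -
    have "x \<in> {0} \<union> (P \<union> N)" for x
    proof (cases x "0 :: int" rule: linorder_cases)
      case less
      then have "x = - int (Suc (nat (- x - 1)))" by simp
      then have "x \<in> N" unfolding N_def by (rule range_eqI)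
      then show ?thesis by simp
    next
      case greater
      then have "x = int (Suc (nat (x - 1)))" by simp
      then have "x \<in> P" unfolding P_def by (rule range_eqI)
      then show ?thesis by simp
    qed simp
    then show ?thesis by blast
  qed
  have sP: "h summable_on P" and sN: "h summable_on N"
    using h by (auto intro: summable_on_subset_banach)
  have "(h has_sum (h 0 + (infsum h P + infsum h N))) ({0} \<union> (P \<union> N))"
    using sP sN has_sum_finiteI[of "{0}" "h 0" h]
    by (intro has_sum_Un_disjoint has_sum_infsum) (auto simp: P_def N_def)
  then have e: "infsum h UNIV = infsum h P + infsum h N"
    using h0 unfolding U[symmetric] by (simp add: infsumI)
  have "inj (\<lambda>n. int (Suc n))" "inj (\<lambda>n. - int (Suc n))" by (auto simp: inj_def)
  then have "((\<lambda>n. h (int (Suc n))) has_sum infsum h P) UNIV" "((\<lambda>n. h (- int (Suc n))) has_sum infsum h N) UNIV"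
    using has_sum_infsum[OF sP] has_sum_infsum[OF sN]
    unfolding P_def N_def by (auto simp: has_sum_reindex o_def)
  then show ?thesis
    unfolding e by (intro sums_add has_sum_imp_sums)
qed

text \<open>Fubini for a function on pairs that lives on a single row. No absolute summability has to be
checked.\<close>

lemma has_sum_row:
  assumes "(g has_sum G) UNIV"
  shows "((\<lambda>(x, y). if x = a then g y else 0) has_sum G) UNIV"
proof -
  have "(((\<lambda>(x, y). if x = a then g y else 0) \<circ> Pair a) has_sum G) UNIV"
    using assms by (simp add: o_def)
  then have "((\<lambda>(x, y). if x = a then g y else 0) has_sum G) (range (Pair a))"
    by (subst has_sum_reindex) (auto simp: inj_def)
  then show ?thesis
    by (subst has_sum_cong_neutral[where S = UNIV and T = "range (Pair a)"
          and g = "\<lambda>(x, y). if x = a then g y else 0"]) auto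
qed

lemma has_sum_finite_rows:
  fixes g :: "'a \<Rightarrow> 'b \<Rightarrow> real"
  assumes "finite S" "\<And>x. x \<in> S \<Longrightarrow> (g x has_sum G x) UNIV"
  shows "((\<lambda>(x, y). if x \<in> S then g x y else 0) has_sum (\<Sum>x\<in>S. G x)) UNIV"
  using assms
proof (induction S)
  case (insert a S)
  have "((\<lambda>z. (case z of (x, y) \<Rightarrow> if x = a then g a y else 0) + (case z of (x, y) \<Rightarrow> if x \<in> S then g x y else 0))
      has_sum (G a + (\<Sum>x\<in>S. G x))) UNIV"
    using insert by (intro has_sum_add has_sum_row) auto
  moreover have "(\<lambda>z. (case z of (x, y) \<Rightarrow> if x = a then g a y else 0) + (case z of (x, y) \<Rightarrow> if x \<in> S then g x y else 0))
      = (\<lambda>(x, y). if x \<in> insert a S then g x y else 0)"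
    using insert(2) by (auto simp: fun_eq_iff)
  ultimately show ?case using insert by simp
qed (simp add: split_def)

lemma has_sum_swap_pairs:
  assumes "(f has_sum s) UNIV"
  shows "((\<lambda>(x, y). f (y, x)) has_sum s) UNIV"
proof -
  have "(f has_sum s) (range prod.swap)" using assms by simp
  then have "((f \<circ> prod.swap) has_sum s) UNIV" by (subst (asm) has_sum_reindex) auto
  then show ?thesis by (simp add: o_def prod.swap_def split_def)
qed

lemma two_sided_bounds_of_LIMSEQ:
  fixes f :: "nat \<Rightarrow> real"
  assumes "f \<longlonglongrightarrow> L" "0 < L" "\<And>n. 1 \<le> n \<Longrightarrow> 0 < f n"
  obtains c C where "0 < c" "0 < C" "\<And>n. 1 \<le> n \<Longrightarrow> c \<le> f n" "\<And>n. 1 \<le> n \<Longrightarrow> f n \<le> C"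
proof -
  obtain C where C: "0 < C" "\<And>n. norm (f n) \<le> C"
    using assms(1) convergent_imp_Bseq[of f] unfolding Bseq_def convergent_def by auto
  have "(\<lambda>n. inverse (f n)) \<longlonglongrightarrow> inverse L"
    using assms by (intro tendsto_inverse) auto
  then obtain D where D: "0 < D" "\<And>n. norm (inverse (f n)) \<le> D"
    using convergent_imp_Bseq[of "\<lambda>n. inverse (f n)"] unfolding Bseq_def convergent_def by auto
  show ?thesis
  proof (rule that[of "inverse D" C])
    show "inverse D \<le> f n" if "1 \<le> n" for n
      using D(2)[of n] assms(3)[OF that] D(1) by (simp add: field_simps)
  qed (use C D assms(3) in \<open>auto simp: abs_le_iff\<close>)
qed

lemma sum_powr_le:
  fixes \<theta> :: real
  assumes "0 \<le> \<theta>" "\<theta> < 1"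
  shows "(\<Sum>d=1..n. real d powr (- \<theta>)) \<le> real n powr (1 - \<theta>) / (1 - \<theta>)"
proof (induction n)
  case (Suc n)
  obtain \<xi> where x: "real n < \<xi>" "\<xi> < real (Suc n)"
      "real (Suc n) powr (1 - \<theta>) - real n powr (1 - \<theta>) = (real (Suc n) - real n) * ((1 - \<theta>) * \<xi> powr (1 - \<theta> - 1))"
    using powr_mean_value[of "real n" "real (Suc n)" "1 - \<theta>"] assms by auto
  have "0 < \<xi>" using x(1) by (smt (verit) of_nat_0_le_iff)
  then have "real (Suc n) powr (- \<theta>) \<le> \<xi> powr (- \<theta>)"
    using assms x by (intro powr_mono2') auto
  then have "(1 - \<theta>) * real (Suc n) powr (- \<theta>) \<le> real (Suc n) powr (1 - \<theta>) - real n powr (1 - \<theta>)"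
    unfolding x(3) using assms by (simp add: mult_left_mono)
  then have "real (Suc n) powr (- \<theta>) \<le> (real (Suc n) powr (1 - \<theta>) - real n powr (1 - \<theta>)) / (1 - \<theta>)"
    using assms by (simp add: field_simps)
  then show ?case using Suc assms by (simp add: diff_divide_distrib)
qed simp

lemma powr_tail_term_le:
  fixes \<theta> :: real
  assumes "0 < \<theta>" "1 \<le> n"
  shows "real (Suc n) powr (- 1 - \<theta>) \<le> (real n powr (- \<theta>) - real (Suc n) powr (- \<theta>)) / \<theta>"
proof -
  obtain \<xi> where x: "real n < \<xi>" "\<xi> < real (Suc n)"
      "real (Suc n) powr (- \<theta>) - real n powr (- \<theta>) = (real (Suc n) - real n) * (- \<theta> * \<xi> powr (- \<theta> - 1))"
  proof (rule mvt[of "real n" "real (Suc n)" "\<lambda>x. x powr (- \<theta>)" "\<lambda>x. (*) (- \<theta> * x powr (- \<theta> - 1))"])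
    show "continuous_on {real n..real (Suc n)} (\<lambda>x. x powr (- \<theta>))"
      using assms by (intro continuous_on_powr) (auto intro!: continuous_intros)
    show "((\<lambda>x. x powr (- \<theta>)) has_derivative (*) (- \<theta> * x powr (- \<theta> - 1))) (at x)" if "real n < x" "x < real (Suc n)" for x
      using has_real_derivative_powr[of x "- \<theta>"] that assms by (simp add: has_field_derivative_def)
  qed (use that in \<open>auto simp: mult.commute\<close>)
  have "real (Suc n) powr (- \<theta> - 1) \<le> \<xi> powr (- \<theta> - 1)"
    using assms x by (intro powr_mono2') auto
  then have "\<theta> * real (Suc n) powr (- \<theta> - 1) \<le> \<theta> * \<xi> powr (- \<theta> - 1)"
    using assms by (intro mult_left_mono) auto
  also have "\<dots> = real n powr (- \<theta>) - real (Suc n) powr (- \<theta>)"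
    using x(3) by simp
  finally have "real (Suc n) powr (- \<theta> - 1) \<le> (real n powr (- \<theta>) - real (Suc n) powr (- \<theta>)) / \<theta>"
    using assms by (simp add: pos_le_divide_eq mult.commute)
  then show ?thesis by (simp only: diff_conv_add_uminus add.commute)
qed

text \<open>Comparison with a telescoping series.\<close>

lemma summable_powr_tail:
  fixes \<theta> :: real
  assumes "0 < \<theta>" "1 \<le> r"
  shows "summable (\<lambda>n. real (Suc (n + r)) powr (- 1 - \<theta>))"
    and "(\<Sum>n. real (Suc (n + r)) powr (- 1 - \<theta>)) \<le> real r powr (- \<theta>) / \<theta>"
proof -
  let ?t = "\<lambda>n. (real (n + r) powr (- \<theta>) - real (Suc n + r) powr (- \<theta>)) / \<theta>"
  have "(\<lambda>n. real (n + r) powr (- \<theta>)) \<longlonglongrightarrow> 0"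
    using assms by real_asymp
  from telescope_sums'[OF this] have t: "?t sums (real r powr (- \<theta>) / \<theta>)"
    using sums_divide[of _ "real r powr (- \<theta>) - 0" \<theta>] by fastforce
  have le: "real (Suc (n + r)) powr (- 1 - \<theta>) \<le> ?t n" for n
    using powr_tail_term_le[of \<theta> "n + r"] assms by simp
  show s: "summable (\<lambda>n. real (Suc (n + r)) powr (- 1 - \<theta>))"
    by (rule summable_comparison_test[OF _ sums_summable[OF t]]) (use le in auto)
  show "(\<Sum>n. real (Suc (n + r)) powr (- 1 - \<theta>)) \<le> real r powr (- \<theta>) / \<theta>"
    using suminf_le[OF le s sums_summable[OF t]] sums_unique[OF t] by simp
qed

locale frac_setting =
  fixes p \<sigma> :: real
  assumes p: "1 < p" and \<sigma>: "0 < \<sigma>" "\<sigma> < 1 / p"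
begin

abbreviation \<kappa> :: "int \<Rightarrow> real" where "\<kappa> \<equiv> kappa p \<sigma>"
abbreviation J :: "real \<Rightarrow> real" where "J t \<equiv> signed_powr t (p - 1)"

lemma sigma_range: "0 < p * \<sigma>" "p * \<sigma> < 1"
  using p \<sigma> by (auto simp: field_simps)

lemma kappa_zero: "\<kappa> 0 = 0"
  using sigma_range by (simp add: kappa_eq_heat_mellin)

lemma kappa_Suc_rec:
  "(real (Suc n) + 1 + p * \<sigma> / 2) * \<kappa> (int (Suc (Suc n))) = (real (Suc n) - p * \<sigma> / 2) * \<kappa> (int (Suc n))"
  using sigma_range by (intro kappa_rec) auto

lemma kappa_pos: "x \<noteq> 0 \<Longrightarrow> 0 < \<kappa> x"
proof -
  have *: "0 < \<kappa> (int (Suc n))" for n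
  proof (induction n)
    case 0
    then show ?case using sigma_range kappa_pos_off_diagonal[of p \<sigma>] by simp
  next
    case (Suc n)
    have "0 < (real (Suc n) - p * \<sigma> / 2) * \<kappa> (int (Suc n))"
      using Suc sigma_range by (intro mult_pos_pos) auto
    then have "0 < (real (Suc n) + 1 + p * \<sigma> / 2) * \<kappa> (int (Suc (Suc n)))"
      by (simp only: kappa_Suc_rec)
    moreover have "0 < real (Suc n) + 1 + p * \<sigma> / 2" using sigma_range by simp
    ultimately show ?case by (simp only: zero_less_mult_pos)
  qed
  assume "x \<noteq> 0"
  then have "\<kappa> x = \<kappa> \<bar>x\<bar>" "\<bar>x\<bar> = int (Suc (nat (\<bar>x\<bar> - 1)))"
    using kappa_uminus[of p \<sigma> x] by (auto simp: abs_if)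
  then show "0 < \<kappa> x" using * by metis
qed

lemma kappa_nonneg: "0 \<le> \<kappa> x"
  using kappa_pos[of x] kappa_zero by (cases "x = 0") auto

lemma kappa_commute: "\<kappa> (x - y) = \<kappa> (y - x)"
  using kappa_uminus[of p \<sigma> "x - y"] by simp

lemma kappa_LIMSEQ: "\<exists>L>0. (\<lambda>n. real n powr (1 + p * \<sigma>) * \<kappa> (int n)) \<longlonglongrightarrow> L"
proof -
  define s where "s = p * \<sigma> / 2"
  have s: "0 < s" "s < 1 / 2" using sigma_range by (auto simp: s_def)
  define L where "L = \<kappa> (int (Suc 0)) * Gamma (2 + s) / Gamma (1 - s)"
  have "(\<lambda>n. real n powr ((2 + s) - (1 - s)) * \<kappa> (int (Suc n))) \<longlonglongrightarrow> L"
    unfolding L_def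
  proof (rule gamma_ratio_recurrence_LIMSEQ)
    show "(real n + (2 + s)) * \<kappa> (int (Suc (Suc n))) = (real n + (1 - s)) * \<kappa> (int (Suc n))" for n
      using kappa_Suc_rec[of n] by (simp add: s_def algebra_simps)
  qed (use s in auto)
  moreover have "(2 + s) - (1 - s) = 1 + p * \<sigma>" by (simp add: s_def)
  moreover have "(\<lambda>n. (real (Suc n) / real n) powr (1 + p * \<sigma>)) \<longlonglongrightarrow> 1"
    using sigma_range by real_asymp
  ultimately have "(\<lambda>n. (real (Suc n) / real n) powr (1 + p * \<sigma>) * (real n powr (1 + p * \<sigma>) * \<kappa> (int (Suc n)))) \<longlonglongrightarrow> 1 * L"
    by (intro tendsto_mult) auto
  moreover have "eventually (\<lambda>n. (real (Suc n) / real n) powr (1 + p * \<sigma>) * (real n powr (1 + p * \<sigma>) * \<kappa> (int (Suc n)))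
      = real (Suc n) powr (1 + p * \<sigma>) * \<kappa> (int (Suc n))) sequentially"
    by (rule eventually_sequentiallyI[of 1]) (auto simp: powr_divide)
  ultimately have "(\<lambda>n. real (Suc n) powr (1 + p * \<sigma>) * \<kappa> (int (Suc n))) \<longlonglongrightarrow> L"
    by (auto intro: Lim_transform_eventually)
  then have "(\<lambda>n. real n powr (1 + p * \<sigma>) * \<kappa> (int n)) \<longlonglongrightarrow> L"
    by (rule LIMSEQ_imp_Suc)
  moreover have "0 < L"
    unfolding L_def using s kappa_pos[of "int (Suc 0)"] Gamma_real_pos[of "2 + s"] Gamma_real_pos[of "1 - s"] by simp
  ultimately show ?thesis by blast
qed

lemma kappa_bounds:
  obtains c C where "0 < c" "0 < C"
    "\<And>x. x \<noteq> 0 \<Longrightarrow> c * real_of_int \<bar>x\<bar> powr (- 1 - p * \<sigma>) \<le> \<kappa> x"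
    "\<And>x. x \<noteq> 0 \<Longrightarrow> \<kappa> x \<le> C * real_of_int \<bar>x\<bar> powr (- 1 - p * \<sigma>)"
proof -
  obtain L where L: "0 < L" "(\<lambda>n. real n powr (1 + p * \<sigma>) * \<kappa> (int n)) \<longlonglongrightarrow> L"
    using kappa_LIMSEQ by blast
  obtain c C where cC: "0 < c" "0 < C"
    "\<And>n. 1 \<le> n \<Longrightarrow> c \<le> real n powr (1 + p * \<sigma>) * \<kappa> (int n)" "\<And>n. 1 \<le> n \<Longrightarrow> real n powr (1 + p * \<sigma>) * \<kappa> (int n) \<le> C"
    using two_sided_bounds_of_LIMSEQ[OF L(2,1)] kappa_pos by auto
  have e: "\<kappa> x = \<kappa> (int (nat \<bar>x\<bar>))" for x
    using kappa_uminus[of p \<sigma> x] by (cases "x \<ge> 0") auto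
  have r: "real (nat \<bar>x\<bar>) = real_of_int \<bar>x\<bar>" for x by simp
  have m: "real_of_int \<bar>x\<bar> powr (- 1 - p * \<sigma>) = inverse (real_of_int \<bar>x\<bar> powr (1 + p * \<sigma>))" for x
    by (simp add: powr_minus[symmetric])
  show ?thesis
  proof (rule that[OF cC(1,2)])
    fix x :: int assume x: "x \<noteq> 0"
    then have p: "0 < real_of_int \<bar>x\<bar> powr (1 + p * \<sigma>)" by simp
    show "c * real_of_int \<bar>x\<bar> powr (- 1 - p * \<sigma>) \<le> \<kappa> x"
      using cC(3)[of "nat \<bar>x\<bar>"] x p unfolding r m e[symmetric] by (simp add: field_simps)
    show "\<kappa> x \<le> C * real_of_int \<bar>x\<bar> powr (- 1 - p * \<sigma>)"
      using cC(4)[of "nat \<bar>x\<bar>"] x p unfolding r m e[symmetric] by (simp add: field_simps)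
  qed
qed

lemma kappa_summable: "\<kappa> summable_on UNIV"
proof -
  obtain c C where cC: "0 < c" "0 < C"
    "\<And>x. x \<noteq> 0 \<Longrightarrow> c * real_of_int \<bar>x\<bar> powr (- 1 - p * \<sigma>) \<le> \<kappa> x"
    "\<And>x. x \<noteq> 0 \<Longrightarrow> \<kappa> x \<le> C * real_of_int \<bar>x\<bar> powr (- 1 - p * \<sigma>)"
    using kappa_bounds by blast
  show ?thesis
  proof (rule infsum_int_le(1)[where g = "\<lambda>n. C * real n powr (- 1 - p * \<sigma>)"])
    show "\<kappa> x \<le> C * real (nat \<bar>x\<bar>) powr (- 1 - p * \<sigma>)" for x
      using cC(4)[of x] kappa_zero by (cases "x = 0") auto
    have "summable (\<lambda>n. real (n + 2) powr (- 1 - p * \<sigma>))"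
      using summable_powr_tail(1)[of "p * \<sigma>" 1] sigma_range by simp
    then show "summable (\<lambda>n. C * real n powr (- 1 - p * \<sigma>))"
      by (subst (asm) summable_iff_shift) (rule summable_mult)
  qed (rule kappa_nonneg)
qed

lemma kappa_shift_summable: "(\<lambda>y. \<kappa> (x - y)) summable_on UNIV"
proof -
  have "bij_betw (\<lambda>y. x - y) UNIV UNIV"
    by (rule bij_betwI[where g = "\<lambda>y. x - y"]) auto
  then show ?thesis
    using summable_on_reindex_bij_betw[of "\<lambda>y. x - y" UNIV UNIV \<kappa>] kappa_summable by simp
qed

text \<open>The edge weights are summable.\<close>

lemma bounded_in_F_space:
  assumes "\<And>x. \<bar>u x\<bar> \<le> M"
  shows "u \<in> F_space p \<sigma>"
proof -
  have "(\<lambda>y. \<kappa> (x - y) * \<bar>u x - u y\<bar> powr (p - 1)) summable_on UNIV" for x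
  proof (rule summable_on_comparison_test)
    show "(\<lambda>y. \<kappa> (x - y) * (2 * M) powr (p - 1)) summable_on UNIV"
      by (intro summable_on_cmult_left kappa_shift_summable)
    show "\<kappa> (x - y) * \<bar>u x - u y\<bar> powr (p - 1) \<le> \<kappa> (x - y) * (2 * M) powr (p - 1)" for y
      using assms[of x] assms[of y] p kappa_nonneg by (intro mult_left_mono powr_mono2) auto
  qed (simp add: kappa_nonneg)
  then show ?thesis by (simp add: F_space_def)
qed

lemma frac_laplacian_has_sum:
  assumes "v \<in> F_space p \<sigma>"
  shows "((\<lambda>y. \<kappa> (x - y) * J (v x - v y)) has_sum frac_laplacian p \<sigma> v x) UNIV"
proof -
  have "(\<lambda>y. norm (\<kappa> (x - y) * J (v x - v y))) summable_on UNIV"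
    using assms by (auto simp: F_space_def abs_mult signed_powr_abs kappa_nonneg)
  then have "(\<lambda>y. \<kappa> (x - y) * J (v x - v y)) summable_on UNIV"
    by (rule abs_summable_summable)
  then show ?thesis
    unfolding frac_laplacian_def by (rule has_sum_infsum)
qed

text \<open>The double sum of \<open>\<psi>(x) \<kappa>(x-y) J(v x - v y)\<close> has finitely many nonzero rows, each summable as
\<open>v \<in> F_space\<close>. Adding its mirror image under \<open>(x,y) \<mapsto> (y,x)\<close> antisymmetrises \<open>\<psi>\<close>.\<close>

lemma greens_formula:
  assumes v: "v \<in> F_space p \<sigma>" and S: "finite S" "\<And>x. x \<notin> S \<Longrightarrow> \<psi> x = 0"
  shows "((\<lambda>(x, y). \<kappa> (x - y) * (J (v x - v y) * (\<psi> x - \<psi> y))) has_sum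
     2 * (\<Sum>x\<in>S. \<psi> x * frac_laplacian p \<sigma> v x)) UNIV"
proof -
  let ?I = "\<Sum>x\<in>S. \<psi> x * frac_laplacian p \<sigma> v x"
  let ?f = "\<lambda>(x, y). if x \<in> S then \<psi> x * (\<kappa> (x - y) * J (v x - v y)) else 0"
  have f: "(?f has_sum ?I) UNIV"
    by (intro has_sum_finite_rows has_sum_cmult_right frac_laplacian_has_sum v S)
  from has_sum_add[OF f has_sum_swap_pairs[OF f]]
  have "((\<lambda>z. ?f z + (case z of (x, y) \<Rightarrow> ?f (y, x))) has_sum (2 * ?I)) UNIV"
    by simp
  moreover have "(\<lambda>z. ?f z + (case z of (x, y) \<Rightarrow> ?f (y, x))) =
      (\<lambda>(x, y). \<kappa> (x - y) * (J (v x - v y) * (\<psi> x - \<psi> y)))"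
  proof (rule ext)
    fix z :: "int \<times> int"
    obtain x y where z: "z = (x, y)" by (cases z)
    have 1: "?f (x, y) = \<psi> x * (\<kappa> (x - y) * J (v x - v y))" for x y
      using S(2)[of x] by auto
    have "J (v y - v x) = - J (v x - v y)"
      using signed_powr_uminus[of "v x - v y" "p - 1"] by simp
    then have "?f (x, y) + ?f (y, x) = \<kappa> (x - y) * (J (v x - v y) * (\<psi> x - \<psi> y))"
      unfolding 1 by (simp add: kappa_commute[of y x] algebra_simps)
    then show "?f z + (case z of (x, y) \<Rightarrow> ?f (y, x)) =
        (case z of (x, y) \<Rightarrow> \<kappa> (x - y) * (J (v x - v y) * (\<psi> x - \<psi> y)))"
      by (simp add: z)
  qed
  ultimately show ?thesis by (simp only:)
qed

lemma p_energy_has_sum: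
  assumes \<phi>: "finite S" "\<And>x. x \<notin> S \<Longrightarrow> \<phi> x = 0"
  shows "((\<lambda>(x, y). \<kappa> (x - y) * \<bar>\<phi> x - \<phi> y\<bar> powr p) has_sum 2 * p_energy p \<sigma> \<phi>) UNIV"
proof -
  define M where "M = (\<Sum>x\<in>S. \<bar>\<phi> x\<bar>)"
  have M: "\<bar>\<phi> x\<bar> \<le> M" for x
    using \<phi> member_le_sum[of x S "\<lambda>x. \<bar>\<phi> x\<bar>"]
    by (cases "x \<in> S") (auto simp: M_def intro: sum_nonneg)
  let ?f = "\<lambda>(x, y). if x \<in> S then \<kappa> (x - y) * (2 * M) powr p else 0"
  have f: "(?f has_sum (\<Sum>x\<in>S. infsum (\<lambda>y. \<kappa> (x - y)) UNIV * (2 * M) powr p)) UNIV"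
    by (intro has_sum_finite_rows has_sum_cmult_left has_sum_infsum kappa_shift_summable \<phi>)
  have "(\<lambda>(x, y). \<kappa> (x - y) * \<bar>\<phi> x - \<phi> y\<bar> powr p) summable_on UNIV"
  proof (rule summable_on_comparison_test)
    show "(\<lambda>z. ?f z + (case z of (x, y) \<Rightarrow> ?f (y, x))) summable_on UNIV"
      using has_sum_imp_summable[OF has_sum_add[OF f has_sum_swap_pairs[OF f]]] .
    fix z :: "int \<times> int"
    obtain x y where z: "z = (x, y)" by (cases z)
    have le: "\<kappa> (x - y) * \<bar>\<phi> x - \<phi> y\<bar> powr p \<le> \<kappa> (x - y) * (2 * M) powr p"
      using M[of x] M[of y] p kappa_nonneg by (intro mult_left_mono powr_mono2) auto
    have nn: "0 \<le> \<kappa> (x - y) * (2 * M) powr p"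
      using kappa_nonneg by simp
    show "(case z of (x, y) \<Rightarrow> \<kappa> (x - y) * \<bar>\<phi> x - \<phi> y\<bar> powr p) \<le> ?f z + (case z of (x, y) \<Rightarrow> ?f (y, x))"
      using le nn \<phi>(2)[of x] \<phi>(2)[of y] by (auto simp: z kappa_commute[of y x])
    show "0 \<le> (case z of (x, y) \<Rightarrow> \<kappa> (x - y) * \<bar>\<phi> x - \<phi> y\<bar> powr p)"
      using kappa_nonneg by (auto simp: z)
  qed
  then show ?thesis
    unfolding p_energy_def by (simp add: has_sum_infsum)
qed

definition picone_remainder :: "(int \<Rightarrow> real) \<Rightarrow> (int \<Rightarrow> real) \<Rightarrow> int \<Rightarrow> int \<Rightarrow> real" where
  "picone_remainder v \<phi> x y = \<bar>\<phi> x - \<phi> y\<bar> powr p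
     - J (v x - v y) * (\<bar>\<phi> x\<bar> powr p / v x powr (p - 1) - \<bar>\<phi> y\<bar> powr p / v y powr (p - 1))"

lemma picone_remainder_nonneg:
  assumes "\<And>x. 0 < v x"
  shows "0 \<le> picone_remainder v \<phi> x y"
  using picone(1)[of p "v x" "v y" "\<phi> x" "\<phi> y"] assms p by (simp add: picone_remainder_def)

text \<open>Green's formula with the test function \<open>\<bar>\<phi>\<bar> powr p / v powr (p-1)\<close>, subtracted from the energy.\<close>

lemma ground_state_representation:
  assumes v: "v \<in> F_space p \<sigma>" "\<And>x. 0 < v x" and S: "finite S" "\<And>x. x \<notin> S \<Longrightarrow> \<phi> x = 0"
  shows "((\<lambda>(x, y). \<kappa> (x - y) * picone_remainder v \<phi> x y) has_sum
    2 * (p_energy p \<sigma> \<phi> - (\<Sum>x\<in>S. frac_laplacian p \<sigma> v x / v x powr (p - 1) * \<bar>\<phi> x\<bar> powr p))) UNIV"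
proof -
  define \<psi> where "\<psi> x = \<bar>\<phi> x\<bar> powr p / v x powr (p - 1)" for x
  have E: "((\<lambda>(x, y). \<kappa> (x - y) * \<bar>\<phi> x - \<phi> y\<bar> powr p) has_sum 2 * p_energy p \<sigma> \<phi>) UNIV"
    using S by (rule p_energy_has_sum)
  have G: "((\<lambda>(x, y). \<kappa> (x - y) * (J (v x - v y) * (\<psi> x - \<psi> y))) has_sum
     2 * (\<Sum>x\<in>S. \<psi> x * frac_laplacian p \<sigma> v x)) UNIV"
    using v S by (intro greens_formula) (auto simp: \<psi>_def)
  have "((\<lambda>z. (case z of (x, y) \<Rightarrow> \<kappa> (x - y) * \<bar>\<phi> x - \<phi> y\<bar> powr p)
       + - (case z of (x, y) \<Rightarrow> \<kappa> (x - y) * (J (v x - v y) * (\<psi> x - \<psi> y)))) has_sum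
     (2 * p_energy p \<sigma> \<phi> + - (2 * (\<Sum>x\<in>S. \<psi> x * frac_laplacian p \<sigma> v x)))) UNIV"
    by (intro has_sum_add E has_sum_uminusI G)
  moreover have "(\<lambda>z. (case z of (x, y) \<Rightarrow> \<kappa> (x - y) * \<bar>\<phi> x - \<phi> y\<bar> powr p)
       + - (case z of (x, y) \<Rightarrow> \<kappa> (x - y) * (J (v x - v y) * (\<psi> x - \<psi> y))))
     = (\<lambda>(x, y). \<kappa> (x - y) * picone_remainder v \<phi> x y)"
    by (auto simp: fun_eq_iff picone_remainder_def \<psi>_def algebra_simps)
  moreover have "2 * p_energy p \<sigma> \<phi> + - (2 * (\<Sum>x\<in>S. \<psi> x * frac_laplacian p \<sigma> v x))
     = 2 * (p_energy p \<sigma> \<phi> - (\<Sum>x\<in>S. frac_laplacian p \<sigma> v x / v x powr (p - 1) * \<bar>\<phi> x\<bar> powr p))"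
    by (simp add: \<psi>_def mult.commute)
  ultimately show ?thesis by (simp only:)
qed

lemma infsum_finite_support:
  fixes w :: "int \<Rightarrow> real"
  assumes "finite S" "\<And>x. x \<notin> S \<Longrightarrow> \<phi> x = 0"
  shows "(\<Sum>\<^sub>\<infinity>x\<in>UNIV. w x * \<bar>\<phi> x\<bar> powr p) = (\<Sum>x\<in>S. w x * \<bar>\<phi> x\<bar> powr p)"
  by (rule infsumI, rule has_sum_finite_neutralI[where B = S]) (use assms in auto)

text \<open>All terms of the ground state representation are nonnegative, so each one is bounded by the sum.\<close>

lemma picone_remainder_le_hardy_deficit:
  assumes v: "positive_supersolution p \<sigma> w v" and S: "finite S" "\<And>x. x \<notin> S \<Longrightarrow> \<phi> x = 0"
  shows "\<kappa> (a - b) * picone_remainder v \<phi> a b \<le> 2 * (p_energy p \<sigma> \<phi> - (\<Sum>x\<in>S. w x * \<bar>\<phi> x\<bar> powr p))"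
proof -
  have v': "v \<in> F_space p \<sigma>" "\<And>x. 0 < v x" "\<And>x. w x * v x powr (p - 1) \<le> frac_laplacian p \<sigma> v x"
    using v by (auto simp: positive_supersolution_def)
  let ?f = "\<lambda>(x, y). \<kappa> (x - y) * picone_remainder v \<phi> x y"
  have "(?f has_sum ?f (a, b)) {(a, b)}"
    by (rule has_sum_finiteI) auto
  moreover note ground_state_representation[OF v'(1,2) S]
  ultimately have "?f (a, b) \<le> 2 * (p_energy p \<sigma> \<phi> - (\<Sum>x\<in>S. frac_laplacian p \<sigma> v x / v x powr (p - 1) * \<bar>\<phi> x\<bar> powr p))"
    by (rule has_sum_mono2) (use kappa_nonneg picone_remainder_nonneg v'(2) in auto)
  moreover have "(\<Sum>x\<in>S. w x * \<bar>\<phi> x\<bar> powr p) \<le> (\<Sum>x\<in>S. frac_laplacian p \<sigma> v x / v x powr (p - 1) * \<bar>\<phi> x\<bar> powr p)"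
    using v'(3) less_imp_neq[OF v'(2), symmetric]
    by (intro sum_mono mult_right_mono) (auto simp: pos_le_divide_eq)
  ultimately show ?thesis by simp
qed

lemma hardy_type_weight_of_supersolution:
  assumes v: "positive_supersolution p \<sigma> w v"
  shows "hardy_type_weight p \<sigma> w"
  unfolding hardy_type_weight_def finitely_supported_def
proof clarify
  fix \<phi> :: "int \<Rightarrow> real" assume "finite {x. \<phi> x \<noteq> 0}"
  then have S: "finite {x. \<phi> x \<noteq> 0}" "\<And>x. x \<notin> {x. \<phi> x \<noteq> 0} \<Longrightarrow> \<phi> x = 0" by auto
  have "0 \<le> \<kappa> (0 - 0) * picone_remainder v \<phi> 0 0"
    by (simp add: kappa_zero)
  also note picone_remainder_le_hardy_deficit[OF v S]
  finally show "(\<Sum>\<^sub>\<infinity>x\<in>UNIV. w x * \<bar>\<phi> x\<bar> powr p) \<le> p_energy p \<sigma> \<phi>"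
    using infsum_finite_support[OF S] by simp
qed

text \<open>A larger weight \<open>w'\<close> would bound the deficit of \<open>e\<close> from below by \<open>(w' - w) u powr p\<close> at a point where
\<open>e = u\<close>. For another positive supersolution \<open>v\<close>, the remainder of \<open>u\<close> with respect to \<open>v\<close> at a pair of points
equals that of \<open>e\<close> as soon as \<open>e = u\<close> at both of them, and it is bounded by the deficit of \<open>e\<close>. Hence it is \<open>0\<close>.
Any two distinct points are joined by an edge, so the quotient \<open>u/v\<close> is constant.\<close>

lemma null_sequence_imp_critical:
  assumes u: "u \<in> F_space p \<sigma>" "\<And>x. 0 < u x"
    and w: "\<And>x. w x = frac_laplacian p \<sigma> u x / u x powr (p - 1)"
    and null: "\<And>\<delta> x y. 0 < \<delta> \<Longrightarrow> \<exists>e S. finite S \<and> (\<forall>x. x \<notin> S \<longrightarrow> e x = 0) \<and> (\<forall>x. 0 \<le> e x) \<and> e x = u x \<and> e y = u y \<and>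
        p_energy p \<sigma> e - (\<Sum>x\<in>S. w x * \<bar>e x\<bar> powr p) < \<delta>"
  shows "p_critical p \<sigma> w" "agmon_ground_state p \<sigma> w u"
proof -
  have ps: "positive_supersolution p \<sigma> w u"
    unfolding positive_supersolution_def using u by (auto simp: w less_imp_neq[symmetric])
  show "p_critical p \<sigma> w"
    unfolding p_critical_def
  proof (intro conjI notI hardy_type_weight_of_supersolution[OF ps])
    assume "\<exists>w'. hardy_type_weight p \<sigma> w' \<and> (\<forall>x. w x \<le> w' x) \<and> w' \<noteq> w"
    then obtain w' a where w': "hardy_type_weight p \<sigma> w'" "\<And>x. w x \<le> w' x" "w' a \<noteq> w a"
      by (auto simp: fun_eq_iff)
    define \<delta> where "\<delta> = (w' a - w a) * u a powr p"
    have "0 < \<delta>" using w'(2)[of a] w'(3) u(2)[of a] by (simp add: \<delta>_def)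
    then obtain e S where e: "finite S" "\<And>x. x \<notin> S \<Longrightarrow> e x = 0" "e a = u a"
        "p_energy p \<sigma> e - (\<Sum>x\<in>S. w x * \<bar>e x\<bar> powr p) < \<delta>"
      using null[of \<delta> a a] by blast
    have "{x. e x \<noteq> 0} \<subseteq> S" using e(2) by auto
    then have "finite {x. e x \<noteq> 0}" using e(1) by (rule finite_subset)
    then have "(\<Sum>\<^sub>\<infinity>x\<in>UNIV. w' x * \<bar>e x\<bar> powr p) \<le> p_energy p \<sigma> e"
      using w'(1) unfolding hardy_type_weight_def finitely_supported_def by blast
    then have "(\<Sum>x\<in>S. w' x * \<bar>e x\<bar> powr p) \<le> p_energy p \<sigma> e"
      using infsum_finite_support[where \<phi> = e and S = S, OF e(1,2)] by simp
    moreover have "\<delta> \<le> (\<Sum>x\<in>S. (w' x - w x) * \<bar>e x\<bar> powr p)"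
    proof -
      have "a \<in> S" using e(2)[of a] e(3) u(2)[of a] by auto
      then have "(w' a - w a) * \<bar>e a\<bar> powr p \<le> (\<Sum>x\<in>S. (w' x - w x) * \<bar>e x\<bar> powr p)"
        using e(1) w'(2) by (intro member_le_sum[where f = "\<lambda>x. (w' x - w x) * \<bar>e x\<bar> powr p"]) auto
      then show ?thesis using e(3) u(2)[of a] by (simp add: \<delta>_def)
    qed
    ultimately show False using e(4) by (simp add: algebra_simps sum_subtractf)
  qed
  show "agmon_ground_state p \<sigma> w u"
    unfolding agmon_ground_state_def
  proof (intro conjI ps allI impI)
    fix v assume v: "positive_supersolution p \<sigma> w v"
    have vpos: "0 < v x" for x using v by (simp add: positive_supersolution_def)
    have eq: "u x / v x = u y / v y" for x y
    proof (cases "x = y")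
      case False
      define r where "r = \<kappa> (x - y) * picone_remainder v u x y"
      have "r \<le> \<epsilon>" if eps: "0 < \<epsilon>" for \<epsilon>
      proof -
        obtain e S where e: "finite S" "\<And>x. x \<notin> S \<Longrightarrow> e x = 0" "e x = u x" "e y = u y"
            "p_energy p \<sigma> e - (\<Sum>x\<in>S. w x * \<bar>e x\<bar> powr p) < \<epsilon> / 2"
          using null[OF half_gt_zero[OF eps], of x y] by blast
        have "r = \<kappa> (x - y) * picone_remainder v e x y"
          by (simp add: r_def picone_remainder_def e(3,4))
        also have "\<dots> \<le> 2 * (p_energy p \<sigma> e - (\<Sum>x\<in>S. w x * \<bar>e x\<bar> powr p))"
          by (rule picone_remainder_le_hardy_deficit[OF v e(1,2)])
        finally show ?thesis using e(5) by simp
      qed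
      from this[of "r / 2"] have "r \<le> 0" by (cases "0 < r") auto
      moreover have "0 < \<kappa> (x - y)" using False by (intro kappa_pos) auto
      ultimately have "picone_remainder v u x y \<le> 0"
        by (simp add: r_def mult_le_0_iff)
      then have "picone_remainder v u x y = 0"
        using picone_remainder_nonneg[of v u x y] vpos by simp
      then show ?thesis
        using picone(2)[of p "v x" "v y" "u x" "u y"] p vpos u(2)[of x] u(2)[of y]
        by (simp add: picone_remainder_def)
    qed simp
    show "\<exists>c>0. \<forall>x. v x = c * u x"
    proof (intro exI[of _ "v 0 / u 0"] conjI allI)
      show "0 < v 0 / u 0" using vpos u by simp
      show "v x = v 0 / u 0 * u x" for x
        using eq[of x 0] vpos[of x] vpos[of 0] u(2)[of 0] by (simp add: field_simps)
    qed
  qed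
qed

end

section \<open>Null sequences from logarithmic cutoffs\<close>

text \<open>The logarithm grows more slowly than any power, with explicit constants and valid for all \<open>z \<ge> 0\<close>.\<close>

lemma ln_add_one_powr_le:
  fixes z \<theta> m :: real
  assumes "0 \<le> z" "0 < \<theta>" "\<theta> \<le> 1" "0 \<le> m"
  shows "ln (1 + z) powr m \<le> (1 / \<theta>) powr m * z powr (\<theta> * m)"
proof -
  have "\<theta> * ln (1 + z) = ln ((1 + z) powr \<theta>)"
    using assms by (simp add: ln_powr)
  also have "\<dots> \<le> (1 + z) powr \<theta> - 1"
    using assms by (intro ln_le_minus_one) simp
  also have "\<dots> \<le> z powr \<theta>"
    using powr_add_le[of 1 z \<theta>] assms by simp
  finally have "ln (1 + z) \<le> (1 / \<theta>) * z powr \<theta>"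
    using assms by (simp add: field_simps)
  then have "ln (1 + z) powr m \<le> ((1 / \<theta>) * z powr \<theta>) powr m"
    using assms by (intro powr_mono2) auto
  then show ?thesis using assms by (simp add: powr_mult powr_powr powr_divide)
qed

lemma sum_inverse_le_ln: "1 \<le> n \<Longrightarrow> (\<Sum>k=1..n. 1 / real k) \<le> 1 + ln (real n)"
proof (induction n rule: nat_induct_at_least)
  case (Suc n)
  have "ln (real n / real (Suc n)) \<le> real n / real (Suc n) - 1"
    using Suc by (intro ln_le_minus_one) auto
  also have "\<dots> = - (1 / real (Suc n))" by (simp add: field_simps)
  finally have "1 / real (Suc n) \<le> ln (real (Suc n)) - ln (real n)"
    using Suc by (simp add: ln_div)
  then show ?case using Suc by simp
qed simp

text \<open>Equal to \<open>1\<close> for \<open>1 + \<bar>x\<bar> \<le> exp n\<close>, vanishing for \<open>1 + \<bar>x\<bar> \<ge> exp (2n)\<close>, and linear in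
\<open>ln (1 + \<bar>x\<bar>)\<close> in between.\<close>

definition log_cutoff :: "nat \<Rightarrow> int \<Rightarrow> real" where
  "log_cutoff n x = max 0 (min 1 (2 - ln (1 + real_of_int \<bar>x\<bar>) / real n))"

lemma log_cutoff_range: "0 \<le> log_cutoff n x" "log_cutoff n x \<le> 1"
  by (auto simp: log_cutoff_def)

lemma log_cutoff_eq_1: "0 < n \<Longrightarrow> ln (1 + real_of_int \<bar>x\<bar>) \<le> real n \<Longrightarrow> log_cutoff n x = 1"
  by (simp add: log_cutoff_def max_def min_def field_simps)

definition log_ball :: "nat \<Rightarrow> int set" where
  "log_ball n = {x. 1 + real_of_int \<bar>x\<bar> \<le> exp (2 * real n)}"

lemma log_ball_subset: "log_ball n \<subseteq> {- \<lfloor>exp (2 * real n)\<rfloor>..\<lfloor>exp (2 * real n)\<rfloor>}"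
proof
  fix x assume "x \<in> log_ball n"
  then have "real_of_int \<bar>x\<bar> \<le> exp (2 * real n)" by (simp add: log_ball_def)
  then have "\<bar>x\<bar> \<le> \<lfloor>exp (2 * real n)\<rfloor>" by (simp only: le_floor_iff)
  then show "x \<in> {- \<lfloor>exp (2 * real n)\<rfloor>..\<lfloor>exp (2 * real n)\<rfloor>}" by auto
qed

lemma finite_log_ball: "finite (log_ball n)"
  by (rule finite_subset[OF log_ball_subset]) simp

lemma log_cutoff_eq_0:
  assumes "0 < n" "x \<notin> log_ball n"
  shows "log_cutoff n x = 0"
proof -
  have "exp (2 * real n) \<le> 1 + real_of_int \<bar>x\<bar>" using assms by (simp add: log_ball_def)
  then have "ln (exp (2 * real n)) \<le> ln (1 + real_of_int \<bar>x\<bar>)" by (intro ln_mono) auto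
  then show ?thesis using assms by (simp add: log_cutoff_def field_simps)
qed

text \<open>The bound depends on the pair only through \<open>\<bar>x-y\<bar>\<close> and the point closer to \<open>0\<close>, so that it can be
summed over \<open>y\<close> with \<open>x\<close> fixed.\<close>

lemma log_cutoff_diff_le:
  assumes "0 < n" "\<bar>x\<bar> \<le> \<bar>y\<bar>"
  shows "\<bar>log_cutoff n x - log_cutoff n y\<bar> \<le> ln (1 + real_of_int \<bar>x - y\<bar> / (1 + real_of_int \<bar>x\<bar>)) / real n"
proof -
  let ?a = "1 + real_of_int \<bar>x\<bar>" and ?b = "1 + real_of_int \<bar>y\<bar>"
  have "?a \<le> ?b" using assms(2) by (simp only: add_le_cancel_left of_int_le_iff)
  then have le: "ln ?a \<le> ln ?b" by (intro ln_mono) auto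
  have clamp: "\<bar>max 0 (min 1 s) - max 0 (min 1 t)\<bar> \<le> \<bar>s - t\<bar>" for s t :: real by linarith
  have "\<bar>log_cutoff n x - log_cutoff n y\<bar> \<le> \<bar>(2 - ln ?a / real n) - (2 - ln ?b / real n)\<bar>"
    unfolding log_cutoff_def by (rule clamp)
  also have "(2 - ln ?a / real n) - (2 - ln ?b / real n) = (ln ?b - ln ?a) / real n"
    by (simp add: diff_divide_distrib)
  also have "\<bar>\<dots>\<bar> = (ln ?b - ln ?a) / real n" using le by simp
  also have "ln ?b - ln ?a = ln (?b / ?a)"
  proof -
    have "?a \<noteq> 0" "?b \<noteq> 0" by linarith+
    then show ?thesis by (simp add: ln_div)
  qed
  also have "ln (?b / ?a) / real n \<le> ln (1 + real_of_int \<bar>x - y\<bar> / ?a) / real n"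
  proof (intro divide_right_mono ln_mono)
    have "?b \<le> ?a + real_of_int \<bar>x - y\<bar>" by linarith
    then have "?b / ?a \<le> (?a + real_of_int \<bar>x - y\<bar>) / ?a" by (intro divide_right_mono) auto
    moreover have "?a \<noteq> 0" by linarith
    ultimately show "?b / ?a \<le> 1 + real_of_int \<bar>x - y\<bar> / ?a"
      unfolding add_divide_distrib[of ?a "real_of_int \<bar>x - y\<bar>" ?a] by simp
  qed auto
  finally show ?thesis .
qed

lemma sum_log_ball_inverse_le:
  assumes "0 < n"
  shows "(\<Sum>x\<in>log_ball n. 1 / (1 + real_of_int \<bar>x\<bar>)) \<le> 6 * real n"
proof -
  define K where "K = nat \<lfloor>exp (2 * real n)\<rfloor>"
  have K: "1 \<le> K" "real K \<le> exp (2 * real n)"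
  proof -
    have "1 \<le> exp (2 * real n)" by simp
    then show "1 \<le> K" "real K \<le> exp (2 * real n)" unfolding K_def by linarith+
  qed
  have le: "1 + nat \<bar>x\<bar> \<in> {1..K}" if "x \<in> log_ball n" for x
  proof -
    have "real_of_int (1 + \<bar>x\<bar>) \<le> exp (2 * real n)" using that by (simp add: log_ball_def)
    then have "1 + \<bar>x\<bar> \<le> \<lfloor>exp (2 * real n)\<rfloor>" by (simp only: le_floor_iff)
    then show ?thesis by (simp add: K_def)
  qed
  have part: "(\<Sum>x\<in>F. 1 / (1 + real_of_int \<bar>x\<bar>)) \<le> 1 + 2 * real n"
    if F: "F \<subseteq> log_ball n" "inj_on (\<lambda>x. 1 + nat \<bar>x\<bar>) F" for F
  proof -
    have "(\<Sum>x\<in>F. 1 / (1 + real_of_int \<bar>x\<bar>)) = (\<Sum>x\<in>F. 1 / real (1 + nat \<bar>x\<bar>))" by simp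
    also have "\<dots> = (\<Sum>k\<in>(\<lambda>x. 1 + nat \<bar>x\<bar>) ` F. 1 / real k)"
      using F(2) by (simp add: sum.reindex)
    also have "\<dots> \<le> (\<Sum>k=1..K. 1 / real k)"
      using F(1) le by (intro sum_mono2) auto
    also have "\<dots> \<le> 1 + ln (real K)" by (rule sum_inverse_le_ln[OF K(1)])
    also have "ln (real K) \<le> ln (exp (2 * real n))" using K by (intro ln_mono) auto
    finally show ?thesis by simp
  qed
  have "(\<Sum>x\<in>log_ball n. 1 / (1 + real_of_int \<bar>x\<bar>)) =
      (\<Sum>x\<in>log_ball n \<inter> {0..}. 1 / (1 + real_of_int \<bar>x\<bar>)) + (\<Sum>x\<in>log_ball n \<inter> {..<0}. 1 / (1 + real_of_int \<bar>x\<bar>))"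
    using finite_log_ball by (subst sum.union_disjoint[symmetric]) (auto intro!: sum.cong)
  also have "\<dots> \<le> (1 + 2 * real n) + (1 + 2 * real n)"
    by (intro add_mono part) (auto simp: inj_on_def)
  also have "\<dots> \<le> 6 * real n" using assms by simp
  finally show ?thesis .
qed

context frac_setting
begin

text \<open>The sum scales like the integral of \<open>d powr (-1-\<tau>) * ln (1 + d/R) powr m\<close>. Distances \<open>d \<le> R\<close> are
controlled by \<open>ln (1+z) powr m \<le> z\<close>, larger ones by \<open>ln (1+z) powr m\<close> being at most a constant times
\<open>z powr (\<tau>/2)\<close>.\<close>

lemma kappa_log_sum_le:
  fixes m :: real
  assumes m: "1 < m"
  obtains C where "0 < C"
    "\<And>R. 1 \<le> R \<Longrightarrow> (\<lambda>d. \<kappa> d * ln (1 + real_of_int \<bar>d\<bar> / real R) powr m) summable_on UNIV"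
    "\<And>R. 1 \<le> R \<Longrightarrow> infsum (\<lambda>d. \<kappa> d * ln (1 + real_of_int \<bar>d\<bar> / real R) powr m) UNIV \<le> C * real R powr (- (p * \<sigma>))"
proof -
  define \<tau> where "\<tau> = p * \<sigma>"
  have \<tau>: "0 < \<tau>" "\<tau> < 1" using sigma_range by (auto simp: \<tau>_def)
  obtain c A where A: "0 < c" "0 < A" "\<And>x. x \<noteq> 0 \<Longrightarrow> c * real_of_int \<bar>x\<bar> powr (- 1 - p * \<sigma>) \<le> \<kappa> x"
     "\<And>x. x \<noteq> 0 \<Longrightarrow> \<kappa> x \<le> A * real_of_int \<bar>x\<bar> powr (- 1 - p * \<sigma>)"
    using kappa_bounds by blast
  \<comment> \<open>Chosen such that \<open>ln (1+z) powr m\<close> is of order \<open>z powr (\<tau>/2)\<close>, half of the decay that the kernel provides.\<close>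
  define \<theta> where "\<theta> = \<tau> / (2 * m)"
  have \<theta>: "0 < \<theta>" "\<theta> \<le> 1" "\<theta> * m = \<tau> / 2" using \<tau> m by (auto simp: \<theta>_def field_simps)
  define B where "B = A * (1 / \<theta>) powr m"
  have B: "0 < B" using A \<theta> by (simp add: B_def)
  define C where "C = 2 * (A / (1 - \<tau>) + B / (\<tau> / 2))"
  have "0 < C" unfolding C_def using A B \<tau> by (intro mult_pos_pos add_pos_pos divide_pos_pos) auto
  moreover have "(\<lambda>d. \<kappa> d * ln (1 + real_of_int \<bar>d\<bar> / real R) powr m) summable_on UNIV \<and>
      infsum (\<lambda>d. \<kappa> d * ln (1 + real_of_int \<bar>d\<bar> / real R) powr m) UNIV \<le> C * real R powr (- (p * \<sigma>))"
    if R: "1 \<le> R" for R :: nat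
  proof -
    define g where "g n = (if n \<le> R then A * real n powr (- \<tau>) / real R
        else B * real R powr (- (\<tau> / 2)) * real n powr (- 1 - \<tau> / 2))" for n
    have le: "\<kappa> d * ln (1 + real_of_int \<bar>d\<bar> / real R) powr m \<le> g (nat \<bar>d\<bar>)" for d
    proof (cases "d = 0")
      case True
      then show ?thesis by (simp add: g_def kappa_zero)
    next
      case False
      define n where "n = nat \<bar>d\<bar>"
      have n: "1 \<le> n" "real_of_int \<bar>d\<bar> = real n" using False by (auto simp: n_def)
      have k: "\<kappa> d \<le> A * real n powr (- 1 - \<tau>)"
        using A(4)[OF False] n(2) by (simp add: \<tau>_def)
      show ?thesis
      proof (cases "n \<le> R")
        case True
        have "ln (1 + real n / real R) powr m \<le> (1 / 1) powr m * (real n / real R) powr (1 * m)"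
          using m by (intro ln_add_one_powr_le) auto
        also have "\<dots> = (real n / real R) powr m" by simp
        also have "\<dots> \<le> (real n / real R) powr 1"
          using True R n m by (intro powr_mono') auto
        also have "\<dots> = real n / real R" by simp
        finally have "\<kappa> d * ln (1 + real n / real R) powr m \<le> (A * real n powr (- 1 - \<tau>)) * (real n / real R)"
          using k kappa_nonneg A by (intro mult_mono) auto
        also have "\<dots> = A * real n powr (- \<tau>) / real R"
          using n R by (simp add: powr_diff powr_minus field_simps)
        finally show ?thesis using True unfolding n(2) n_def[symmetric] by (simp add: g_def)
      next
        case False
        have "ln (1 + real n / real R) powr m \<le> (1 / \<theta>) powr m * (real n / real R) powr (\<tau> / 2)"
          using ln_add_one_powr_le[of "real n / real R" \<theta> m] m \<theta> by simp
        then have "\<kappa> d * ln (1 + real n / real R) powr m \<le>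
            (A * real n powr (- 1 - \<tau>)) * ((1 / \<theta>) powr m * (real n / real R) powr (\<tau> / 2))"
          using k kappa_nonneg A by (intro mult_mono) auto
        also have "\<dots> = B * real R powr (- (\<tau> / 2)) * (real n powr (- 1 - \<tau>) * real n powr (\<tau> / 2))"
          using n R by (simp add: B_def powr_divide powr_minus field_simps)
        also have "real n powr (- 1 - \<tau>) * real n powr (\<tau> / 2) = real n powr (- 1 - \<tau> / 2)"
        proof -
          have e: "(- 1 - \<tau>) + \<tau> / 2 = - 1 - \<tau> / 2" by (simp add: field_simps)
          show ?thesis by (simp only: powr_add[symmetric] e)
        qed
        finally show ?thesis using False unfolding n(2) n_def[symmetric] by (simp add: g_def)
      qed
    qed
    have tail: "summable (\<lambda>n. g (n + Suc R))" "(\<Sum>n. g (n + Suc R)) \<le> B / (\<tau> / 2) * real R powr (- \<tau>)"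
    proof -
      have e: "g (n + Suc R) = B * real R powr (- (\<tau> / 2)) * real (Suc (n + R)) powr (- 1 - \<tau> / 2)" for n
        by (simp add: g_def)
      have s: "summable (\<lambda>n. real (Suc (n + R)) powr (- 1 - \<tau> / 2))"
        using summable_powr_tail(1)[of "\<tau> / 2" R] R \<tau> by simp
      show "summable (\<lambda>n. g (n + Suc R))" unfolding e by (rule summable_mult[OF s])
      have "(\<Sum>n. g (n + Suc R)) = B * real R powr (- (\<tau> / 2)) * (\<Sum>n. real (Suc (n + R)) powr (- 1 - \<tau> / 2))"
        unfolding e by (rule suminf_mult[OF s])
      also have "\<dots> \<le> B * real R powr (- (\<tau> / 2)) * (real R powr (- (\<tau> / 2)) / (\<tau> / 2))"
        using summable_powr_tail(2)[of "\<tau> / 2" R] R \<tau> B by (intro mult_left_mono) auto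
      also have "\<dots> = B / (\<tau> / 2) * (real R powr (- (\<tau> / 2)) * real R powr (- (\<tau> / 2)))"
        by (simp add: field_simps)
      also have "\<dots> = B / (\<tau> / 2) * real R powr (- \<tau>)"
        by (simp add: powr_add[symmetric])
      finally show "(\<Sum>n. g (n + Suc R)) \<le> B / (\<tau> / 2) * real R powr (- \<tau>)" .
    qed
    have sg: "summable g" using tail(1) summable_iff_shift[of g "Suc R"] by simp
    have "(\<Sum>n<Suc R. g n) = (\<Sum>n=1..R. A / real R * real n powr (- \<tau>))"
    proof -
      have "(\<Sum>n<Suc R. g n) = g 0 + (\<Sum>n=1..R. g n)"
        by (simp add: lessThan_Suc_atMost atMost_atLeast0 sum.atLeast_Suc_atMost)
      also have "g 0 = 0" by (simp add: g_def)
      finally show ?thesis by (simp add: g_def)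
    qed
    also have "\<dots> = A / real R * (\<Sum>n=1..R. real n powr (- \<tau>))" by (simp add: sum_distrib_left)
    also have "\<dots> \<le> A / real R * (real R powr (1 - \<tau>) / (1 - \<tau>))"
      using sum_powr_le[of \<tau> R] \<tau> A by (intro mult_left_mono) auto
    also have "\<dots> = A / (1 - \<tau>) * real R powr (- \<tau>)"
      using R by (simp add: powr_diff powr_minus field_simps)
    finally have sm: "suminf g \<le> A / (1 - \<tau>) * real R powr (- \<tau>) + B / (\<tau> / 2) * real R powr (- \<tau>)"
      using suminf_split_initial_segment[OF sg, of "Suc R"] tail(2) by simp
    have "C * real R powr (- \<tau>) = 2 * (A / (1 - \<tau>) * real R powr (- \<tau>) + B / (\<tau> / 2) * real R powr (- \<tau>))"
      by (simp only: C_def distrib_right mult.assoc)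
    then have "2 * suminf g \<le> C * real R powr (- \<tau>)"
      using mult_left_mono[OF sm, of 2] by simp
    then show ?thesis
      using infsum_int_le[of "\<lambda>d. \<kappa> d * ln (1 + real_of_int \<bar>d\<bar> / real R) powr m", OF _ le sg] kappa_nonneg
      by (auto simp: \<tau>_def)
  qed
  ultimately show ?thesis using that by blast
qed

text \<open>Test with \<open>u\<close> times a logarithmic cutoff of length \<open>n\<close>. By \<open>picone_remainder_le\<close> the deficit is at most
a constant times \<open>n powr (-m)\<close> times the sum over \<open>x\<close> in the support of
\<open>(1 + \<bar>x\<bar>) powr (\<tau>-1) * (1 + \<bar>x\<bar>) powr (-\<tau>)\<close>, where the second factor is the row sum from
\<open>kappa_log_sum_le\<close>. This is a harmonic sum of length \<open>exp (2n)\<close> and contributes a factor of order \<open>n\<close>.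
Since \<open>m = min p 2 > 1\<close>, the product tends to \<open>0\<close>.\<close>

lemma null_sequence_exists:
  assumes u: "u \<in> F_space p \<sigma>" "\<And>x. 0 < u x"
    and decay: "\<And>x. u x powr p \<le> A * (1 + real_of_int \<bar>x\<bar>) powr (p * \<sigma> - 1)"
    and w: "\<And>x. w x = frac_laplacian p \<sigma> u x / u x powr (p - 1)" and \<delta>: "0 < \<delta>"
  shows "\<exists>e S. finite S \<and> (\<forall>x. x \<notin> S \<longrightarrow> e x = 0) \<and> (\<forall>x. 0 \<le> e x) \<and> e x = u x \<and> e y = u y \<and>
        p_energy p \<sigma> e - (\<Sum>x\<in>S. w x * \<bar>e x\<bar> powr p) < \<delta>"
proof -
  define m where "m = min p 2"
  have m: "1 < m" using p by (simp add: m_def)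
  define \<tau> where "\<tau> = p * \<sigma>"
  have A: "0 < A"
    using decay[of 0] u(2)[of 0] by (simp add: less_le_trans[of 0 "u 0 powr p"])
  obtain C where C: "0 \<le> C" "\<And>a b s t. 0 < a \<Longrightarrow> 0 < b \<Longrightarrow> 0 \<le> s \<Longrightarrow> s \<le> 1 \<Longrightarrow> 0 \<le> t \<Longrightarrow> t \<le> 1 \<Longrightarrow>
     \<bar>a * s - b * t\<bar> powr p - J (a - b) * (a * s powr p - b * t powr p) \<le> C * max a b powr p * \<bar>s - t\<bar> powr m"
    unfolding m_def using picone_remainder_le[OF p] by blast
  obtain D where D: "0 < D"
    "\<And>R. 1 \<le> R \<Longrightarrow> (\<lambda>d. \<kappa> d * ln (1 + real_of_int \<bar>d\<bar> / real R) powr m) summable_on UNIV"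
    "\<And>R. 1 \<le> R \<Longrightarrow> infsum (\<lambda>d. \<kappa> d * ln (1 + real_of_int \<bar>d\<bar> / real R) powr m) UNIV \<le> D * real R powr (- (p * \<sigma>))"
    using kappa_log_sum_le[OF m] by blast
  define row where "row x y = \<kappa> (x - y) * ln (1 + real_of_int \<bar>x - y\<bar> / (1 + real_of_int \<bar>x\<bar>)) powr m" for x y
  have row_nonneg: "0 \<le> row x y" for x y by (simp add: row_def kappa_nonneg)
  define G where "G x = infsum (row x) UNIV" for x
  have row: "(row x has_sum G x) UNIV" "G x \<le> D * (1 + real_of_int \<bar>x\<bar>) powr (- \<tau>)" for x
  proof -
    define f where "f d = \<kappa> d * ln (1 + real_of_int \<bar>d\<bar> / real (1 + nat \<bar>x\<bar>)) powr m" for d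
    have b: "bij_betw (\<lambda>y. x - y) UNIV UNIV" by (rule bij_betwI[where g = "\<lambda>y. x - y"]) auto
    have e: "row x = (\<lambda>y. f (x - y))" by (simp add: fun_eq_iff row_def f_def)
    have "f summable_on UNIV" unfolding f_def by (intro D(2)) simp
    then have "row x summable_on UNIV"
      unfolding e using summable_on_reindex_bij_betw[OF b, of f] by simp
    then show "(row x has_sum G x) UNIV" unfolding G_def by (rule has_sum_infsum)
    have "G x = infsum f UNIV" unfolding G_def e using infsum_reindex_bij_betw[OF b, of f] by simp
    also have "\<dots> \<le> D * real (1 + nat \<bar>x\<bar>) powr (- (p * \<sigma>))" unfolding f_def by (intro D(3)) simp
    finally show "G x \<le> D * (1 + real_of_int \<bar>x\<bar>) powr (- \<tau>)" by (simp add: \<tau>_def)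
  qed
  have bound: "p_energy p \<sigma> (\<lambda>x. u x * log_cutoff n x) - (\<Sum>x\<in>log_ball n. w x * \<bar>u x * log_cutoff n x\<bar> powr p)
      \<le> 6 * C * A * D * real n powr (1 - m)" if n: "0 < n" for n
  proof -
    let ?e = "\<lambda>x. u x * log_cutoff n x"
    define \<Phi> where "\<Phi> = (\<lambda>(x, y). if x \<in> log_ball n then C * A * (1 + real_of_int \<bar>x\<bar>) powr (\<tau> - 1) * real n powr (- m) * row x y else 0)"
    define T where "T = (\<Sum>x\<in>log_ball n. C * A * (1 + real_of_int \<bar>x\<bar>) powr (\<tau> - 1) * real n powr (- m) * G x)"
    have \<Phi>: "(\<Phi> has_sum T) UNIV"
      unfolding \<Phi>_def T_def by (intro has_sum_finite_rows has_sum_cmult_right row finite_log_ball)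
    have \<Phi>0: "0 \<le> \<Phi> z" for z
      using C A row_nonneg by (auto simp: \<Phi>_def split_def intro!: mult_nonneg_nonneg)
    have ordered: "\<kappa> (x - y) * picone_remainder u ?e x y \<le> \<Phi> (x, y)" if xy: "\<bar>x\<bar> \<le> \<bar>y\<bar>" for x y
    proof (cases "x \<in> log_ball n")
      case False
      have "real_of_int \<bar>x\<bar> \<le> real_of_int \<bar>y\<bar>" using xy by (simp only: of_int_le_iff)
      then have "y \<notin> log_ball n" using False by (auto simp: log_ball_def)
      then have z: "?e x = 0" "?e y = 0" using False n by (simp_all add: log_cutoff_eq_0)
      have "picone_remainder u ?e x y = 0"
        unfolding picone_remainder_def z using p by simp
      then show ?thesis using False by (simp add: \<Phi>_def)
    next
      case True
      define s t where "s = log_cutoff n x" and "t = log_cutoff n y"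
      have e: "\<bar>u x * s\<bar> powr p / u x powr (p - 1) = u x * s powr p" if "0 \<le> s" for x s
        using that u(2)[of x] by (simp add: abs_mult powr_mult powr_diff less_imp_neq[symmetric])
      have st: "0 \<le> s" "s \<le> 1" "0 \<le> t" "t \<le> 1" by (simp_all add: s_def t_def log_cutoff_range)
      have "picone_remainder u ?e x y =
          \<bar>u x * s - u y * t\<bar> powr p - J (u x - u y) * (u x * s powr p - u y * t powr p)"
        unfolding picone_remainder_def s_def[symmetric] t_def[symmetric] using st by (simp only: e)
      also have "\<dots> \<le> C * max (u x) (u y) powr p * \<bar>s - t\<bar> powr m"
        using st u(2) by (intro C)
      also have "\<dots> \<le> C * (A * (1 + real_of_int \<bar>x\<bar>) powr (\<tau> - 1)) *
          (ln (1 + real_of_int \<bar>x - y\<bar> / (1 + real_of_int \<bar>x\<bar>)) / real n) powr m"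
      proof (intro mult_mono mult_left_mono)
        have "(1 + real_of_int \<bar>y\<bar>) powr (\<tau> - 1) \<le> (1 + real_of_int \<bar>x\<bar>) powr (\<tau> - 1)"
        proof (rule powr_mono2')
          show "1 + real_of_int \<bar>x\<bar> \<le> 1 + real_of_int \<bar>y\<bar>"
            using xy by (simp only: add_le_cancel_left of_int_le_iff)
        qed (use sigma_range in \<open>auto simp: \<tau>_def\<close>)
        then have "A * (1 + real_of_int \<bar>y\<bar>) powr (\<tau> - 1) \<le> A * (1 + real_of_int \<bar>x\<bar>) powr (\<tau> - 1)"
          using A by simp
        then show "max (u x) (u y) powr p \<le> A * (1 + real_of_int \<bar>x\<bar>) powr (\<tau> - 1)"
          using decay[of x] decay[of y] unfolding \<tau>_def max_def by (auto intro: order.trans)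
        show "\<bar>s - t\<bar> powr m \<le> (ln (1 + real_of_int \<bar>x - y\<bar> / (1 + real_of_int \<bar>x\<bar>)) / real n) powr m"
          unfolding s_def t_def using n xy m by (intro powr_mono2 log_cutoff_diff_le) auto
      qed (use C A in auto)
      finally have "\<kappa> (x - y) * picone_remainder u ?e x y \<le> \<kappa> (x - y) * (C * (A * (1 + real_of_int \<bar>x\<bar>) powr (\<tau> - 1)) *
          (ln (1 + real_of_int \<bar>x - y\<bar> / (1 + real_of_int \<bar>x\<bar>)) / real n) powr m)"
        using kappa_nonneg by (intro mult_left_mono) auto
      also have "\<dots> = \<Phi> (x, y)"
        using True n by (simp add: \<Phi>_def row_def powr_divide powr_minus field_simps)
      finally show ?thesis .
    qed
    have sym: "picone_remainder u ?e x y = picone_remainder u ?e y x" for x y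
      using signed_powr_uminus[of "u x - u y" "p - 1"]
      by (simp add: picone_remainder_def abs_minus_commute algebra_simps)
    have "2 * (p_energy p \<sigma> ?e - (\<Sum>x\<in>log_ball n. frac_laplacian p \<sigma> u x / u x powr (p - 1) * \<bar>?e x\<bar> powr p)) \<le> T + T"
    proof (rule has_sum_mono[OF ground_state_representation[OF u finite_log_ball] has_sum_add[OF \<Phi> has_sum_swap_pairs[OF \<Phi>]]])
      show "?e x = 0" if "x \<notin> log_ball n" for x using that n by (simp add: log_cutoff_eq_0)
      fix z :: "int \<times> int"
      obtain x y where z: "z = (x, y)" by (cases z)
      show "(case z of (x, y) \<Rightarrow> \<kappa> (x - y) * picone_remainder u ?e x y) \<le> \<Phi> z + (case z of (x, y) \<Rightarrow> \<Phi> (y, x))"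
      proof (cases "\<bar>x\<bar> \<le> \<bar>y\<bar>")
        case True
        then show ?thesis using ordered[of x y] \<Phi>0[of "(y, x)"] by (simp add: z)
      next
        case False
        then show ?thesis using ordered[of y x] \<Phi>0[of "(x, y)"]
          by (simp add: z sym[of y x] kappa_commute[of y x])
      qed
    qed
    moreover have "T \<le> 6 * C * A * D * real n powr (1 - m)"
    proof -
      have "T \<le> (\<Sum>x\<in>log_ball n. C * A * D * real n powr (- m) * (1 / (1 + real_of_int \<bar>x\<bar>)))"
        unfolding T_def
      proof (rule sum_mono)
        fix x
        have "C * A * (1 + real_of_int \<bar>x\<bar>) powr (\<tau> - 1) * real n powr (- m) * G x
            \<le> C * A * (1 + real_of_int \<bar>x\<bar>) powr (\<tau> - 1) * real n powr (- m) * (D * (1 + real_of_int \<bar>x\<bar>) powr (- \<tau>))"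
          using row(2)[of x] C A by (intro mult_left_mono) auto
        also have "\<dots> = C * A * D * real n powr (- m) * ((1 + real_of_int \<bar>x\<bar>) powr (\<tau> - 1) * (1 + real_of_int \<bar>x\<bar>) powr (- \<tau>))"
          by (simp add: mult_ac)
        also have "(1 + real_of_int \<bar>x\<bar>) powr (\<tau> - 1) * (1 + real_of_int \<bar>x\<bar>) powr (- \<tau>) = 1 / (1 + real_of_int \<bar>x\<bar>)"
        proof -
          have e: "(\<tau> - 1) + - \<tau> = - 1" by simp
          show ?thesis by (simp only: powr_add[symmetric] e) (simp add: powr_minus_divide)
        qed
        finally show "C * A * (1 + real_of_int \<bar>x\<bar>) powr (\<tau> - 1) * real n powr (- m) * G x
            \<le> C * A * D * real n powr (- m) * (1 / (1 + real_of_int \<bar>x\<bar>))" .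
      qed
      also have "\<dots> = C * A * D * real n powr (- m) * (\<Sum>x\<in>log_ball n. 1 / (1 + real_of_int \<bar>x\<bar>))"
        by (rule sum_distrib_left[symmetric])
      also have "\<dots> \<le> C * A * D * real n powr (- m) * (6 * real n)"
        using sum_log_ball_inverse_le[OF n] C A D by (intro mult_left_mono) auto
      also have "\<dots> = 6 * C * A * D * real n powr (1 - m)"
        using n by (simp add: powr_diff powr_minus field_simps)
      finally show ?thesis .
    qed
    ultimately show ?thesis by (simp add: w)
  qed
  have "(\<lambda>n. 6 * C * A * D * real n powr (1 - m)) \<longlonglongrightarrow> 6 * C * A * D * 0"
    using m by (intro tendsto_mult tendsto_const tendsto_neg_powr filterlim_real_sequentially) auto
  then have "eventually (\<lambda>n. 6 * C * A * D * real n powr (1 - m) < \<delta>) sequentially"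
    using \<delta> by (intro order_tendstoD(2)) auto
  moreover have "eventually (\<lambda>n. ln (1 + real_of_int \<bar>x\<bar>) \<le> real n) sequentially" for x
    by (intro eventually_sequentiallyI[of "nat \<lceil>ln (1 + real_of_int \<bar>x\<bar>)\<rceil>"]) linarith
  ultimately have "eventually (\<lambda>n. 6 * C * A * D * real n powr (1 - m) < \<delta> \<and> ln (1 + real_of_int \<bar>x\<bar>) \<le> real n \<and>
      ln (1 + real_of_int \<bar>y\<bar>) \<le> real n \<and> 0 < n) sequentially"
    by (intro eventually_conj eventually_gt_at_top) auto
  then obtain n where n: "6 * C * A * D * real n powr (1 - m) < \<delta>" "ln (1 + real_of_int \<bar>x\<bar>) \<le> real n"
      "ln (1 + real_of_int \<bar>y\<bar>) \<le> real n" "0 < n"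
    using eventually_happens'[OF sequentially_bot] by blast
  show ?thesis
  proof (intro exI[of _ "\<lambda>x. u x * log_cutoff n x"] exI[of _ "log_ball n"] conjI allI impI)
    show "p_energy p \<sigma> (\<lambda>x. u x * log_cutoff n x) - (\<Sum>x\<in>log_ball n. w x * \<bar>u x * log_cutoff n x\<bar> powr p) < \<delta>"
      using bound[OF n(4)] n(1) by linarith
  qed (use n u(2) in \<open>auto simp: finite_log_ball log_cutoff_eq_0 log_cutoff_eq_1 log_cutoff_range less_imp_le\<close>)
qed

end

section \<open>The critical profile\<close>

text \<open>Power asymptotics of \<open>f\<close> along an argument of linear growth. Applied to both kernels, with the ratio
of distances as \<open>\<zeta>\<close>.\<close>

lemma regularly_varying_LIMSEQ:
  fixes f :: "nat \<Rightarrow> real" and y :: "nat \<Rightarrow> nat"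
  assumes f: "(\<lambda>n. real n powr \<rho> * f n) \<longlonglongrightarrow> L"
    and y: "(\<lambda>n. real (y n) / real n) \<longlonglongrightarrow> \<zeta>" and \<zeta>: "0 < \<zeta>"
  shows "(\<lambda>n. real n powr \<rho> * f (y n)) \<longlonglongrightarrow> L * \<zeta> powr (- \<rho>)"
proof -
  have ev: "eventually (\<lambda>n. \<zeta> / 2 < real (y n) / real n) sequentially"
    using order_tendstoD(1)[OF y, of "\<zeta> / 2"] \<zeta> by simp
  have ge: "eventually (\<lambda>n. \<zeta> / 2 * real n \<le> real (y n)) sequentially"
    using ev eventually_gt_at_top[of 0]
    by eventually_elim (simp add: field_simps)
  have "filterlim (\<lambda>n. \<zeta> / 2 * real n) at_top sequentially"
    using \<zeta> by (intro filterlim_tendsto_pos_mult_at_top[OF tendsto_const] filterlim_real_sequentially) auto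
  then have "filterlim (\<lambda>n. real (y n)) at_top sequentially"
    using ge by (rule filterlim_at_top_mono)
  then have "filterlim y at_top sequentially"
    by (simp only: filterlim_sequentially_iff_filterlim_real)
  then have "(\<lambda>n. real (y n) powr \<rho> * f (y n)) \<longlonglongrightarrow> L"
    by (rule filterlim_compose[OF f])
  moreover have "(\<lambda>n. (real (y n) / real n) powr (- \<rho>)) \<longlonglongrightarrow> \<zeta> powr (- \<rho>)"
    using y \<zeta> by (intro tendsto_intros) auto
  ultimately have "(\<lambda>n. real (y n) powr \<rho> * f (y n) * (real (y n) / real n) powr (- \<rho>)) \<longlonglongrightarrow> L * \<zeta> powr (- \<rho>)"
    by (rule tendsto_mult)
  moreover have "eventually (\<lambda>n. real (y n) powr \<rho> * f (y n) * (real (y n) / real n) powr (- \<rho>) = real n powr \<rho> * f (y n)) sequentially"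
    using ev eventually_gt_at_top[of 0]
  proof eventually_elim
    case (elim n)
    then have "0 < real (y n) / real n" using \<zeta> by linarith
    then have "0 < real (y n)" "0 < real n" using elim by (auto simp: zero_less_divide_iff)
    then show ?case by (simp add: powr_minus powr_divide field_simps)
  qed
  ultimately show ?thesis by (rule Lim_transform_eventually)
qed

lemma powr_lipschitz_on_segment:
  fixes c C r :: real
  assumes "0 < c" "0 < r"
  obtains K where "0 \<le> K" "\<And>u v. c \<le> u \<Longrightarrow> u \<le> C \<Longrightarrow> c \<le> v \<Longrightarrow> v \<le> C \<Longrightarrow> \<bar>u powr r - v powr r\<bar> \<le> K * \<bar>u - v\<bar>"
proof -
  define K where "K = r * (c powr (r - 1) + C powr (r - 1))"
  have *: "\<bar>v powr r - u powr r\<bar> \<le> K * (v - u)" if uv: "c \<le> u" "u < v" "v \<le> C" for u v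
  proof -
    obtain \<xi> where x: "u < \<xi>" "\<xi> < v" "v powr r - u powr r = (v - u) * (r * \<xi> powr (r - 1))"
      using powr_mean_value[of u v r] uv assms by auto
    have "\<xi> powr (r - 1) \<le> c powr (r - 1) + C powr (r - 1)"
    proof (cases "1 \<le> r")
      case True
      have "\<xi> powr (r - 1) \<le> C powr (r - 1)" using True x uv assms by (intro powr_mono2) auto
      then show ?thesis by (simp add: add_increasing)
    next
      case False
      have "\<xi> powr (r - 1) \<le> c powr (r - 1)" using False x uv assms by (intro powr_mono2') auto
      then show ?thesis by (simp add: add_increasing2)
    qed
    then have "(v - u) * (r * \<xi> powr (r - 1)) \<le> (v - u) * K"
      unfolding K_def using assms uv by (intro mult_left_mono) auto
    moreover have "0 \<le> (v - u) * (r * \<xi> powr (r - 1))" using uv assms by simp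
    ultimately show ?thesis unfolding x(3) by (simp add: mult.commute)
  qed
  show ?thesis
  proof (rule that[of K])
    show "0 \<le> K" using assms by (simp add: K_def)
    show "\<bar>u powr r - v powr r\<bar> \<le> K * \<bar>u - v\<bar>" if "c \<le> u" "u \<le> C" "c \<le> v" "v \<le> C" for u v
      using *[of u v] *[of v u] that by (cases u v rule: linorder_cases) auto
  qed
qed

locale frac_profile = frac_setting +
  fixes q \<alpha> :: real
  assumes q: "1 < q" and \<alpha>: "\<alpha> = (p - 1 + p * \<sigma>) / (p * q)"
begin

definition G :: "int \<Rightarrow> real" where "G = kappa q (- \<alpha>)"

text \<open>This is \<open>q\<alpha>/2\<close>, minus the parameter \<open>\<rho>\<close> that belongs to \<open>G\<close>.\<close>

definition \<mu> :: real where "\<mu> = (p - 1 + p * \<sigma>) / (2 * p)"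
definition \<gamma> :: real where "\<gamma> = (1 - p * \<sigma>) / p"

lemma mu_range: "0 < \<mu>" "\<mu> < 1 / 2"
  using p sigma_range by (auto simp: \<mu>_def field_simps)

lemma gamma_eq: "\<gamma> = 1 - 2 * \<mu>"
  using p by (simp add: \<mu>_def \<gamma>_def field_simps)

lemma gamma_pos: "0 < \<gamma>" using mu_range by (simp add: gamma_eq)

lemma gamma_le_1: "\<gamma> < 1" using mu_range by (simp add: gamma_eq)

lemma gamma_p: "\<gamma> * p = 1 - p * \<sigma>"
  using p by (simp add: \<gamma>_def)

lemma gamma_p1: "\<gamma> * (p - 1) = 1 - p * \<sigma> - \<gamma>"
  using gamma_p by (simp add: algebra_simps)

lemma G_order: "q * (- \<alpha>) / 2 = - \<mu>"
  using p q by (simp add: \<alpha> \<mu>_def field_simps)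

lemma G_uminus: "G (- x) = G x"
  by (simp add: G_def kappa_uminus)

lemma G_abs: "G x = G (int (nat \<bar>x\<bar>))"
  using G_uminus[of x] by (cases "0 \<le> x") auto

lemma G_rec: "(real n + 1 - \<mu>) * G (int (Suc n)) = (real n + \<mu>) * G (int n)"
proof -
  have "- (1 / 2) < q * (- \<alpha>) / 2" "q * (- \<alpha>) / 2 < 0"
    unfolding G_order using mu_range by auto
  then show ?thesis
    using kappa_rec[of q "- \<alpha>" n] unfolding G_order G_def by simp
qed

lemma G_nat_pos: "0 < G (int n)"
proof (induction n)
  case 0
  have "0 < kappa q (- \<alpha>) 0"
    by (rule kappa_pos_diagonal) (unfold G_order, use mu_range in auto)
  then show ?case by (simp add: G_def)
next
  case (Suc n)
  have "0 < (real n + \<mu>) * G (int n)" using Suc mu_range by (intro mult_pos_pos) auto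
  then have "0 < (real n + 1 - \<mu>) * G (int (Suc n))" by (simp only: G_rec)
  moreover have "0 < real n + 1 - \<mu>" using mu_range by simp
  ultimately show ?case by (simp only: zero_less_mult_pos)
qed

lemma G_pos: "0 < G x"
  using G_nat_pos[of "nat \<bar>x\<bar>"] G_abs[of x] by simp

definition DG :: "nat \<Rightarrow> real" where "DG n = G (int n) - G (int (Suc n))"

text \<open>The recurrence of \<open>G\<close> makes its first difference a multiple of \<open>G\<close> itself. Differencing once more
(\<open>DG_diff\<close>) shows that \<open>G\<close> is decreasing and convex on the naturals, with the derivative bounds of a power.\<close>

lemma DG_eq: "DG n = \<gamma> * G (int n) / (real n + 1 - \<mu>)"
proof -
  have "real n + 1 - \<mu> \<noteq> 0" using mu_range by linarith
  have "(real n + 1 - \<mu>) * DG n = (real n + 1 - \<mu>) * G (int n) - (real n + 1 - \<mu>) * G (int (Suc n))"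
    by (simp only: DG_def right_diff_distrib)
  also have "\<dots> = \<gamma> * G (int n)"
    unfolding G_rec gamma_eq by (simp add: algebra_simps)
  finally have "(real n + 1 - \<mu>) * DG n = \<gamma> * G (int n)" .
  then show ?thesis using \<open>real n + 1 - \<mu> \<noteq> 0\<close> by (simp add: eq_divide_eq mult.commute)
qed

lemma DG_pos: "0 < DG n"
  unfolding DG_eq using gamma_pos G_nat_pos[of n] mu_range by (intro divide_pos_pos mult_pos_pos) auto

lemma DG_diff: "DG n - DG (Suc n) = DG n * (1 + \<gamma>) / (real n + 2 - \<mu>)"
proof -
  have n: "real n + 1 - \<mu> \<noteq> 0" "real n + 2 - \<mu> \<noteq> 0" using mu_range by linarith+
  have "(real n + 1 - \<mu>) * DG n = \<gamma> * G (int n)" using n unfolding DG_eq by simp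
  moreover have "(real n + 2 - \<mu>) * DG (Suc n) = \<gamma> * G (int (Suc n))"
  proof -
    have m: "real (Suc n) + 1 - \<mu> = real n + 2 - \<mu>" by simp
    show ?thesis unfolding DG_eq m using n by simp
  qed
  ultimately have "(real n + 1 - \<mu>) * ((real n + 2 - \<mu>) * DG (Suc n)) = \<gamma> * ((real n + 1 - \<mu>) * G (int (Suc n)))"
    and e: "(real n + 1 - \<mu>) * ((real n + \<mu>) * DG n) = (real n + \<mu>) * (\<gamma> * G (int n))"
    by (simp_all only: mult.left_commute)
  then have "(real n + 1 - \<mu>) * ((real n + 2 - \<mu>) * DG (Suc n)) = (real n + 1 - \<mu>) * ((real n + \<mu>) * DG n)"
    unfolding G_rec e by (simp only: mult.left_commute)
  then have "(real n + 2 - \<mu>) * DG (Suc n) = (real n + \<mu>) * DG n"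
    using n(1) by (simp only: mult_cancel_left) simp
  then have "(real n + 2 - \<mu>) * (DG n - DG (Suc n)) = DG n * (1 + \<gamma>)"
    unfolding gamma_eq by (simp add: algebra_simps)
  then show ?thesis using n(2) by (simp add: eq_divide_eq mult.commute)
qed

lemma DG_antimono: "m \<le> n \<Longrightarrow> DG n \<le> DG m"
proof (rule lift_Suc_antimono_le[of DG])
  show "DG (Suc n) \<le> DG n" for n
  proof -
    have "0 \<le> DG n * (1 + \<gamma>) / (real n + 2 - \<mu>)"
      using DG_pos[of n] gamma_pos mu_range by (intro divide_nonneg_nonneg mult_nonneg_nonneg) auto
    then show ?thesis using DG_diff[of n] by linarith
  qed
qed auto

lemma G_diff_eq_sum: "G (int n) - G (int (n + d)) = (\<Sum>i<d. DG (n + i))"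
  by (induction d) (auto simp: DG_def)

lemma G_less: "\<bar>x\<bar> < \<bar>y\<bar> \<Longrightarrow> G y < G x"
proof -
  assume xy: "\<bar>x\<bar> < \<bar>y\<bar>"
  define n d where "n = nat \<bar>x\<bar>" and "d = nat (\<bar>y\<bar> - \<bar>x\<bar>)"
  have d: "0 < d" "nat \<bar>y\<bar> = n + d" using xy by (auto simp: n_def d_def nat_add_distrib[symmetric])
  have "0 < (\<Sum>i<d. DG (n + i))" using d(1) DG_pos by (intro sum_pos) auto
  then show ?thesis
    using G_diff_eq_sum[of n d] G_abs[of x] G_abs[of y] by (simp add: n_def[symmetric] d(2))
qed

lemma G_le: "\<bar>x\<bar> \<le> \<bar>y\<bar> \<Longrightarrow> G y \<le> G x"
proof (cases "\<bar>x\<bar> = \<bar>y\<bar>")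
  case True
  then show ?thesis using G_abs[of x] G_abs[of y] by simp
next
  case False
  assume "\<bar>x\<bar> \<le> \<bar>y\<bar>"
  with False show ?thesis using G_less[of x y] by simp
qed

lemma G_LIMSEQ: "\<exists>L>0. (\<lambda>n. real n powr \<gamma> * G (int n)) \<longlonglongrightarrow> L"
proof -
  have "(\<lambda>n. real n powr ((1 - \<mu>) - \<mu>) * G (int n)) \<longlonglongrightarrow> G (int 0) * Gamma (1 - \<mu>) / Gamma \<mu>"
  proof (rule gamma_ratio_recurrence_LIMSEQ)
    show "(real n + (1 - \<mu>)) * G (int (Suc n)) = (real n + \<mu>) * G (int n)" for n
      using G_rec[of n] by (simp add: algebra_simps)
  qed (use mu_range in auto)
  moreover have "(1 - \<mu>) - \<mu> = \<gamma>" by (simp add: gamma_eq)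
  moreover have "0 < G (int 0) * Gamma (1 - \<mu>) / Gamma \<mu>"
    using mu_range G_nat_pos[of 0] Gamma_real_pos[of "1 - \<mu>"] Gamma_real_pos[of \<mu>] by simp
  ultimately show ?thesis by auto
qed

lemma G_bounds:
  obtains c C where "0 < c" "0 < C"
    "\<And>x. c * (1 + real_of_int \<bar>x\<bar>) powr (- \<gamma>) \<le> G x"
    "\<And>x. G x \<le> C * (1 + real_of_int \<bar>x\<bar>) powr (- \<gamma>)"
proof -
  obtain L where L: "0 < L" "(\<lambda>n. real n powr \<gamma> * G (int n)) \<longlonglongrightarrow> L" using G_LIMSEQ by blast
  have "(\<lambda>n. real (n - 1) / real n) \<longlonglongrightarrow> 1"
  proof (rule Lim_transform_eventually)
    show "(\<lambda>n. (real n - 1) / real n) \<longlonglongrightarrow> 1" by real_asymp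
    show "eventually (\<lambda>n. (real n - 1) / real n = real (n - 1) / real n) sequentially"
      by (rule eventually_sequentiallyI[of 1]) (simp add: of_nat_diff)
  qed
  from regularly_varying_LIMSEQ[OF L(2) this]
  have "(\<lambda>n. real n powr \<gamma> * G (int (n - 1))) \<longlonglongrightarrow> L" by simp
  moreover have "0 < real n powr \<gamma> * G (int (n - 1))" if "1 \<le> n" for n
    using that by (intro mult_pos_pos G_pos) auto
  ultimately obtain c C where cC: "0 < c" "0 < C" "\<And>n. 1 \<le> n \<Longrightarrow> c \<le> real n powr \<gamma> * G (int (n - 1))"
      "\<And>n. 1 \<le> n \<Longrightarrow> real n powr \<gamma> * G (int (n - 1)) \<le> C"
    using two_sided_bounds_of_LIMSEQ[OF _ L(1)] by blast
  have e: "c \<le> (1 + real_of_int \<bar>x\<bar>) powr \<gamma> * G x" "(1 + real_of_int \<bar>x\<bar>) powr \<gamma> * G x \<le> C" for x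
    using cC(3,4)[of "1 + nat \<bar>x\<bar>"] G_abs[of x] by auto
  have pos: "0 < (1 + real_of_int \<bar>x\<bar>) powr \<gamma>" for x :: int
  proof -
    have "1 + real_of_int \<bar>x\<bar> \<noteq> 0" by linarith
    then show ?thesis by simp
  qed
  show ?thesis
    by (rule that[OF cC(1,2)]; unfold powr_minus divide_inverse[symmetric])
       (use e pos in \<open>auto simp: pos_le_divide_eq pos_divide_le_eq mult.commute\<close>)
qed

end

section \<open>Near-diagonal cancellation and the scaling limit\<close>

context frac_profile
begin

lemma G_comparable:
  obtains c C where "0 < c" "0 < C"
    "\<And>x n :: nat. n \<le> 2 * x \<Longrightarrow> c * G (int x) \<le> G (int n)"
    "\<And>x n :: nat. x \<le> 2 * n \<Longrightarrow> G (int n) \<le> C * G (int x)"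
proof -
  obtain c C where cC: "0 < c" "0 < C"
    "\<And>x. c * (1 + real_of_int \<bar>x\<bar>) powr (- \<gamma>) \<le> G x"
    "\<And>x. G x \<le> C * (1 + real_of_int \<bar>x\<bar>) powr (- \<gamma>)"
    using G_bounds by blast
  have up: "G (int n) \<le> (C / c) * 2 powr \<gamma> * G (int x)" if "x \<le> 2 * n" for x n :: nat
  proof -
    have "(1 + real n) powr (- \<gamma>) \<le> ((1 + real x) / 2) powr (- \<gamma>)"
      using that gamma_pos by (intro powr_mono2') auto
    also have "\<dots> = 2 powr \<gamma> * (1 + real x) powr (- \<gamma>)"
      by (simp add: powr_divide powr_minus field_simps)
    finally have "C * (1 + real n) powr (- \<gamma>) \<le> C * (2 powr \<gamma> * (1 + real x) powr (- \<gamma>))"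
      using cC by (intro mult_left_mono) auto
    moreover have "G (int n) \<le> C * (1 + real n) powr (- \<gamma>)" using cC(4)[of "int n"] by simp
    moreover have "(C / c) * 2 powr \<gamma> * (c * (1 + real x) powr (- \<gamma>)) \<le> (C / c) * 2 powr \<gamma> * G (int x)"
      using cC cC(3)[of "int x"] by (intro mult_left_mono) auto
    moreover have "(C / c) * 2 powr \<gamma> * (c * (1 + real x) powr (- \<gamma>)) = C * (2 powr \<gamma> * (1 + real x) powr (- \<gamma>))"
      using cC by simp
    ultimately show ?thesis by linarith
  qed
  define M where "M = (C / c) * 2 powr \<gamma>"
  have M: "0 < M" using cC by (simp add: M_def)
  show ?thesis
  proof (rule that[of "1 / M" M])
    show "1 / M * G (int x) \<le> G (int n)" if "n \<le> 2 * x" for x n :: nat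
      using up[OF that, folded M_def] M by (simp add: field_simps)
    show "G (int n) \<le> M * G (int x)" if "x \<le> 2 * n" for x n :: nat
      using up[OF that] by (simp add: M_def)
  qed (use M in auto)
qed

lemma DG_comparable:
  obtains c C where "0 < c" "0 < C"
    "\<And>x n :: nat. 1 \<le> x \<Longrightarrow> n \<le> 2 * x \<Longrightarrow> c * (G (int x) / real x) \<le> DG n"
    "\<And>x n :: nat. 1 \<le> x \<Longrightarrow> x \<le> 2 * n \<Longrightarrow> DG n \<le> C * (G (int x) / real x)"
proof -
  obtain c C where cC: "0 < c" "0 < C"
    "\<And>x n :: nat. n \<le> 2 * x \<Longrightarrow> c * G (int x) \<le> G (int n)"
    "\<And>x n :: nat. x \<le> 2 * n \<Longrightarrow> G (int n) \<le> C * G (int x)"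
    using G_comparable by blast
  show ?thesis
  proof (rule that[of "\<gamma> * c / 3" "2 * \<gamma> * C"])
    fix x n :: nat assume x: "1 \<le> x"
    show "\<gamma> * c / 3 * (G (int x) / real x) \<le> DG n" if "n \<le> 2 * x"
    proof -
      have "real n + 1 - \<mu> \<le> 3 * real x" "0 < real n + 1 - \<mu>" using x that mu_range by linarith+
      then have "\<gamma> * (c * G (int x)) / (3 * real x) \<le> \<gamma> * G (int n) / (real n + 1 - \<mu>)"
        using gamma_pos cC that G_pos by (intro frac_le mult_left_mono mult_nonneg_nonneg) (auto intro: less_imp_le)
      then show ?thesis by (simp add: DG_eq field_simps)
    qed
    show "DG n \<le> 2 * \<gamma> * C * (G (int x) / real x)" if "x \<le> 2 * n"
    proof -
      have "real x / 2 \<le> real n + 1 - \<mu>" "0 < real x / 2" using x that mu_range by linarith+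
      then have "\<gamma> * G (int n) / (real n + 1 - \<mu>) \<le> \<gamma> * (C * G (int x)) / (real x / 2)"
        using gamma_pos cC that G_pos by (intro frac_le mult_left_mono mult_nonneg_nonneg) (auto intro: less_imp_le)
      then show ?thesis by (simp add: DG_eq field_simps)
    qed
  qed (use gamma_pos cC in auto)
qed

text \<open>Each of the two terms has order \<open>(d/x) powr (p-1)\<close> relative to \<open>G(x) powr (p-1)\<close>. They have opposite
signs, and \<open>P = G(x) - G(x+d)\<close> and \<open>Q = G(x-d) - G(x)\<close> differ only by a second difference, which gains a
factor \<open>d/x\<close>. The exponent \<open>p > \<tau>\<close> makes the singularity of \<open>\<kappa>\<close> summable for every \<open>p > 1\<close>; the exponent
\<open>p - 1\<close> alone would not.\<close>

lemma near_diagonal_bound: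
  obtains K where "0 \<le> K"
    "\<And>x d :: nat. 1 \<le> d \<Longrightarrow> 2 * d \<le> x \<Longrightarrow>
      \<bar>J (G (int x) - G (int (x + d))) + J (G (int x) - G (int (x - d)))\<bar>
        \<le> K * G (int x) powr (p - 1) * (real d / real x) powr p"
proof -
  obtain c C where cC: "0 < c" "0 < C"
    "\<And>x n :: nat. 1 \<le> x \<Longrightarrow> n \<le> 2 * x \<Longrightarrow> c * (G (int x) / real x) \<le> DG n"
    "\<And>x n :: nat. 1 \<le> x \<Longrightarrow> x \<le> 2 * n \<Longrightarrow> DG n \<le> C * (G (int x) / real x)"
    using DG_comparable by blast
  obtain K where K: "0 \<le> K" "\<And>u v. c \<le> u \<Longrightarrow> u \<le> C \<Longrightarrow> c \<le> v \<Longrightarrow> v \<le> C \<Longrightarrow> \<bar>u powr (p - 1) - v powr (p - 1)\<bar> \<le> K * \<bar>u - v\<bar>"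
    using powr_lipschitz_on_segment[of c "p - 1" C] cC p by auto
  have "\<bar>J (G (int x) - G (int (x + d))) + J (G (int x) - G (int (x - d)))\<bar>
        \<le> (K * (4 * C)) * G (int x) powr (p - 1) * (real d / real x) powr p"
    if d: "1 \<le> d" "2 * d \<le> x" for x d :: nat
  proof -
    define b where "b = G (int x) / real x"
    have x: "1 \<le> x" using d by simp
    have b: "0 < b" using x G_pos by (simp add: b_def)
    define P Q where "P = (\<Sum>i<d. DG (x + i))" and "Q = (\<Sum>i<d. DG (x - d + i))"
    have P: "G (int x) - G (int (x + d)) = P" unfolding P_def by (rule G_diff_eq_sum)
    have Q: "G (int x) - G (int (x - d)) = - Q"
      using G_diff_eq_sum[of "x - d" d] d by (simp add: Q_def)
    have near: "c * b \<le> DG n" "DG n \<le> C * b" if "n \<le> 2 * x" "x \<le> 2 * n" for n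
      using cC(3,4)[of x n] x that by (simp_all add: b_def)
    have bounds: "c * b * real d \<le> (\<Sum>i<d. DG (m + i))" "(\<Sum>i<d. DG (m + i)) \<le> C * b * real d"
      if m: "x \<le> 2 * m" "m \<le> x" for m
    proof -
      have "(\<Sum>i<d. c * b) \<le> (\<Sum>i<d. DG (m + i))" using m d by (intro sum_mono near) auto
      then show "c * b * real d \<le> (\<Sum>i<d. DG (m + i))" by (simp add: mult_ac)
      have "(\<Sum>i<d. DG (m + i)) \<le> (\<Sum>i<d. C * b)" using m d by (intro sum_mono near) auto
      then show "(\<Sum>i<d. DG (m + i)) \<le> C * b * real d" by (simp add: mult_ac)
    qed
    have step: "DG n - DG (Suc n) \<le> 4 * C * b / real x" if n: "n \<le> 2 * x" "x \<le> 2 * n" for n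
    proof -
      have "DG n * (1 + \<gamma>) / (real n + 2 - \<mu>) \<le> (C * b) * 2 / (real x / 2)"
        using near[OF n] DG_pos[of n] gamma_pos gamma_le_1 n x mu_range cC b
        by (intro frac_le mult_mono) auto
      then show ?thesis unfolding DG_diff by (simp add: field_simps)
    qed
    have PQ: "0 \<le> Q - P" "Q - P \<le> real d * (real d * (4 * C * b / real x))"
    proof -
      have e: "Q - P = (\<Sum>i<d. DG (x - d + i) - DG (x + i))"
        by (simp add: P_def Q_def sum_subtractf)
      show "0 \<le> Q - P" unfolding e by (intro sum_nonneg) (use DG_antimono in auto)
      have "DG (x - d + i) - DG (x + i) \<le> real d * (4 * C * b / real x)" if i: "i < d" for i
      proof -
        have "DG (x - d + i) - DG (x + i) = (\<Sum>j<d. DG (x - d + i + j) - DG (Suc (x - d + i + j)))"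
        proof -
          have t: "DG m - DG (m + k) = (\<Sum>j<k. DG (m + j) - DG (Suc (m + j)))" for m k
            by (induction k) auto
          show ?thesis using t[of "x - d + i" d] d i by (simp add: algebra_simps)
        qed
        also have "\<dots> \<le> (\<Sum>j<d. 4 * C * b / real x)" using d i by (intro sum_mono step) auto
        finally show ?thesis by simp
      qed
      then have "(\<Sum>i<d. DG (x - d + i) - DG (x + i)) \<le> (\<Sum>i<d. real d * (4 * C * b / real x))"
        by (intro sum_mono) auto
      then show "Q - P \<le> real d * (real d * (4 * C * b / real x))" unfolding e by simp
    qed
    have pos: "0 \<le> P" "0 \<le> Q"
      unfolding P_def Q_def by (intro sum_nonneg less_imp_le DG_pos)+
    \<comment> \<open>The common order of \<open>P\<close> and \<open>Q\<close>. Dividing by it confines both to a fixed segment, on which \<open>powr\<close> is Lipschitz.\<close>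
    define h where "h = b * real d"
    have h: "0 < h" using b d by (simp add: h_def)
    have Pb: "c \<le> P / h" "P / h \<le> C" "c \<le> Q / h" "Q / h \<le> C"
      using bounds[of x] bounds[of "x - d"] d h x unfolding P_def[symmetric] Q_def[symmetric] h_def
      by (auto simp: field_simps)
    have "\<bar>(P / h) powr (p - 1) - (Q / h) powr (p - 1)\<bar> \<le> K * \<bar>P / h - Q / h\<bar>"
      using Pb by (intro K)
    also have "\<bar>P / h - Q / h\<bar> = (Q - P) / h"
      using PQ(1) h by (simp add: diff_divide_distrib[symmetric])
    also have "(Q - P) / h \<le> real d * (real d * (4 * C * b / real x)) / h"
      using PQ(2) h by (intro divide_right_mono) auto
    also have "\<dots> = 4 * C * (real d / real x)" using b d by (simp add: h_def)
    finally have "\<bar>(P / h) powr (p - 1) - (Q / h) powr (p - 1)\<bar> \<le> K * (4 * C * (real d / real x))"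
      using K(1) by (simp add: mult_left_mono)
    then have "h powr (p - 1) * \<bar>(P / h) powr (p - 1) - (Q / h) powr (p - 1)\<bar>
        \<le> h powr (p - 1) * (K * (4 * C * (real d / real x)))"
      by (intro mult_left_mono) auto
    moreover have "h powr (p - 1) * \<bar>(P / h) powr (p - 1) - (Q / h) powr (p - 1)\<bar>
        = \<bar>P powr (p - 1) - Q powr (p - 1)\<bar>"
    proof -
      have "h powr (p - 1) * ((P / h) powr (p - 1) - (Q / h) powr (p - 1)) = P powr (p - 1) - Q powr (p - 1)"
        using h pos by (simp add: powr_divide right_diff_distrib)
      from arg_cong[OF this, of abs] show ?thesis by (simp add: abs_mult)
    qed
    moreover have "h powr (p - 1) * (real d / real x) = G (int x) powr (p - 1) * (real d / real x) powr p"
    proof -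
      have "h = G (int x) * (real d / real x)" by (simp add: h_def b_def)
      then have "h powr (p - 1) = G (int x) powr (p - 1) * (real d / real x) powr (p - 1)"
        using powr_mult[of "G (int x)" "real d / real x" "p - 1"] G_pos[of "int x"] by (simp only: less_imp_le)
      moreover have "(real d / real x) powr (p - 1) * (real d / real x) = (real d / real x) powr p"
        using d x by (simp add: powr_diff)
      ultimately show ?thesis by (simp only: mult.assoc)
    qed
    moreover have "J (G (int x) - G (int (x + d))) + J (G (int x) - G (int (x - d))) = P powr (p - 1) - Q powr (p - 1)"
    proof -
      show ?thesis unfolding P Q using pos by (simp add: signed_powr_uminus signed_powr_nonneg)
    qed
    moreover have r: "A * (K * (4 * C * r)) = K * (4 * C) * (A * r)" for A r :: real by simp
    ultimately show ?thesis unfolding r by (simp only: mult.assoc)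
  qed
  then show ?thesis using that[of "K * (4 * C)"] K cC by auto
qed


lemma J_diff_G: "J (G x - z) = G x powr (p - 1) * J (1 - z / G x)"
proof -
  have "G x - z = G x * (1 - z / G x)"
    using G_pos[of x] by (simp add: field_simps)
  then show ?thesis using signed_powr_mult[of "G x"] G_pos[of x] by simp
qed

lemma G_in_F_space: "G \<in> F_space p \<sigma>"
  by (rule bounded_in_F_space[where M = "G 0"]) (use G_le[of 0] G_pos in \<open>auto simp: abs_of_pos\<close>)

text \<open>The joint contribution of the two points at distance \<open>d\<close> to \<open>\<Delta>G(x) / G(x) powr (p-1)\<close>.\<close>

definition profile_term :: "nat \<Rightarrow> nat \<Rightarrow> real" where
  "profile_term x d = \<kappa> (int d) *
     (J (1 - G (int x + int d) / G (int x)) + J (1 - G (int x - int d) / G (int x)))"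

lemma profile_term_sums:
  "(\<lambda>n. profile_term x (Suc n)) sums (frac_laplacian p \<sigma> G (int x) / G (int x) powr (p - 1))"
proof -
  define h where "h d = \<kappa> d * J (G (int x) - G (int x + d))" for d
  have b: "bij_betw (\<lambda>y. y - int x) UNIV UNIV"
    by (rule bij_betwI[where g = "\<lambda>y. y + int x"]) auto
  have e: "(\<lambda>y. \<kappa> (int x - y) * J (G (int x) - G y)) = (\<lambda>y. h (y - int x))"
    by (simp add: fun_eq_iff h_def kappa_commute)
  have "((\<lambda>y. h (y - int x)) has_sum frac_laplacian p \<sigma> G (int x)) UNIV"
    using frac_laplacian_has_sum[OF G_in_F_space, of "int x"] unfolding e .
  then have hs: "(h has_sum frac_laplacian p \<sigma> G (int x)) UNIV"
    using has_sum_reindex_bij_betw[OF b, of h] by simp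
  have "(\<lambda>n. h (int (Suc n)) + h (- int (Suc n))) sums infsum h UNIV"
    using has_sum_imp_summable[OF hs] by (rule infsum_int_sums) (simp add: h_def)
  then have "(\<lambda>n. (h (int (Suc n)) + h (- int (Suc n))) / G (int x) powr (p - 1)) sums
      (frac_laplacian p \<sigma> G (int x) / G (int x) powr (p - 1))"
    using infsumI[OF hs] by (intro sums_divide) simp
  moreover have "(h (int (Suc n)) + h (- int (Suc n))) / G (int x) powr (p - 1) = profile_term x (Suc n)" for n
  proof -
    have "G (int x) powr (p - 1) \<noteq> 0" using G_pos[of "int x"] by simp
    moreover have "(k * (A * u) + k * (A * v)) / A = k * (u + v)" if "A \<noteq> 0" for k A u v :: real
    proof -
      have "k * (A * u) + k * (A * v) = A * (k * (u + v))" by (simp add: algebra_simps)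
      then show ?thesis using that by simp
    qed
    moreover have "int x + - int (Suc n) = int x - int (Suc n)" by simp
    ultimately show ?thesis
      unfolding h_def J_diff_G profile_term_def kappa_uminus by (simp del: of_nat_Suc)
  qed
  ultimately show ?thesis by simp
qed

text \<open>Constant on the intervals \<open>((d-1)/x, d/x]\<close>, so that its integral is the scaled sum over \<open>d\<close>.\<close>

definition profile_step :: "nat \<Rightarrow> real \<Rightarrow> real" where
  "profile_step x z = real x powr (1 + p * \<sigma>) * profile_term x (nat \<lceil>real x * z\<rceil>)"

definition profile_limit :: "real \<Rightarrow> real \<Rightarrow> real" where
  "profile_limit L z = L * z powr (- (1 + p * \<sigma>)) *
     (J (1 - (1 + z) powr (- \<gamma>)) + J (1 - \<bar>1 - z\<bar> powr (- \<gamma>)))"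

lemma G_ratio_LIMSEQ:
  assumes "(\<lambda>n. real (y n) / real n) \<longlonglongrightarrow> \<zeta>" "0 < \<zeta>"
  shows "(\<lambda>n. G (int (y n)) / G (int n)) \<longlonglongrightarrow> \<zeta> powr (- \<gamma>)"
proof -
  obtain L where L: "0 < L" "(\<lambda>n. real n powr \<gamma> * G (int n)) \<longlonglongrightarrow> L" using G_LIMSEQ by blast
  have "(\<lambda>n. (real n powr \<gamma> * G (int (y n))) / (real n powr \<gamma> * G (int n))) \<longlonglongrightarrow> (L * \<zeta> powr (- \<gamma>)) / L"
    using L by (intro tendsto_divide regularly_varying_LIMSEQ[OF L(2) assms]) auto
  moreover have "eventually (\<lambda>n. (real n powr \<gamma> * G (int (y n))) / (real n powr \<gamma> * G (int n)) = G (int (y n)) / G (int n)) sequentially"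
    by (rule eventually_sequentiallyI[of 1]) auto
  ultimately show ?thesis using L by (auto intro: Lim_transform_eventually)
qed

lemma ceiling_ratio_LIMSEQ:
  assumes "0 < z"
  shows "(\<lambda>n. real (nat \<lceil>real n * z\<rceil>) / real n) \<longlonglongrightarrow> z"
proof (rule tendsto_sandwich[of "\<lambda>_. z" _ _ "\<lambda>n. z + 1 / real n"])
  have *: "real n * z \<le> real (nat \<lceil>real n * z\<rceil>)" "real (nat \<lceil>real n * z\<rceil>) \<le> real n * z + 1" for n
  proof -
    have "0 \<le> real n * z" using assms by simp
    then show "real n * z \<le> real (nat \<lceil>real n * z\<rceil>)" "real (nat \<lceil>real n * z\<rceil>) \<le> real n * z + 1"
      by linarith+
  qed
  show "eventually (\<lambda>n. z \<le> real (nat \<lceil>real n * z\<rceil>) / real n) sequentially"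
    using * by (intro eventually_sequentiallyI[of 1]) (auto simp: pos_le_divide_eq mult.commute)
  show "eventually (\<lambda>n. real (nat \<lceil>real n * z\<rceil>) / real n \<le> z + 1 / real n) sequentially"
    using * by (intro eventually_sequentiallyI[of 1]) (auto simp: field_simps)
  show "(\<lambda>n. z + 1 / real n) \<longlonglongrightarrow> z" by real_asymp
qed auto

lemma profile_step_LIMSEQ:
  obtains L where "0 < L"
    "\<And>z. 0 < z \<Longrightarrow> z \<noteq> 1 \<Longrightarrow> (\<lambda>x. profile_step x z) \<longlonglongrightarrow> profile_limit L z"
proof -
  obtain L where L: "0 < L" "(\<lambda>n. real n powr (1 + p * \<sigma>) * \<kappa> (int n)) \<longlonglongrightarrow> L"
    using kappa_LIMSEQ by blast
  have "(\<lambda>x. profile_step x z) \<longlonglongrightarrow> profile_limit L z" if z: "0 < z" "z \<noteq> 1" for z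
  proof -
    define d where "d n = nat \<lceil>real n * z\<rceil>" for n
    have d: "(\<lambda>n. real (d n) / real n) \<longlonglongrightarrow> z"
      unfolding d_def by (rule ceiling_ratio_LIMSEQ[OF z(1)])
    have k: "(\<lambda>n. real n powr (1 + p * \<sigma>) * \<kappa> (int (d n))) \<longlonglongrightarrow> L * z powr (- (1 + p * \<sigma>))"
      by (rule regularly_varying_LIMSEQ[OF L(2) d z(1)])
    have "(\<lambda>n. 1 + real (d n) / real n) \<longlonglongrightarrow> 1 + z" by (intro tendsto_intros d)
    moreover have "eventually (\<lambda>n. 1 + real (d n) / real n = real (n + d n) / real n) sequentially"
      by (rule eventually_sequentiallyI[of 1]) (auto simp: field_simps)
    ultimately have "(\<lambda>n. real (n + d n) / real n) \<longlonglongrightarrow> 1 + z"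
      by (rule Lim_transform_eventually)
    from G_ratio_LIMSEQ[OF this] z have g1: "(\<lambda>n. G (int n + int (d n)) / G (int n)) \<longlonglongrightarrow> (1 + z) powr (- \<gamma>)"
      by simp
    have "(\<lambda>n. \<bar>1 - real (d n) / real n\<bar>) \<longlonglongrightarrow> \<bar>1 - z\<bar>" by (intro tendsto_intros d)
    moreover have "eventually (\<lambda>n. \<bar>1 - real (d n) / real n\<bar> = real (nat \<bar>int n - int (d n)\<bar>) / real n) sequentially"
    proof (rule eventually_sequentiallyI[of 1])
      fix n :: nat assume n: "1 \<le> n"
      then have "1 - real (d n) / real n = (real n - real (d n)) / real n"
        by (simp add: diff_divide_distrib)
      then have "\<bar>1 - real (d n) / real n\<bar> = \<bar>real n - real (d n)\<bar> / real n"
        by (simp add: abs_divide)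
      also have "\<bar>real n - real (d n)\<bar> = real (nat \<bar>int n - int (d n)\<bar>)" by simp
      finally show "\<bar>1 - real (d n) / real n\<bar> = real (nat \<bar>int n - int (d n)\<bar>) / real n" .
    qed
    ultimately have "(\<lambda>n. real (nat \<bar>int n - int (d n)\<bar>) / real n) \<longlonglongrightarrow> \<bar>1 - z\<bar>"
      by (rule Lim_transform_eventually)
    from G_ratio_LIMSEQ[OF this] z have g2: "(\<lambda>n. G (int n - int (d n)) / G (int n)) \<longlonglongrightarrow> \<bar>1 - z\<bar> powr (- \<gamma>)"
      by (simp only: G_abs[symmetric])
    have J: "(\<lambda>n. J (f n)) \<longlonglongrightarrow> J l" if "f \<longlonglongrightarrow> l" for f and l :: real
      using isCont_tendsto_compose[OF isCont_signed_powr that, of "p - 1"] p by simp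
    have "(\<lambda>n. real n powr (1 + p * \<sigma>) * \<kappa> (int (d n)) *
        (J (1 - G (int n + int (d n)) / G (int n)) + J (1 - G (int n - int (d n)) / G (int n)))) \<longlonglongrightarrow> profile_limit L z"
      unfolding profile_limit_def by (intro tendsto_mult k tendsto_add J tendsto_diff tendsto_const g1 g2)
    then show ?thesis
      by (simp add: profile_step_def profile_term_def d_def mult.assoc)
  qed
  with L(1) that show ?thesis by blast
qed

end

section \<open>Dominated convergence for the scaled Laplacian\<close>

lemma integrable_two_sided_singularity:
  fixes \<theta> :: real
  assumes "\<theta> < 1"
  shows "integrable lborel (\<lambda>z. indicator {0<..<2} z * \<bar>1 - z\<bar> powr (- \<theta>))"
proof -
  \<comment> \<open>The two reflected halves add up to the integrand; both vanish at \<open>z = 1\<close>, as \<open>0 powr r = 0\<close>.\<close>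
  define f where "f t = indicator {0<..<1} t * t powr (- \<theta>)" for t :: real
  have f: "integrable lborel f"
    using set_integrable_powr_at_0[of "- \<theta>" 1] assms unfolding set_integrable_def f_def[abs_def] by simp
  have "integrable lborel (\<lambda>z. f (1 + (- 1) * z) + f (- 1 + 1 * z))"
    using f by (intro Bochner_Integration.integrable_add lborel_integrable_real_affine) auto
  moreover have "f (1 + (- 1) * z) + f (- 1 + 1 * z) = indicator {0<..<2} z * \<bar>1 - z\<bar> powr (- \<theta>)" for z
    by (cases z "1 :: real" rule: linorder_cases) (auto simp: f_def indicator_def abs_if)
  ultimately show ?thesis by simp
qed

context frac_profile
begin

text \<open>With \<open>r = d/x\<close>, the kernel contributes \<open>r powr (-1-\<tau>)\<close> and \<open>near_diagonal_bound\<close> contributes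
\<open>r powr p\<close>. As \<open>z \<le> r \<le> 1/2\<close>, the result is bounded by a power of \<open>z\<close> or by \<open>1\<close> according to the sign of the
exponent.\<close>

lemma profile_step_near_le:
  obtains K where "0 \<le> K" "\<And>x z. 4 \<le> x \<Longrightarrow> 0 < z \<Longrightarrow> 2 * nat \<lceil>real x * z\<rceil> \<le> x \<Longrightarrow>
     z < 1 \<and> \<bar>profile_step x z\<bar> \<le> K * (z powr (p - 1 - p * \<sigma>) + 1)"
proof -
  define \<tau> where "\<tau> = p * \<sigma>"
  have \<tau>: "0 < \<tau>" "\<tau> < 1" using sigma_range by (auto simp: \<tau>_def)
  obtain c A where A: "0 < c" "0 < A" "\<And>x. x \<noteq> 0 \<Longrightarrow> c * real_of_int \<bar>x\<bar> powr (- 1 - p * \<sigma>) \<le> \<kappa> x"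
     "\<And>x. x \<noteq> 0 \<Longrightarrow> \<kappa> x \<le> A * real_of_int \<bar>x\<bar> powr (- 1 - p * \<sigma>)"
    using kappa_bounds by blast
  obtain K where K: "0 \<le> K" "\<And>x d :: nat. 1 \<le> d \<Longrightarrow> 2 * d \<le> x \<Longrightarrow>
      \<bar>J (G (int x) - G (int (x + d))) + J (G (int x) - G (int (x - d)))\<bar>
        \<le> K * G (int x) powr (p - 1) * (real d / real x) powr p"
    using near_diagonal_bound by blast
  have "z < 1 \<and> \<bar>profile_step x z\<bar> \<le> (A * K) * (z powr (p - 1 - p * \<sigma>) + 1)"
    if h: "4 \<le> x" "0 < z" "2 * nat \<lceil>real x * z\<rceil> \<le> x" for x z
  proof -
    define d where "d = nat \<lceil>real x * z\<rceil>"
    have xz: "0 < real x * z" using h by simp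
    then have d: "1 \<le> d" "real x * z \<le> real d" unfolding d_def by linarith+
    have d2: "2 * d \<le> x" using h(3) by (simp add: d_def)
    define r where "r = real d / real x"
    have r: "z \<le> r" "r \<le> 1 / 2" "0 < r"
      using d d2 h by (auto simp: r_def field_simps)
    have Gx: "0 < G (int x)" by (rule G_pos)
    define S where "S = J (1 - G (int x + int d) / G (int x)) + J (1 - G (int x - int d) / G (int x))"
    have "\<bar>S\<bar> \<le> K * r powr p"
    proof -
      have "\<bar>J (G (int x) - G (int (x + d))) + J (G (int x) - G (int (x - d)))\<bar> = G (int x) powr (p - 1) * \<bar>S\<bar>"
        unfolding J_diff_G S_def using d2 by (simp add: distrib_left[symmetric] abs_mult of_nat_diff)
      with K(2)[OF d(1) d2] have "G (int x) powr (p - 1) * \<bar>S\<bar> \<le> G (int x) powr (p - 1) * (K * r powr p)"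
        unfolding r_def by (simp only: mult_ac)
      then show ?thesis using Gx by simp
    qed
    moreover have "real x powr (1 + p * \<sigma>) * \<kappa> (int d) \<le> A * r powr (- 1 - \<tau>)"
    proof -
      have "real x powr (1 + p * \<sigma>) * \<kappa> (int d) \<le> real x powr (1 + p * \<sigma>) * (A * real d powr (- 1 - \<tau>))"
        using A(4)[of "int d"] d by (intro mult_left_mono) (auto simp: \<tau>_def)
      also have "\<dots> = A * r powr (- 1 - \<tau>)"
        using h d by (simp add: r_def powr_divide \<tau>_def powr_diff powr_add powr_minus field_simps)
      finally show ?thesis .
    qed
    ultimately have "(real x powr (1 + p * \<sigma>) * \<kappa> (int d)) * \<bar>S\<bar> \<le> (A * r powr (- 1 - \<tau>)) * (K * r powr p)"
      by (intro mult_mono[of "real x powr (1 + p * \<sigma>) * \<kappa> (int d)"]) (use A in auto)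
    also have "\<dots> = A * K * (r powr (- 1 - \<tau>) * r powr p)" by (simp add: mult_ac)
    also have "r powr (- 1 - \<tau>) * r powr p = r powr (p - 1 - \<tau>)"
      unfolding powr_add[symmetric] by (simp add: algebra_simps)
    finally have 1: "\<bar>profile_step x z\<bar> \<le> A * K * r powr (p - 1 - \<tau>)"
      using kappa_nonneg by (simp add: profile_step_def profile_term_def d_def[symmetric] S_def[symmetric] abs_mult mult.assoc)
    have "r powr (p - 1 - \<tau>) \<le> z powr (p - 1 - \<tau>) + 1"
    proof (cases "p - 1 - \<tau> \<le> 0")
      case True
      then have "r powr (p - 1 - \<tau>) \<le> z powr (p - 1 - \<tau>)" using r h by (intro powr_mono2') auto
      then show ?thesis by simp
    next
      case False
      then have "r powr (p - 1 - \<tau>) \<le> 1" using r by (intro powr_le1) auto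
      then show ?thesis by (simp add: add_increasing)
    qed
    then have "A * K * r powr (p - 1 - \<tau>) \<le> A * K * (z powr (p - 1 - \<tau>) + 1)"
      using A K by (intro mult_left_mono) auto
    then show ?thesis using 1 r by (auto simp: \<tau>_def)
  qed
  then show ?thesis using that[of "A * K"] A K by auto
qed

text \<open>The singularity at \<open>z = 1\<close> reflects that \<open>x - d\<close> is close to \<open>0\<close>, where \<open>G\<close> is much larger than \<open>G(x)\<close>.
Its exponent \<open>\<gamma>(p-1) = 1 - \<tau> - \<gamma>\<close> is below \<open>1\<close>, hence it is integrable.\<close>

lemma profile_step_far_le:
  obtains K where "0 \<le> K" "\<And>x z. 4 \<le> x \<Longrightarrow> 0 < z \<Longrightarrow> z \<noteq> 1 \<Longrightarrow> x < 2 * nat \<lceil>real x * z\<rceil> \<Longrightarrow>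
     1 / 4 < z \<and> \<bar>profile_step x z\<bar> \<le> K * (z powr (- 1 - p * \<sigma>) * (1 + \<bar>1 - z\<bar> powr (- (\<gamma> * (p - 1)))))"
proof -
  define \<tau> where "\<tau> = p * \<sigma>"
  have \<tau>: "0 < \<tau>" "\<tau> < 1" using sigma_range by (auto simp: \<tau>_def)
  obtain c A where A: "0 < c" "0 < A" "\<And>x. x \<noteq> 0 \<Longrightarrow> c * real_of_int \<bar>x\<bar> powr (- 1 - p * \<sigma>) \<le> \<kappa> x"
     "\<And>x. x \<noteq> 0 \<Longrightarrow> \<kappa> x \<le> A * real_of_int \<bar>x\<bar> powr (- 1 - p * \<sigma>)"
    using kappa_bounds by blast
  obtain g B where B: "0 < g" "0 < B"
    "\<And>x. g * (1 + real_of_int \<bar>x\<bar>) powr (- \<gamma>) \<le> G x"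
    "\<And>x. G x \<le> B * (1 + real_of_int \<bar>x\<bar>) powr (- \<gamma>)"
    using G_bounds by blast
  define M where "M = ((B / g) * 2 powr \<gamma>) powr (p - 1)"
  have "1 / 4 < z \<and> \<bar>profile_step x z\<bar> \<le> (A * (2 + M)) * (z powr (- 1 - p * \<sigma>) * (1 + \<bar>1 - z\<bar> powr (- (\<gamma> * (p - 1)))))"
    if h: "4 \<le> x" "0 < z" "z \<noteq> 1" "x < 2 * nat \<lceil>real x * z\<rceil>" for x z
  proof -
    define d where "d = nat \<lceil>real x * z\<rceil>"
    have xz: "0 < real x * z" using h by simp
    then have d: "1 \<le> d" "real x * z \<le> real d" "real d < real x * z + 1" unfolding d_def by linarith+
    have d2: "real x < 2 * real d" using h(4) by (simp add: d_def)
    \<comment> \<open>Here \<open>4 \<le> x\<close> absorbs the rounding error \<open>1/x\<close> in \<open>z > d/x - 1/x\<close>.\<close>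
    have z4: "1 / 4 < z"
    proof -
      have "real x / 4 \<le> real x / 2 - 1" using h(1) by simp
      also have "\<dots> < real x * z" using d2 d(3) by simp
      finally show ?thesis using h(1) by (simp add: field_simps)
    qed
    have Gx: "0 < G (int x)" by (rule G_pos)
    define \<rho> where "\<rho> = G (int x - int d) / G (int x)"
    have \<rho>0: "0 < \<rho>" using G_pos by (simp add: \<rho>_def)
    have "\<rho> \<le> (B / g) * 2 powr \<gamma> * \<bar>1 - z\<bar> powr (- \<gamma>)"
    proof -
      define y where "y = 1 + real_of_int \<bar>int x - int d\<bar>"
      have "\<bar>real x - real x * z\<bar> \<le> y" using d by (simp add: y_def)
      moreover have "real x - real x * z = real x * (1 - z)" by (simp add: algebra_simps)
      ultimately have y1: "real x * \<bar>1 - z\<bar> \<le> y" by (simp add: abs_mult)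
      have y0: "0 < real x * \<bar>1 - z\<bar>" using h by simp
      have "(1 + real x) / 2 * \<bar>1 - z\<bar> \<le> real x * \<bar>1 - z\<bar>" using h by (intro mult_right_mono) auto
      then have y2: "(1 + real x) / 2 * \<bar>1 - z\<bar> \<le> y" using y1 by linarith
      have y3: "0 < (1 + real x) / 2 * \<bar>1 - z\<bar>" using h by (intro mult_pos_pos) auto
      have "y powr (- \<gamma>) \<le> ((1 + real x) / 2 * \<bar>1 - z\<bar>) powr (- \<gamma>)"
        by (intro powr_mono2' y2 y3) (use gamma_pos in auto)
      also have "\<dots> = 2 powr \<gamma> * (1 + real x) powr (- \<gamma>) * \<bar>1 - z\<bar> powr (- \<gamma>)"
        unfolding powr_mult powr_divide by (simp add: powr_minus divide_inverse)
      finally have "B * y powr (- \<gamma>) \<le> B * (2 powr \<gamma> * (1 + real x) powr (- \<gamma>) * \<bar>1 - z\<bar> powr (- \<gamma>))"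
        using B by (intro mult_left_mono) auto
      then have n: "G (int x - int d) \<le> B * (2 powr \<gamma> * (1 + real x) powr (- \<gamma>) * \<bar>1 - z\<bar> powr (- \<gamma>))"
        using B(4)[of "int x - int d"] by (simp add: y_def)
      have p1: "0 < g * (1 + real x) powr (- \<gamma>)" using B by simp
      have "g * (1 + real x) powr (- \<gamma>) \<le> G (int x)" using B(3)[of "int x"] by simp
      then have "\<rho> \<le> B * (2 powr \<gamma> * (1 + real x) powr (- \<gamma>) * \<bar>1 - z\<bar> powr (- \<gamma>)) / (g * (1 + real x) powr (- \<gamma>))"
        unfolding \<rho>_def using n p1 G_pos B by (intro frac_le) (auto intro: less_imp_le)
      also have "\<dots> = (B / g) * 2 powr \<gamma> * \<bar>1 - z\<bar> powr (- \<gamma>)" using p1 by simp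
      finally show ?thesis .
    qed
    then have "\<rho> powr (p - 1) \<le> ((B / g) * 2 powr \<gamma> * \<bar>1 - z\<bar> powr (- \<gamma>)) powr (p - 1)"
      using \<rho>0 p by (intro powr_mono2) auto
    also have "\<dots> = M * \<bar>1 - z\<bar> powr (- (\<gamma> * (p - 1)))"
      by (simp only: M_def powr_mult[of "(B / g) * 2 powr \<gamma>"] powr_powr mult_minus_left)
    finally have \<rho>: "\<rho> powr (p - 1) \<le> M * \<bar>1 - z\<bar> powr (- (\<gamma> * (p - 1)))" .
    define S where "S = J (1 - G (int x + int d) / G (int x)) + J (1 - \<rho>)"
    have "\<bar>J (1 - G (int x + int d) / G (int x))\<bar> \<le> 1"
    proof -
      have "G (int x + int d) / G (int x) \<le> 1" "0 \<le> G (int x + int d) / G (int x)"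
        using G_le[of "int x" "int x + int d"] G_pos[of "int x + int d"] Gx by auto
      then have "\<bar>1 - G (int x + int d) / G (int x)\<bar> \<le> 1" by linarith
      then show ?thesis unfolding signed_powr_abs using p by (intro powr_le1) auto
    qed
    moreover have "\<bar>J (1 - \<rho>)\<bar> \<le> 1 + \<rho> powr (p - 1)"
    proof (cases "\<rho> \<le> 1")
      case True
      then have "\<bar>1 - \<rho>\<bar> powr (p - 1) \<le> 1" using \<rho>0 p by (intro powr_le1) auto
      then show ?thesis unfolding signed_powr_abs by (simp add: add_increasing2)
    next
      case False
      then have "\<bar>1 - \<rho>\<bar> powr (p - 1) \<le> \<rho> powr (p - 1)" using p by (intro powr_mono2) auto
      then show ?thesis unfolding signed_powr_abs by (simp add: add_increasing)
    qed
    ultimately have "\<bar>S\<bar> \<le> 2 + M * \<bar>1 - z\<bar> powr (- (\<gamma> * (p - 1)))"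
      using \<rho> unfolding S_def by linarith
    also have "\<dots> \<le> (2 + M) * (1 + \<bar>1 - z\<bar> powr (- (\<gamma> * (p - 1))))"
      by (simp add: M_def distrib_left distrib_right)
    finally have S: "\<bar>S\<bar> \<le> (2 + M) * (1 + \<bar>1 - z\<bar> powr (- (\<gamma> * (p - 1))))" .
    have k: "real x powr (1 + p * \<sigma>) * \<kappa> (int d) \<le> A * z powr (- 1 - \<tau>)"
    proof -
      have "real x powr (1 + p * \<sigma>) * \<kappa> (int d) \<le> real x powr (1 + p * \<sigma>) * (A * real d powr (- 1 - \<tau>))"
        using A(4)[of "int d"] d by (intro mult_left_mono) (auto simp: \<tau>_def)
      also have "\<dots> \<le> real x powr (1 + p * \<sigma>) * (A * (real x * z) powr (- 1 - \<tau>))"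
        using A d xz \<tau> by (intro mult_left_mono powr_mono2') auto
      also have "\<dots> = A * z powr (- 1 - \<tau>)"
        using h by (simp add: powr_mult \<tau>_def powr_diff powr_add powr_minus field_simps)
      finally show ?thesis .
    qed
    have "(real x powr (1 + p * \<sigma>) * \<kappa> (int d)) * \<bar>S\<bar> \<le> (A * z powr (- 1 - \<tau>)) * ((2 + M) * (1 + \<bar>1 - z\<bar> powr (- (\<gamma> * (p - 1)))))"
      by (rule mult_mono[OF k S]) (use A in auto)
    moreover have "\<bar>profile_step x z\<bar> = (real x powr (1 + p * \<sigma>) * \<kappa> (int d)) * \<bar>S\<bar>"
      using kappa_nonneg by (simp add: profile_step_def profile_term_def d_def[symmetric] S_def \<rho>_def abs_mult mult.assoc)
    ultimately show ?thesis using z4 by (simp add: \<tau>_def mult_ac)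
  qed
  then show ?thesis using that[of "A * (2 + M)"] A by (auto simp: M_def)
qed

lemma profile_step_dominated:
  obtains D where "integrable lborel D" "\<And>z. 0 \<le> D z"
    "\<And>x z. 4 \<le> x \<Longrightarrow> 0 < z \<Longrightarrow> z \<noteq> 1 \<Longrightarrow> \<bar>profile_step x z\<bar> \<le> D z"
proof -
  define \<tau> where "\<tau> = p * \<sigma>"
  have \<tau>: "0 < \<tau>" "\<tau> < 1" using sigma_range by (auto simp: \<tau>_def)
  define \<theta> where "\<theta> = \<gamma> * (p - 1)"
  have \<theta>: "0 < \<theta>" "\<theta> < 1" 
  proof -
    show "0 < \<theta>" unfolding \<theta>_def using gamma_pos p by (intro mult_pos_pos) auto
    show "\<theta> < 1" unfolding \<theta>_def gamma_p1 using gamma_pos \<tau> by (simp add: \<tau>_def)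
  qed
  obtain K1 where K1: "0 \<le> K1" "\<And>x z. 4 \<le> x \<Longrightarrow> 0 < z \<Longrightarrow> 2 * nat \<lceil>real x * z\<rceil> \<le> x \<Longrightarrow>
     z < 1 \<and> \<bar>profile_step x z\<bar> \<le> K1 * (z powr (p - 1 - p * \<sigma>) + 1)"
    using profile_step_near_le by blast
  obtain K2 where K2: "0 \<le> K2" "\<And>x z. 4 \<le> x \<Longrightarrow> 0 < z \<Longrightarrow> z \<noteq> 1 \<Longrightarrow> x < 2 * nat \<lceil>real x * z\<rceil> \<Longrightarrow>
     1 / 4 < z \<and> \<bar>profile_step x z\<bar> \<le> K2 * (z powr (- 1 - p * \<sigma>) * (1 + \<bar>1 - z\<bar> powr (- (\<gamma> * (p - 1)))))"
    using profile_step_far_le by blast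
  \<comment> \<open>One summand each for the diagonal at \<open>0\<close>, the tail at infinity and the singularity at \<open>1\<close>.\<close>
  define D1 where "D1 z = indicator {0<..<1} z * z powr (p - 1 - \<tau>) + indicator {0<..<1} z" for z :: real
  define D2 where "D2 z = indicator {1/4<..} z * z powr (- 1 - \<tau>)" for z :: real
  define D3 where "D3 z = indicator {0<..<2} z * \<bar>1 - z\<bar> powr (- \<theta>)" for z :: real
  define D where "D z = K1 * D1 z + (2 * K2 * D2 z + K2 * 4 powr (1 + \<tau>) * D3 z)" for z
  have nn: "0 \<le> D1 z" "0 \<le> D2 z" "0 \<le> D3 z" for z
    by (auto simp: D1_def D2_def D3_def indicator_def)
  have "integrable lborel D"
    unfolding D_def[abs_def]
  proof (intro Bochner_Integration.integrable_add integrable_mult_right)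
    show "integrable lborel D1"
      unfolding D1_def[abs_def]
    proof (rule Bochner_Integration.integrable_add)
      show "integrable lborel (\<lambda>z :: real. indicator {0<..<1} z * z powr (p - 1 - \<tau>))"
        using set_integrable_powr_at_0[of "p - 1 - \<tau>" 1] p \<tau> by (simp add: set_integrable_def)
      show "integrable lborel (\<lambda>z :: real. indicator {0<..<1} z :: real)"
        by (intro integrable_real_indicator) auto
    qed
    show "integrable lborel D2"
      using set_integrable_powr_at_top[of "- 1 - \<tau>" "1/4"] \<tau> by (simp add: set_integrable_def D2_def[abs_def])
    show "integrable lborel D3"
      unfolding D3_def[abs_def] using \<theta> by (intro integrable_two_sided_singularity)
  qed
  moreover have "\<bar>profile_step x z\<bar> \<le> D z" if h: "4 \<le> x" "0 < z" "z \<noteq> 1" for x z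
  proof (cases "2 * nat \<lceil>real x * z\<rceil> \<le> x")
    case True
    from K1(2)[OF h(1,2) True] have z: "z < 1" "\<bar>profile_step x z\<bar> \<le> K1 * (z powr (p - 1 - \<tau>) + 1)"
      by (simp_all add: \<tau>_def)
    have "K1 * (z powr (p - 1 - \<tau>) + 1) = K1 * D1 z" using z h by (simp add: D1_def)
    also have "\<dots> \<le> D z" unfolding D_def using nn K2(1) by simp
    finally show ?thesis using z by simp
  next
    case False
    then have "x < 2 * nat \<lceil>real x * z\<rceil>" by simp
    from K2(2)[OF h(1,2,3) this] have z: "1 / 4 < z"
      "\<bar>profile_step x z\<bar> \<le> K2 * (z powr (- 1 - \<tau>) * (1 + \<bar>1 - z\<bar> powr (- \<theta>)))"
      by (simp_all add: \<tau>_def \<theta>_def)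
    have "z powr (- 1 - \<tau>) * (1 + \<bar>1 - z\<bar> powr (- \<theta>)) \<le> 2 * D2 z + 4 powr (1 + \<tau>) * D3 z"
    proof (cases "z < 2")
      case True
      have "z powr (- 1 - \<tau>) \<le> (1 / 4) powr (- 1 - \<tau>)"
        using z \<tau> by (intro powr_mono2') auto
      also have "\<dots> = 4 powr (1 + \<tau>)" by (simp add: powr_divide powr_diff powr_add powr_minus field_simps)
      finally have "z powr (- 1 - \<tau>) * \<bar>1 - z\<bar> powr (- \<theta>) \<le> 4 powr (1 + \<tau>) * \<bar>1 - z\<bar> powr (- \<theta>)"
        by (intro mult_right_mono) auto
      moreover have "D2 z = z powr (- 1 - \<tau>)" "D3 z = \<bar>1 - z\<bar> powr (- \<theta>)"
        using z True h by (simp_all add: D2_def D3_def)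
      moreover have "0 \<le> z powr (- 1 - \<tau>)" by simp
      moreover have "u * (1 + v) \<le> 2 * u + k * v" if "u * v \<le> k * v" "0 \<le> u" for u v k :: real
        using that by (simp add: distrib_left)
      ultimately show ?thesis by simp
    next
      case False
      then have "\<bar>1 - z\<bar> powr (- \<theta>) \<le> 1 powr (- \<theta>)" using \<theta> by (intro powr_mono2') auto
      then have "z powr (- 1 - \<tau>) * (1 + \<bar>1 - z\<bar> powr (- \<theta>)) \<le> z powr (- 1 - \<tau>) * 2"
        by (intro mult_left_mono) auto
      moreover have "D2 z = z powr (- 1 - \<tau>)" using z by (simp add: D2_def)
      ultimately show ?thesis using nn[of z] by (simp add: add_increasing2)
    qed
    then have "K2 * (z powr (- 1 - \<tau>) * (1 + \<bar>1 - z\<bar> powr (- \<theta>))) \<le> K2 * (2 * D2 z + 4 powr (1 + \<tau>) * D3 z)"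
      using K2 by (intro mult_left_mono)
    also have "\<dots> \<le> D z" unfolding D_def using nn K1(1) by (simp add: algebra_simps)
    finally show ?thesis using z by simp
  qed
  moreover have "0 \<le> D z" for z unfolding D_def using nn K1(1) K2(1) by simp
  ultimately show ?thesis using that by blast
qed

lemma profile_step_measurable [measurable]: "profile_step x \<in> borel_measurable borel"
proof -
  have "(\<lambda>z :: real. nat \<lceil>real x * z\<rceil>) \<in> measurable borel (count_space UNIV)" by measurable
  from measurable_compose[OF this, of "\<lambda>n. real x powr (1 + p * \<sigma>) * profile_term x n" borel]
  show ?thesis unfolding profile_step_def[abs_def] by simp
qed

lemma profile_step_integral:
  assumes x: "4 \<le> x"
  shows "(LINT z:{0<..}|lborel. profile_step x z) =
     real x powr (p * \<sigma>) * (frac_laplacian p \<sigma> G (int x) / G (int x) powr (p - 1))"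
proof -
  obtain D where D: "integrable lborel D" "\<And>z. 0 \<le> D z"
    "\<And>x z. 4 \<le> x \<Longrightarrow> 0 < z \<Longrightarrow> z \<noteq> 1 \<Longrightarrow> \<bar>profile_step x z\<bar> \<le> D z"
    using profile_step_dominated by blast
  define A where "A n = {real n / real x <.. real (Suc n) / real x}" for n
  have x0: "0 < real x" using x by simp
  have mem: "z \<in> A n \<longleftrightarrow> nat \<lceil>real x * z\<rceil> = Suc n" for z n
  proof -
    have "z \<in> A n \<longleftrightarrow> real n < real x * z \<and> real x * z \<le> real (Suc n)"
      using x0 by (auto simp: A_def field_simps)
    also have "\<dots> \<longleftrightarrow> nat \<lceil>real x * z\<rceil> = Suc n" by linarith
    finally show ?thesis .
  qed
  have UA: "(\<Union>n. A n) = {0<..}"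
  proof -
    have "z \<in> (\<Union>n. A n) \<longleftrightarrow> 0 < z" for z
    proof
      assume "z \<in> (\<Union>n. A n)"
      then obtain n where "nat \<lceil>real x * z\<rceil> = Suc n" by (auto simp: mem)
      then have "0 < real x * z" by linarith
      then show "0 < z" using x0 by (simp add: zero_less_mult_iff)
    next
      assume "0 < z"
      then have "0 < real x * z" using x0 by simp
      then have "nat \<lceil>real x * z\<rceil> = Suc (nat \<lceil>real x * z\<rceil> - 1)" by linarith
      then show "z \<in> (\<Union>n. A n)" unfolding UN_iff mem by blast
    qed
    then show ?thesis by auto
  qed
  have "set_integrable lborel {0<..} (profile_step x)"
    unfolding set_integrable_def
  proof (rule Bochner_Integration.integrable_bound[OF D(1)])
    show "AE z in lborel. norm (indicat_real {0<..} z *\<^sub>R profile_step x z) \<le> norm (D z)"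
      using AE_lborel_singleton[of "1 :: real"]
    proof eventually_elim
      case (elim z)
      then show ?case using D(2)[of z] D(3)[OF x, of z] by (auto simp: indicator_def)
    qed
  qed measurable
  then have si: "set_integrable lborel (\<Union>n. A n) (profile_step x)"
    unfolding UA .
  have split: "(LINT z:(\<Union>n. A n)|lborel. profile_step x z) = (\<Sum>n. (LINT z:A n|lborel. profile_step x z))"
  proof (rule lebesgue_integral_countable_add[OF _ _ si])
    show "A n \<in> sets lborel" for n by (simp add: A_def)
    show "A m \<inter> A n = {}" if "m \<noteq> n" for m n using that by (auto simp: disjoint_iff mem)
  qed
  have cell: "(LINT z:A n|lborel. profile_step x z) = real x powr (p * \<sigma>) * profile_term x (Suc n)" for n
  proof -
    have "(LINT z:A n|lborel. profile_step x z) = (LINT z:A n|lborel. real x powr (1 + p * \<sigma>) * profile_term x (Suc n))"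
    proof (rule set_lebesgue_integral_cong)
      show "A n \<in> sets lborel" by (simp add: A_def)
    qed (auto simp: mem profile_step_def)
    also have "\<dots> = measure lborel (A n) *\<^sub>R (real x powr (1 + p * \<sigma>) * profile_term x (Suc n))"
      using x0 by (intro set_integral_const) (auto simp: A_def divide_right_mono)
    also have "measure lborel (A n) = 1 / real x"
      using x0 by (simp add: A_def divide_right_mono diff_divide_distrib[symmetric])
    finally show ?thesis using x0 by (simp add: powr_add)
  qed
  have "(\<Sum>n. real x powr (p * \<sigma>) * profile_term x (Suc n)) =
      real x powr (p * \<sigma>) * (frac_laplacian p \<sigma> G (int x) / G (int x) powr (p - 1))"
    using sums_mult[OF profile_term_sums] by (rule sums_unique[symmetric])
  then show ?thesis using split unfolding UA cell by (rule trans[rotated])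
qed

lemma scaled_laplacian_convergent:
  obtains A where "(\<lambda>x. real x powr (p * \<sigma>) * (frac_laplacian p \<sigma> G (int x) / G (int x) powr (p - 1))) \<longlonglongrightarrow> A"
proof -
  obtain D where D: "integrable lborel D" "\<And>z. 0 \<le> D z"
    "\<And>x z. 4 \<le> x \<Longrightarrow> 0 < z \<Longrightarrow> z \<noteq> 1 \<Longrightarrow> \<bar>profile_step x z\<bar> \<le> D z"
    using profile_step_dominated by blast
  obtain L where L: "\<And>z. 0 < z \<Longrightarrow> z \<noteq> 1 \<Longrightarrow> (\<lambda>x. profile_step x z) \<longlonglongrightarrow> profile_limit L z"
    using profile_step_LIMSEQ by blast
  define s where "s i z = indicator {0<..} z * profile_step (i + 4) z" for i z
  define f where "f z = indicator {0<..} z * profile_limit L z" for z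
  have J [measurable]: "J \<in> borel_measurable borel"
    using isCont_signed_powr[of "p - 1"] p
    by (intro borel_measurable_continuous_onI) (auto simp: continuous_on_eq_continuous_at)
  have lim: "(\<lambda>i. integral\<^sup>L lborel (s i)) \<longlonglongrightarrow> integral\<^sup>L lborel f"
  proof (rule integral_dominated_convergence[where w = D])
    show "f \<in> borel_measurable lborel"
      unfolding f_def[abs_def] profile_limit_def by measurable
    show "s i \<in> borel_measurable lborel" for i
      unfolding s_def[abs_def] by measurable
    show "AE z in lborel. (\<lambda>i. s i z) \<longlonglongrightarrow> f z"
      using AE_lborel_singleton[of "1 :: real"]
    proof eventually_elim
      case (elim z)
      then have "0 < z \<Longrightarrow> (\<lambda>i. profile_step (i + 4) z) \<longlonglongrightarrow> profile_limit L z"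
        using L[of z] by (intro LIMSEQ_ignore_initial_segment) auto
      then show ?case unfolding s_def f_def
        by (cases "0 < z") (auto simp: indicator_def)
    qed
    show "AE z in lborel. norm (s i z) \<le> D z" for i
      using AE_lborel_singleton[of "1 :: real"]
    proof eventually_elim
      case (elim z)
      then show ?case using D(2)[of z] D(3)[of "i + 4" z] by (auto simp: s_def indicator_def)
    qed
  qed (rule D(1))
  then have "(\<lambda>i. real (i + 4) powr (p * \<sigma>) * (frac_laplacian p \<sigma> G (int (i + 4)) / G (int (i + 4)) powr (p - 1)))
      \<longlonglongrightarrow> integral\<^sup>L lborel f"
    using profile_step_integral by (simp add: set_lebesgue_integral_def s_def[abs_def])
  then have "(\<lambda>x. real x powr (p * \<sigma>) * (frac_laplacian p \<sigma> G (int x) / G (int x) powr (p - 1))) \<longlonglongrightarrow> integral\<^sup>L lborel f"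
    by (rule LIMSEQ_offset)
  then show ?thesis by (rule that)
qed

end

section \<open>Positivity of the limit\<close>

context frac_profile
begin

lemma frac_laplacian_G_uminus: "frac_laplacian p \<sigma> G (- x) = frac_laplacian p \<sigma> G x"
proof -
  have b: "bij_betw uminus (UNIV :: int set) UNIV" by (rule bij_betwI[where g = uminus]) auto
  have "\<kappa> (- x - - y) = \<kappa> (x - y)" for y
    using kappa_uminus[of p \<sigma> "x - y"] by simp
  then show ?thesis
    unfolding frac_laplacian_def
    using infsum_reindex_bij_betw[OF b, of "\<lambda>y. \<kappa> (- x - y) * J (G (- x) - G y)"]
    by (simp add: G_uminus)
qed

lemma frac_laplacian_G_abs: "frac_laplacian p \<sigma> G x = frac_laplacian p \<sigma> G (int (nat \<bar>x\<bar>))"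
  using frac_laplacian_G_uminus[of x] by (cases "0 \<le> x") auto

text \<open>Green's formula for \<open>v = G\<close> and \<open>\<psi>\<close> equal to \<open>G\<close> on the interval and \<open>0\<close> outside. Every pair contributes
a nonnegative amount, also the pairs with one point outside, because \<open>G\<close> is larger inside. The pairs
\<open>(x,y)\<close> with \<open>2x < y \<le> 3x\<close> contribute at least a constant times
\<open>x * x powr (-1-\<tau>) * G(x) powr p\<close>, that is, a constant times \<open>1/x\<close>.\<close>

lemma energy_lower_bound:
  obtains c where "0 < c"
    "\<And>M. c * (\<Sum>x=1..M. 1 / real x) \<le> (\<Sum>x\<in>{- int (3 * M)..int (3 * M)}. G x * frac_laplacian p \<sigma> G x)"
proof -
  define \<tau> where "\<tau> = p * \<sigma>"
  obtain k A where k: "0 < k" "0 < A" "\<And>x. x \<noteq> 0 \<Longrightarrow> k * real_of_int \<bar>x\<bar> powr (- 1 - p * \<sigma>) \<le> \<kappa> x"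
     "\<And>x. x \<noteq> 0 \<Longrightarrow> \<kappa> x \<le> A * real_of_int \<bar>x\<bar> powr (- 1 - p * \<sigma>)"
    using kappa_bounds by blast
  obtain g B where B: "0 < g" "0 < B"
    "\<And>x. g * (1 + real_of_int \<bar>x\<bar>) powr (- \<gamma>) \<le> G x"
    "\<And>x. G x \<le> B * (1 + real_of_int \<bar>x\<bar>) powr (- \<gamma>)"
    using G_bounds by blast
  obtain e E where e: "0 < e" "0 < E"
    "\<And>x n :: nat. 1 \<le> x \<Longrightarrow> n \<le> 2 * x \<Longrightarrow> e * (G (int x) / real x) \<le> DG n"
    "\<And>x n :: nat. 1 \<le> x \<Longrightarrow> x \<le> 2 * n \<Longrightarrow> DG n \<le> E * (G (int x) / real x)"
    using DG_comparable by blast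
  define b where "b = e * g * 2 powr (- \<gamma>)"
  have b: "0 < b" using e B by (simp add: b_def)
  define c where "c = k * 2 powr (- 1 - \<tau>) * b powr p / 2"
  have gap: "b * real x powr (- \<gamma>) \<le> G (int x) - G (int y)" if xy: "1 \<le> x" "2 * x \<le> y" for x y :: nat
  proof -
    have "e * G (int x) = (\<Sum>i<x. e * (G (int x) / real x))" using xy by simp
    also have "\<dots> \<le> (\<Sum>i<x. DG (x + i))" using xy by (intro sum_mono e) auto
    also have "\<dots> = G (int x) - G (int (x + x))" by (rule G_diff_eq_sum[symmetric])
    also have "\<dots> \<le> G (int x) - G (int y)" using G_le[of "int (x + x)" "int y"] xy by simp
    finally have 1: "e * G (int x) \<le> G (int x) - G (int y)" .
    have "(2 * real x) powr (- \<gamma>) \<le> (1 + real x) powr (- \<gamma>)"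
      using xy gamma_pos by (intro powr_mono2') auto
    then have "g * (2 * real x) powr (- \<gamma>) \<le> g * (1 + real x) powr (- \<gamma>)"
      using B(1) by (intro mult_left_mono) auto
    also have "\<dots> \<le> G (int x)" using B(3)[of "int x"] by simp
    finally have "e * (g * (2 * real x) powr (- \<gamma>)) \<le> e * G (int x)" using e by (intro mult_left_mono) auto
    moreover have "e * (g * (2 * real x) powr (- \<gamma>)) = b * real x powr (- \<gamma>)"
      by (simp add: b_def powr_mult)
    ultimately show ?thesis using 1 by linarith
  qed
  have "c * (\<Sum>x=1..M. 1 / real x) \<le> (\<Sum>x\<in>{- int (3 * M)..int (3 * M)}. G x * frac_laplacian p \<sigma> G x)" for M
  proof -
    define S where "S = {- int (3 * M)..int (3 * M)}"
    define \<psi> where "\<psi> x = (if x \<in> S then G x else 0)" for x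
    define f where "f = (\<lambda>(x, y). \<kappa> (x - y) * (J (G x - G y) * (\<psi> x - \<psi> y)))"
    have S: "x \<in> S \<longleftrightarrow> \<bar>x\<bar> \<le> int (3 * M)" for x by (auto simp: S_def)
    have Jp: "J t * t = \<bar>t\<bar> powr p" for t
      using picone_refl[of p 1 t 0] p by simp
    have f0: "0 \<le> f (x, y)" for x y
    proof -
      have "0 \<le> J (G x - G y) * (\<psi> x - \<psi> y)"
      proof -
        consider "x \<in> S" "y \<in> S" | "x \<in> S" "y \<notin> S" | "x \<notin> S" "y \<in> S" | "x \<notin> S" "y \<notin> S" by blast
        then show ?thesis
        proof cases
          case 1
          then show ?thesis using Jp by (simp add: \<psi>_def)
        next
          case 2
          then have "G y \<le> G x" by (intro G_le) (simp add: S)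
          then show ?thesis using 2 G_pos[of x] by (simp add: \<psi>_def signed_powr_nonneg)
        next
          case 3
          then have "G x \<le> G y" by (intro G_le) (simp add: S)
          then have "J (G x - G y) \<le> 0" using signed_powr_mono[of "p - 1" "G x - G y" 0] p by simp
          then show ?thesis using 3 G_pos[of y] by (simp add: \<psi>_def mult_nonpos_nonneg)
        next
          case 4
          then show ?thesis by (simp add: \<psi>_def)
        qed
      qed
      then show ?thesis using kappa_nonneg by (simp add: f_def)
    qed
    have gf: "(f has_sum 2 * (\<Sum>x\<in>S. \<psi> x * frac_laplacian p \<sigma> G x)) UNIV"
      unfolding f_def by (intro greens_formula G_in_F_space) (auto simp: S_def \<psi>_def)
    \<comment> \<open>These pairs suffice for a logarithmic lower bound: \<open>y\<close> is comparable to \<open>x\<close>, but \<open>G(x) - G(y)\<close> is comparable to \<open>G(x)\<close>.\<close>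
    define P where "P = Sigma {1..M} (\<lambda>x. {2 * x + 1..3 * x})"
    define \<iota> where "\<iota> = (\<lambda>(x, y). (int x, int y))"
    have fin: "finite P" by (simp add: P_def)
    have inj: "inj_on \<iota> P" by (auto simp: inj_on_def \<iota>_def)
    have "(f has_sum sum f (\<iota> ` P)) (\<iota> ` P)"
      using fin by (intro has_sum_finiteI) auto
    then have "sum f (\<iota> ` P) \<le> 2 * (\<Sum>x\<in>S. \<psi> x * frac_laplacian p \<sigma> G x)"
      by (rule has_sum_mono2[OF _ gf]) (use f0 in auto)
    moreover have "sum f (\<iota> ` P) = (\<Sum>x=1..M. \<Sum>y=2*x+1..3*x. f (int x, int y))"
      using inj by (simp add: sum.reindex P_def \<iota>_def sum.Sigma split_def)
    moreover have "(\<Sum>x=1..M. 2 * c * (1 / real x)) \<le> (\<Sum>x=1..M. \<Sum>y=2*x+1..3*x. f (int x, int y))"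
    proof (rule sum_mono)
      fix x assume x: "x \<in> {1..M}"
      define t where "t = k * (2 * real x) powr (- 1 - \<tau>) * (b * real x powr (- \<gamma>)) powr p"
      have "t \<le> f (int x, int y)" if y: "y \<in> {2 * x + 1..3 * x}" for y
      proof -
        have in_S: "int x \<in> S" "int y \<in> S" using x y by (auto simp: S)
        have "G (int x) - G (int y) \<ge> b * real x powr (- \<gamma>)" using x y by (intro gap) auto
        then have 1: "(b * real x powr (- \<gamma>)) powr p \<le> \<bar>G (int x) - G (int y)\<bar> powr p"
          using b p by (intro powr_mono2) auto
        have "k * (2 * real x) powr (- 1 - \<tau>) \<le> k * (real y - real x) powr (- 1 - \<tau>)"
        proof (intro mult_left_mono powr_mono2')
          show "0 < real y - real x" "real y - real x \<le> 2 * real x" using x y by auto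
        qed (use k sigma_range in \<open>auto simp: \<tau>_def\<close>)
        also have "\<dots> \<le> \<kappa> (int x - int y)"
        proof -
          have a: "real_of_int \<bar>int x - int y\<bar> = real y - real x" using y by simp
          show ?thesis using k(3)[of "int x - int y"] y unfolding a \<tau>_def by simp
        qed
        finally have "t \<le> \<kappa> (int x - int y) * \<bar>G (int x) - G (int y)\<bar> powr p"
          unfolding t_def using 1 by (intro mult_mono) (use kappa_nonneg in auto)
        then show ?thesis using in_S Jp by (simp add: f_def \<psi>_def)
      qed
      then have "(\<Sum>y=2*x+1..3*x. t) \<le> (\<Sum>y=2*x+1..3*x. f (int x, int y))" by (intro sum_mono)
      moreover have "(\<Sum>y=2*x+1..3*x. t) = real x * t" by simp
      moreover have "real x * t = 2 * c * (1 / real x)"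
      proof -
        have "(b * real x powr (- \<gamma>)) powr p = b powr p * real x powr (\<tau> - 1)"
          using gamma_p by (simp add: powr_mult powr_powr \<tau>_def)
        then have "real x * t = 2 * c * (real x * (real x powr (- 1 - \<tau>) * real x powr (\<tau> - 1)))"
          by (simp add: t_def c_def powr_mult)
        also have "real x powr (- 1 - \<tau>) * real x powr (\<tau> - 1) = real x powr (- 2)"
          by (simp add: powr_add[symmetric])
        also have "real x * real x powr (- 2) = 1 / real x"
          using x by (simp add: powr_minus powr_numeral power2_eq_square field_simps)
        finally show ?thesis .
      qed
      ultimately show "2 * c * (1 / real x) \<le> (\<Sum>y=2*x+1..3*x. f (int x, int y))" by simp
    qed
    moreover have "(\<Sum>x=1..M. 2 * c * (1 / real x)) = 2 * (c * (\<Sum>x=1..M. 1 / real x))"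
      by (simp only: sum_distrib_left mult.assoc)
    moreover have "(\<Sum>x\<in>S. \<psi> x * frac_laplacian p \<sigma> G x) = (\<Sum>x\<in>S. G x * frac_laplacian p \<sigma> G x)"
      by (intro sum.cong) (auto simp: \<psi>_def)
    ultimately show ?thesis unfolding S_def by simp
  qed
  moreover have "0 < c" using k b by (simp add: c_def)
  ultimately show ?thesis using that by blast
qed

text \<open>If \<open>A \<le> 0\<close>, then \<open>G\<Delta>G \<le> c/(4x)\<close> for large \<open>x\<close>, where \<open>c\<close> is the constant of \<open>energy_lower_bound\<close>. The sum
over \<open>\<bar>x\<bar> \<le> 3M\<close> is then at most half of that lower bound plus a constant, so the harmonic
series would be bounded.\<close>

lemma scaled_laplacian_limit_pos:
  obtains A where "0 < A"
    "(\<lambda>x. real x powr (p * \<sigma>) * (frac_laplacian p \<sigma> G (int x) / G (int x) powr (p - 1))) \<longlonglongrightarrow> A"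
proof -
  define \<tau> where "\<tau> = p * \<sigma>"
  define b where "b x = real x powr \<tau> * (frac_laplacian p \<sigma> G (int x) / G (int x) powr (p - 1))" for x
  obtain A where A: "b \<longlonglongrightarrow> A" using scaled_laplacian_convergent unfolding b_def \<tau>_def by blast
  have "0 < A"
  proof (rule ccontr)
    assume "\<not> 0 < A"
    obtain c where c: "0 < c"
      "\<And>M. c * (\<Sum>x=1..M. 1 / real x) \<le> (\<Sum>x\<in>{- int (3 * M)..int (3 * M)}. G x * frac_laplacian p \<sigma> G x)"
      using energy_lower_bound by blast
    obtain g B where B: "0 < g" "0 < B"
      "\<And>x. g * (1 + real_of_int \<bar>x\<bar>) powr (- \<gamma>) \<le> G x"
      "\<And>x. G x \<le> B * (1 + real_of_int \<bar>x\<bar>) powr (- \<gamma>)"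
      using G_bounds by blast
    \<comment> \<open>The factor \<open>1/4\<close> leaves a net gain of \<open>c/2\<close> after both half-lines are counted.\<close>
    define \<eta> where "\<eta> = c / (4 * B powr p)"
    have \<eta>: "0 < \<eta>" using c B by (simp add: \<eta>_def)
    have "eventually (\<lambda>x. b x < \<eta>) sequentially"
      using \<eta> \<open>\<not> 0 < A\<close> by (intro order_tendstoD(2)[OF A]) auto
    then obtain X where X: "\<And>x. X \<le> x \<Longrightarrow> b x < \<eta>" by (auto simp: eventually_sequentially)
    define h where "h x = G x * frac_laplacian p \<sigma> G x" for x
    have far: "h (int x) \<le> (c / 4) * (1 / real x)" if x: "X \<le> x" "1 \<le> x" for x
    proof -
      have "h (int x) = b x * (real x powr (- \<tau>) * G (int x) powr p)"
        using x G_pos[of "int x"] by (simp add: h_def b_def powr_minus powr_diff field_simps)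
      also have "\<dots> \<le> \<eta> * (real x powr (- \<tau>) * G (int x) powr p)"
        using X[OF x(1)] by (intro mult_right_mono) auto
      also have "\<dots> \<le> \<eta> * (real x powr (- \<tau>) * (B powr p * real x powr (\<tau> - 1)))"
      proof -
        have "(1 + real x) powr (- \<gamma>) \<le> real x powr (- \<gamma>)" using x gamma_pos by (intro powr_mono2') auto
        then have "B * (1 + real x) powr (- \<gamma>) \<le> B * real x powr (- \<gamma>)"
          using B(2) by (intro mult_left_mono) auto
        moreover have "G (int x) \<le> B * (1 + real x) powr (- \<gamma>)" using B(4)[of "int x"] by simp
        ultimately have "G (int x) \<le> B * real x powr (- \<gamma>)" by (rule order.trans[rotated])
        then have "G (int x) powr p \<le> (B * real x powr (- \<gamma>)) powr p"
          using G_pos[of "int x"] p by (intro powr_mono2) auto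
        also have "\<dots> = B powr p * real x powr (\<tau> - 1)"
          using gamma_p by (simp add: powr_mult powr_powr \<tau>_def)
        finally show ?thesis using \<eta> by (intro mult_left_mono) auto
      qed
      also have "\<dots> = (\<eta> * B powr p) * (real x powr (- \<tau>) * real x powr (\<tau> - 1))" by simp
      also have "real x powr (- \<tau>) * real x powr (\<tau> - 1) = 1 / real x"
      proof -
        have e: "- \<tau> + (\<tau> - 1) = - 1" by simp
        show ?thesis unfolding powr_add[symmetric] e using x by (simp add: powr_minus_divide)
      qed
      also have "\<eta> * B powr p = c / 4" using B by (simp add: \<eta>_def)
      finally show ?thesis .
    qed
    define K where "K = h 0 + 2 * (\<Sum>x=1..X. \<bar>h (int x)\<bar>)"
    have upper: "(\<Sum>x\<in>{- int N..int N}. h x) \<le> K + (c / 2) * (\<Sum>x=1..N. 1 / real x)" for N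
    proof -
      have hm: "h (- x) = h x" for x by (simp add: h_def G_uminus frac_laplacian_G_uminus)
      have "(\<Sum>x\<in>{- int N..int N}. h x) = h 0 + 2 * (\<Sum>x=1..N. h (int x))"
      proof (induction N)
        case (Suc N)
        have "{- int (Suc N)..int (Suc N)} = insert (int (Suc N)) (insert (- int (Suc N)) {- int N..int N})"
          by auto
        then show ?case using Suc hm[of "int (Suc N)"] by simp
      qed simp
      moreover have "(\<Sum>x=1..N. h (int x)) \<le> (\<Sum>x=1..X. \<bar>h (int x)\<bar>) + (c / 4) * (\<Sum>x=1..N. 1 / real x)"
      proof -
        have "(\<Sum>x=1..N. h (int x)) \<le> (\<Sum>x=1..N. (if x \<le> X then \<bar>h (int x)\<bar> else 0) + (c / 4) * (1 / real x))"
        proof (rule sum_mono)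
          fix x assume "x \<in> {1..N}"
          then show "h (int x) \<le> (if x \<le> X then \<bar>h (int x)\<bar> else 0) + (c / 4) * (1 / real x)"
            using far[of x] c(1) by (cases "x \<le> X") (auto intro: add_increasing2 simp: abs_ge_self)
        qed
        also have "\<dots> = (\<Sum>x=1..N. if x \<le> X then \<bar>h (int x)\<bar> else 0) + (c / 4) * (\<Sum>x=1..N. 1 / real x)"
          by (simp only: sum.distrib sum_distrib_left)
        also have "(\<Sum>x=1..N. if x \<le> X then \<bar>h (int x)\<bar> else 0) = (\<Sum>x\<in>{1..N} \<inter> {..X}. \<bar>h (int x)\<bar>)"
          by (subst sum.inter_restrict) auto
        also have "\<dots> \<le> (\<Sum>x=1..X. \<bar>h (int x)\<bar>)" by (intro sum_mono2) auto
        finally show ?thesis by simp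
      qed
      ultimately show ?thesis unfolding K_def by simp
    qed
    have harm3: "(\<Sum>x=1..3*M. 1 / real x) \<le> (\<Sum>x=1..M. 1 / real x) + 2" for M
    proof (cases "M = 0")
      case False
      have "{1..3*M} = {1..M} \<union> {M+1..3*M}" by auto
      then have "(\<Sum>x=1..3*M. 1 / real x) = (\<Sum>x=1..M. 1 / real x) + (\<Sum>x=M+1..3*M. 1 / real x)"
        by (simp add: sum.union_disjoint)
      also have "(\<Sum>x=M+1..3*M. 1 / real x) \<le> (\<Sum>x=M+1..3*M. 1 / real M)"
        using False by (intro sum_mono divide_left_mono) auto
      also have "\<dots> = 2" using False by simp
      finally show ?thesis by simp
    qed simp
    have bdd: "(\<Sum>x=1..M. 1 / real x) \<le> 2 * (K + c) / c" for M
    proof -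
      have "c * (\<Sum>x=1..M. 1 / real x) \<le> K + (c / 2) * (\<Sum>x=1..3*M. 1 / real x)"
        using c(2)[of M] upper[of "3 * M"] unfolding h_def by linarith
      also have "(c / 2) * (\<Sum>x=1..3*M. 1 / real x) \<le> (c / 2) * ((\<Sum>x=1..M. 1 / real x) + 2)"
        using harm3[of M] c(1) by (intro mult_left_mono) auto
      finally have "c * (\<Sum>x=1..M. 1 / real x) \<le> 2 * (K + c)" by (simp add: algebra_simps)
      then show ?thesis using c(1) by (simp add: pos_le_divide_eq mult.commute)
    qed
    have "summable (\<lambda>n. 1 / real (Suc n))"
    proof (rule summableI_nonneg_bounded)
      show "(\<Sum>i<n. 1 / real (Suc i)) \<le> 2 * (K + c) / c" for n
        using bdd[of n] by (simp add: sum.atLeast1_atMost_eq del: of_nat_Suc)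
    qed simp
    then show False
      using not_summable_harmonic[where 'a = real] summable_Suc_iff[of "\<lambda>n. 1 / real n"]
      by (simp add: inverse_eq_divide)
  qed
  then show ?thesis using that A unfolding b_def \<tau>_def by blast
qed

end

section \<open>Truncation\<close>

context frac_profile
begin

definition trunc :: "nat \<Rightarrow> int \<Rightarrow> real" where
  "trunc X x = min (G x) (G (int X))"

lemma trunc_pos: "0 < trunc X x"
  using G_pos by (simp add: trunc_def)

lemma trunc_inside: "\<bar>x\<bar> \<le> int X \<Longrightarrow> trunc X x = G (int X)"
  using G_le[of x "int X"] by (simp add: trunc_def)

lemma trunc_outside: "int X \<le> \<bar>x\<bar> \<Longrightarrow> trunc X x = G x"
  using G_le[of "int X" x] by (simp add: trunc_def)

lemma trunc_in_F_space: "trunc X \<in> F_space p \<sigma>"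
proof (rule bounded_in_F_space)
  show "\<bar>trunc X x\<bar> \<le> G (int X)" for x
    using trunc_pos[of X x] by (simp add: trunc_def)
qed

lemma frac_laplacian_trunc_inside_pos:
  assumes "\<bar>x\<bar> \<le> int X"
  shows "0 < frac_laplacian p \<sigma> (trunc X) x"
proof -
  let ?f = "\<lambda>y. \<kappa> (x - y) * J (trunc X x - trunc X y)"
  let ?y = "int (Suc X)"
  have nn: "0 \<le> ?f y" for y
    using kappa_nonneg trunc_inside[OF assms]
    by (intro mult_nonneg_nonneg) (auto simp: signed_powr_nonneg trunc_def)
  have "(?f has_sum ?f ?y) {?y}" by (rule has_sum_finiteI) auto
  then have "?f ?y \<le> frac_laplacian p \<sigma> (trunc X) x"
    by (rule has_sum_mono2[OF _ frac_laplacian_has_sum[OF trunc_in_F_space]]) (use nn in auto)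
  moreover have "0 < ?f ?y"
  proof (rule mult_pos_pos)
    show "0 < \<kappa> (x - ?y)" using assms by (intro kappa_pos) auto
    have "trunc X ?y < trunc X x"
      using G_less[of "int X" ?y] trunc_outside[of X ?y] trunc_inside[OF assms] by simp
    then show "0 < J (trunc X x - trunc X ?y)" by (simp add: signed_powr_nonneg)
  qed
  ultimately show ?thesis by linarith
qed

text \<open>Truncation lowers only the values at other points.\<close>

lemma frac_laplacian_trunc_ge:
  assumes "int X \<le> \<bar>x\<bar>"
  shows "frac_laplacian p \<sigma> G x \<le> frac_laplacian p \<sigma> (trunc X) x"
proof (rule has_sum_mono[OF frac_laplacian_has_sum[OF G_in_F_space] frac_laplacian_has_sum[OF trunc_in_F_space]])
  fix y
  have "J (G x - G y) \<le> J (trunc X x - trunc X y)"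
    unfolding trunc_outside[OF assms] using p by (intro signed_powr_mono) (auto simp: trunc_def)
  then show "\<kappa> (x - y) * J (G x - G y) \<le> \<kappa> (x - y) * J (trunc X x - trunc X y)"
    using kappa_nonneg by (intro mult_left_mono)
qed

lemma frac_laplacian_trunc_le:
  assumes "int X \<le> \<bar>x\<bar>"
  shows "frac_laplacian p \<sigma> (trunc X) x \<le> frac_laplacian p \<sigma> G x
     + (\<Sum>y\<in>{- int X..int X}. \<kappa> (x - y) * G 0 powr (p - 1))"
proof -
  let ?S = "{- int X..int X}"
  have fin: "((\<lambda>y. if y \<in> ?S then \<kappa> (x - y) * G 0 powr (p - 1) else 0) has_sum
      (\<Sum>y\<in>?S. \<kappa> (x - y) * G 0 powr (p - 1))) UNIV"
    by (rule has_sum_finite_neutralI[where B = ?S]) auto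
  show ?thesis
  proof (rule has_sum_mono[OF frac_laplacian_has_sum[OF trunc_in_F_space]
        has_sum_add[OF frac_laplacian_has_sum[OF G_in_F_space] fin]])
    fix y
    show "\<kappa> (x - y) * J (trunc X x - trunc X y) \<le> \<kappa> (x - y) * J (G x - G y) +
        (if y \<in> ?S then \<kappa> (x - y) * G 0 powr (p - 1) else 0)"
    proof (cases "y \<in> ?S")
      case True
      have "trunc X x - trunc X y \<le> 0"
      proof -
        have "trunc X y = G (int X)" using True by (intro trunc_inside) auto
        then show ?thesis by (simp add: trunc_def[of X x])
      qed
      then have "J (trunc X x - trunc X y) \<le> 0"
        using signed_powr_mono[of "p - 1" "trunc X x - trunc X y" 0] p by simp
      moreover have "\<bar>J (G x - G y)\<bar> \<le> G 0 powr (p - 1)"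
        unfolding signed_powr_abs
      proof (rule powr_mono2)
        show "\<bar>G x - G y\<bar> \<le> G 0" using G_le[of 0 x] G_le[of 0 y] G_pos[of x] G_pos[of y] by simp
      qed (use p in auto)
      ultimately have "J (trunc X x - trunc X y) \<le> J (G x - G y) + G 0 powr (p - 1)" by linarith
      then have "\<kappa> (x - y) * J (trunc X x - trunc X y) \<le> \<kappa> (x - y) * (J (G x - G y) + G 0 powr (p - 1))"
        using kappa_nonneg by (intro mult_left_mono)
      then show ?thesis using True by (simp add: distrib_left)
    next
      case False
      then have "int X \<le> \<bar>y\<bar>" by auto
      then show ?thesis using False by (simp add: trunc_outside assms kappa_nonneg)
    qed
  qed
qed

text \<open>Only the finitely many points where \<open>G\<close> exceeds the truncation level are affected. They are at distance
at least \<open>\<bar>x\<bar>/2\<close>, so the correction has order \<open>\<bar>x\<bar> powr (-1-\<tau>)\<close>, and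
\<open>G(x) powr (p-1)\<close> has order \<open>\<bar>x\<bar> powr (-\<gamma>(p-1))\<close> with \<open>\<gamma>(p-1) \<le> 1\<close>.\<close>

lemma correction_le:
  obtains K where "0 < K" "\<And>x. 2 * int X < \<bar>x\<bar> \<Longrightarrow>
    (\<Sum>y\<in>{- int X..int X}. \<kappa> (x - y) * G 0 powr (p - 1)) \<le> K * (real_of_int \<bar>x\<bar> powr (- (p * \<sigma>)) * G x powr (p - 1))"
proof -
  define \<tau> where "\<tau> = p * \<sigma>"
  define \<theta> where "\<theta> = \<gamma> * (p - 1)"
  have \<theta>: "\<theta> \<le> 1" using gamma_p1 gamma_pos sigma_range by (simp add: \<theta>_def)
  obtain c A where A: "0 < c" "0 < A" "\<And>x. x \<noteq> 0 \<Longrightarrow> c * real_of_int \<bar>x\<bar> powr (- 1 - p * \<sigma>) \<le> \<kappa> x"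
     "\<And>x. x \<noteq> 0 \<Longrightarrow> \<kappa> x \<le> A * real_of_int \<bar>x\<bar> powr (- 1 - p * \<sigma>)"
    using kappa_bounds by blast
  obtain g B where B: "0 < g" "0 < B"
    "\<And>x. g * (1 + real_of_int \<bar>x\<bar>) powr (- \<gamma>) \<le> G x"
    "\<And>x. G x \<le> B * (1 + real_of_int \<bar>x\<bar>) powr (- \<gamma>)"
    using G_bounds by blast
  define M where "M = (g * 2 powr (- \<gamma>)) powr (p - 1)"
  have M: "0 < M" using B by (simp add: M_def)
  define N where "N = (2 * real X + 1) * (A * 2 powr (1 + \<tau>) * G 0 powr (p - 1))"
  have G0: "0 < G 0 powr (p - 1)" using G_pos[of 0] by simp
  have N: "0 < N" unfolding N_def using A G0 by (intro mult_pos_pos) auto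
  have "(\<Sum>y\<in>{- int X..int X}. \<kappa> (x - y) * G 0 powr (p - 1)) \<le> (N / M) * (real_of_int \<bar>x\<bar> powr (- (p * \<sigma>)) * G x powr (p - 1))"
    if x: "2 * int X < \<bar>x\<bar>" for x
  proof -
    define r where "r = real_of_int \<bar>x\<bar>"
    have r: "1 \<le> r" using x by (simp add: r_def)
    have "\<kappa> (x - y) * G 0 powr (p - 1) \<le> A * 2 powr (1 + \<tau>) * r powr (- 1 - \<tau>) * G 0 powr (p - 1)"
      if y: "y \<in> {- int X..int X}" for y
    proof -
      have ne: "x - y \<noteq> 0" using x y by auto
      have "\<bar>y\<bar> \<le> int X" using y by auto
      moreover have "\<bar>x\<bar> \<le> \<bar>x - y\<bar> + \<bar>y\<bar>" using abs_triangle_ineq[of "x - y" y] by simp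
      moreover have "c \<le> 2 * d" if "b \<le> n" "c \<le> d + b" "2 * n < c" for b c d n :: int
        using that by simp
      ultimately have "\<bar>x\<bar> \<le> 2 * \<bar>x - y\<bar>" using x by blast
      then have "real_of_int \<bar>x\<bar> \<le> real_of_int (2 * \<bar>x - y\<bar>)" by (simp only: of_int_le_iff)
      then have le: "r / 2 \<le> real_of_int \<bar>x - y\<bar>" by (simp add: r_def)
      have "\<kappa> (x - y) \<le> A * real_of_int \<bar>x - y\<bar> powr (- 1 - \<tau>)"
        using A(4)[OF ne] by (simp add: \<tau>_def)
      also have "\<dots> \<le> A * (r / 2) powr (- 1 - \<tau>)"
        using le r A sigma_range by (intro mult_left_mono powr_mono2') (auto simp: \<tau>_def)
      also have "(r / 2) powr (- 1 - \<tau>) = 2 powr (1 + \<tau>) * r powr (- 1 - \<tau>)"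
      proof -
        have e: "- 1 - \<tau> = - (1 + \<tau>)" by simp
        show ?thesis unfolding e powr_divide powr_minus by (simp add: divide_inverse)
      qed
      finally show ?thesis using G0 by (intro mult_right_mono) (auto simp: mult.assoc)
    qed
    then have "(\<Sum>y\<in>{- int X..int X}. \<kappa> (x - y) * G 0 powr (p - 1))
        \<le> (\<Sum>y\<in>{- int X..int X}. A * 2 powr (1 + \<tau>) * r powr (- 1 - \<tau>) * G 0 powr (p - 1))"
      by (rule sum_mono)
    also have "\<dots> = N * r powr (- 1 - \<tau>)" by (simp add: N_def mult_ac)
    also have "\<dots> \<le> N * (r powr (- \<tau>) * r powr (- \<theta>))"
    proof (intro mult_left_mono)
      have "r powr (- 1 - \<tau>) \<le> r powr (- \<tau> + - \<theta>)" using r \<theta> by (intro powr_mono) auto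
      then show "r powr (- 1 - \<tau>) \<le> r powr (- \<tau>) * r powr (- \<theta>)" by (simp only: powr_add)
    qed (use N in auto)
    also have "\<dots> \<le> N * (r powr (- \<tau>) * (G x powr (p - 1) / M))"
    proof (intro mult_left_mono)
      have "(g * 2 powr (- \<gamma>)) * r powr (- \<gamma>) = g * (2 * r) powr (- \<gamma>)" by (simp add: powr_mult)
      also have "\<dots> \<le> g * (1 + r) powr (- \<gamma>)"
        using r B gamma_pos by (intro mult_left_mono powr_mono2') auto
      also have "\<dots> \<le> G x" using B(3)[of x] by (simp add: r_def)
      finally have "((g * 2 powr (- \<gamma>)) * r powr (- \<gamma>)) powr (p - 1) \<le> G x powr (p - 1)"
        using B p by (intro powr_mono2) auto
      then have "M * r powr (- \<theta>) \<le> G x powr (p - 1)"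
        by (simp only: powr_mult[of "g * 2 powr (- \<gamma>)"] powr_powr M_def \<theta>_def mult_minus_left)
      then show "r powr (- \<theta>) \<le> G x powr (p - 1) / M" using M by (simp add: pos_le_divide_eq mult.commute)
    qed (use N in auto)
    finally show ?thesis by (simp add: r_def \<tau>_def)
  qed
  then show ?thesis using that[of "N / M"] N M by auto
qed

lemma optimal_truncation:
  obtains \<epsilon> where "0 < \<epsilon>"
    "let u = (\<lambda>x. min (kappa q (- \<alpha>) x) \<epsilon>);
         w = (\<lambda>x. frac_laplacian p \<sigma> u x / u x powr (p - 1))
     in superharmonic p \<sigma> u \<and> optimal_hardy_weight p \<sigma> w \<and>
        (\<exists>C1>0. \<exists>C2>0. \<exists>R. \<forall>x. \<bar>x\<bar> \<ge> R \<longrightarrow>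
           C1 * of_int \<bar>x\<bar> powr (- (p * \<sigma>)) \<le> w x \<and> w x \<le> C2 * of_int \<bar>x\<bar> powr (- (p * \<sigma>)))"
proof -
  obtain A where A: "0 < A"
    "(\<lambda>x. real x powr (p * \<sigma>) * (frac_laplacian p \<sigma> G (int x) / G (int x) powr (p - 1))) \<longlonglongrightarrow> A"
    using scaled_laplacian_limit_pos by blast
  have "eventually (\<lambda>x. A / 2 < real x powr (p * \<sigma>) * (frac_laplacian p \<sigma> G (int x) / G (int x) powr (p - 1)) \<and>
      real x powr (p * \<sigma>) * (frac_laplacian p \<sigma> G (int x) / G (int x) powr (p - 1)) < 2 * A) sequentially"
    using A(1) by (intro eventually_conj order_tendstoD[OF A(2)]) auto
  then obtain X0 where X0: "\<And>x. X0 \<le> x \<Longrightarrow> A / 2 < real x powr (p * \<sigma>) * (frac_laplacian p \<sigma> G (int x) / G (int x) powr (p - 1))"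
      "\<And>x. X0 \<le> x \<Longrightarrow> real x powr (p * \<sigma>) * (frac_laplacian p \<sigma> G (int x) / G (int x) powr (p - 1)) < 2 * A"
    unfolding eventually_sequentially by blast
  \<comment> \<open>Shifted by one so that \<open>\<bar>x\<bar> \<ge> X\<close> excludes \<open>x = 0\<close>.\<close>
  define X where "X = Suc X0"
  define R where "R x = real_of_int \<bar>x\<bar> powr (- (p * \<sigma>))" for x
  have two_sided: "A / 2 * R x \<le> frac_laplacian p \<sigma> G x / G x powr (p - 1)"
      "frac_laplacian p \<sigma> G x / G x powr (p - 1) \<le> 2 * A * R x" if x: "int X \<le> \<bar>x\<bar>" for x
  proof -
    define n where "n = nat \<bar>x\<bar>"
    have n: "X0 \<le> n" "0 < real n" "real_of_int \<bar>x\<bar> = real n" using x by (auto simp: n_def X_def)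
    have e: "frac_laplacian p \<sigma> G x = frac_laplacian p \<sigma> G (int n)" "G x = G (int n)"
      unfolding n_def by (rule frac_laplacian_G_abs, rule G_abs)
    have m: "z = (real n powr (p * \<sigma>) * z) * R x" for z
      unfolding R_def n(3) using n(2) by (simp add: powr_minus)
    have R: "0 \<le> R x" by (simp add: R_def)
    show "A / 2 * R x \<le> frac_laplacian p \<sigma> G x / G x powr (p - 1)"
      unfolding e by (subst m) (intro mult_right_mono R less_imp_le X0 n)
    show "frac_laplacian p \<sigma> G x / G x powr (p - 1) \<le> 2 * A * R x"
      unfolding e by (subst m) (intro mult_right_mono R less_imp_le X0 n)
  qed
  define u where "u = trunc X"
  define w where "w x = frac_laplacian p \<sigma> u x / u x powr (p - 1)" for x
  have u: "u \<in> F_space p \<sigma>" "\<And>x. 0 < u x" unfolding u_def by (rule trunc_in_F_space, rule trunc_pos)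
  have up: "0 < u x powr (p - 1)" for x using u(2)[of x] by simp
  have lower: "A / 2 * R x \<le> w x" if x: "int X \<le> \<bar>x\<bar>" for x
  proof -
    have "frac_laplacian p \<sigma> G x / G x powr (p - 1) \<le> w x"
      unfolding w_def u_def trunc_outside[OF x] using frac_laplacian_trunc_ge[OF x] by (intro divide_right_mono) auto
    with two_sided(1)[OF x] show ?thesis by linarith
  qed
  have wpos: "0 < w x" for x
  proof (cases "\<bar>x\<bar> \<le> int X")
    case True
    then show ?thesis
      unfolding w_def using frac_laplacian_trunc_inside_pos[OF True] up by (intro divide_pos_pos) (auto simp: u_def)
  next
    case False
    then have "0 < A / 2 * R x" using A(1) by (intro mult_pos_pos) (auto simp: R_def)
    also have "\<dots> \<le> w x" using False by (intro lower) auto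
    finally show ?thesis .
  qed
  obtain K where K: "0 < K" "\<And>x. 2 * int X < \<bar>x\<bar> \<Longrightarrow>
    (\<Sum>y\<in>{- int X..int X}. \<kappa> (x - y) * G 0 powr (p - 1)) \<le> K * (real_of_int \<bar>x\<bar> powr (- (p * \<sigma>)) * G x powr (p - 1))"
    using correction_le by blast
  have upper: "w x \<le> (2 * A + K) * R x" if x: "2 * int X < \<bar>x\<bar>" for x
  proof -
    have xX: "int X \<le> \<bar>x\<bar>" using x by simp
    have Gp: "0 < G x powr (p - 1)" using G_pos[of x] by simp
    have "frac_laplacian p \<sigma> (trunc X) x \<le> frac_laplacian p \<sigma> G x + K * (R x * G x powr (p - 1))"
      using frac_laplacian_trunc_le[OF xX] K(2)[OF x] unfolding R_def by linarith
    then have "w x \<le> (frac_laplacian p \<sigma> G x + K * (R x * G x powr (p - 1))) / G x powr (p - 1)"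
      unfolding w_def u_def trunc_outside[OF xX] by (intro divide_right_mono) auto
    also have "\<dots> = frac_laplacian p \<sigma> G x / G x powr (p - 1) + K * R x"
      using Gp by (simp add: add_divide_distrib)
    also have "\<dots> \<le> 2 * A * R x + K * R x" using two_sided(2)[OF xX] by simp
    finally show ?thesis by (simp add: distrib_right)
  qed
  have ps: "positive_supersolution p \<sigma> w u"
    unfolding positive_supersolution_def using u up by (auto simp: w_def less_imp_neq[symmetric])
  obtain g B where B: "0 < g" "0 < B"
    "\<And>x. g * (1 + real_of_int \<bar>x\<bar>) powr (- \<gamma>) \<le> G x"
    "\<And>x. G x \<le> B * (1 + real_of_int \<bar>x\<bar>) powr (- \<gamma>)"
    using G_bounds by blast
  have powr_p: "(C * z powr (- \<gamma>)) powr p = C powr p * z powr (p * \<sigma> - 1)" for C z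
    using gamma_p by (simp add: powr_mult powr_powr)
  have decay: "u x powr p \<le> B powr p * (1 + real_of_int \<bar>x\<bar>) powr (p * \<sigma> - 1)" for x
  proof -
    have "u x powr p \<le> (B * (1 + real_of_int \<bar>x\<bar>) powr (- \<gamma>)) powr p"
      using B(4)[of x] u(2)[of x] p by (intro powr_mono2) (auto simp: u_def trunc_def)
    then show ?thesis by (simp only: powr_p)
  qed
  have crit: "p_critical p \<sigma> w" "agmon_ground_state p \<sigma> w u"
    using null_sequence_imp_critical[OF u, of w] null_sequence_exists[OF u decay, of w] by (auto simp: w_def)
  have infinite: "\<not> (\<lambda>x. \<bar>w x\<bar> * u x powr p) summable_on UNIV"
  proof
    assume s: "(\<lambda>x. \<bar>w x\<bar> * u x powr p) summable_on UNIV"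
    define f where "f x = \<bar>w x\<bar> * u x powr p" for x
    have "f summable_on range int" using s unfolding f_def by (rule summable_on_subset_banach) auto
    then have "(\<lambda>n. f (int n)) summable_on UNIV"
      by (subst (asm) summable_on_reindex) (auto simp: o_def)
    then have "summable (\<lambda>n. f (int n))" by (rule summable_on_imp_summable)
    define c where "c = A / 2 * (g * 2 powr (- \<gamma>)) powr p"
    have c: "0 < c" using A B by (simp add: c_def)
    have "summable (\<lambda>n. c * (1 / real n))"
    proof (rule summable_comparison_test[OF _ \<open>summable (\<lambda>n. f (int n))\<close>])
      have "norm (c * (1 / real n)) \<le> f (int n)" if n: "X \<le> n" for n
      proof -
        have n1: "1 \<le> real n" using n by (simp add: X_def)
        have "(g * 2 powr (- \<gamma>)) * real n powr (- \<gamma>) = g * (2 * real n) powr (- \<gamma>)" by (simp add: powr_mult)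
        also have "\<dots> \<le> g * (1 + real n) powr (- \<gamma>)"
          using n1 B gamma_pos by (intro mult_left_mono powr_mono2') auto
        also have "\<dots> \<le> u (int n)"
          using B(3)[of "int n"] n by (simp add: u_def trunc_outside)
        finally have "((g * 2 powr (- \<gamma>)) * real n powr (- \<gamma>)) powr p \<le> u (int n) powr p"
          using B p by (intro powr_mono2) auto
        then have 1: "(g * 2 powr (- \<gamma>)) powr p * real n powr (p * \<sigma> - 1) \<le> u (int n) powr p"
          by (simp only: powr_p)
        have "(A / 2 * real n powr (- (p * \<sigma>))) * ((g * 2 powr (- \<gamma>)) powr p * real n powr (p * \<sigma> - 1)) \<le> \<bar>w (int n)\<bar> * u (int n) powr p"
          using lower[of "int n"] n 1 A(1) by (intro mult_mono) (auto simp: R_def)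
        moreover have "real n powr (- (p * \<sigma>)) * real n powr (p * \<sigma> - 1) = 1 / real n"
        proof -
          have e: "- (p * \<sigma>) + (p * \<sigma> - 1) = - 1" by simp
          show ?thesis unfolding powr_add[symmetric] e using n1 by (simp add: powr_minus_divide)
        qed
        moreover have "(A / 2 * real n powr (- (p * \<sigma>))) * ((g * 2 powr (- \<gamma>)) powr p * real n powr (p * \<sigma> - 1))
            = A / 2 * (g * 2 powr (- \<gamma>)) powr p * (real n powr (- (p * \<sigma>)) * real n powr (p * \<sigma> - 1))"
          by (simp only: mult_ac)
        ultimately have "c * (1 / real n) \<le> f (int n)" by (simp only: c_def f_def)
        then show ?thesis using c n1 by simp
      qed
      then show "\<exists>N. \<forall>n\<ge>N. norm (c * (1 / real n)) \<le> f (int n)" by blast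
    qed
    then have "summable (\<lambda>n. 1 / real n)" using c by (simp only: summable_cmult_iff) simp
    then show False using not_summable_harmonic[where 'a = real] by (simp add: inverse_eq_divide)
  qed
  have "superharmonic p \<sigma> u"
    unfolding superharmonic_def
  proof (intro conjI allI u)
    show "0 \<le> frac_laplacian p \<sigma> u x" for x
      using wpos[of x] up[of x] by (simp add: w_def zero_less_divide_iff)
  qed
  moreover have "optimal_hardy_weight p \<sigma> w"
    unfolding optimal_hardy_weight_def hardy_weight_def p_null_critical_def
    using hardy_type_weight_of_supersolution[OF ps] wpos crit infinite by blast
  moreover have "\<exists>C1>0. \<exists>C2>0. \<exists>Ro. \<forall>x. \<bar>x\<bar> \<ge> Ro \<longrightarrow>
           C1 * of_int \<bar>x\<bar> powr (- (p * \<sigma>)) \<le> w x \<and> w x \<le> C2 * of_int \<bar>x\<bar> powr (- (p * \<sigma>))"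
  proof (rule exI[of _ "A / 2"], rule conjI, use A in simp, rule exI[of _ "2 * A + K"], rule conjI, use A K in simp,
      rule exI[of _ "2 * int X + 1"], intro allI impI)
    fix x :: int assume "2 * int X + 1 \<le> \<bar>x\<bar>"
    then show "A / 2 * of_int \<bar>x\<bar> powr (- (p * \<sigma>)) \<le> w x \<and> w x \<le> (2 * A + K) * of_int \<bar>x\<bar> powr (- (p * \<sigma>))"
      using lower[of x] upper[of x] by (simp add: R_def)
  qed
  moreover have "min (kappa q (- \<alpha>) x) (G (int X)) = u x" for x
    by (simp add: u_def trunc_def G_def)
  ultimately show ?thesis
    using G_pos[of "int X"] by (intro that[of "G (int X)"]) (simp_all only: Let_def w_def[symmetric])
qed

end

theorem theorem2p4:
  fixes p q \<sigma> \<alpha> :: real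
  assumes "p > 1" and "q > 1" and "0 < \<sigma>" and "\<sigma> < 1 / p"
    and "\<alpha> = (p - 1 + p * \<sigma>) / (p * q)"
  shows "\<exists>\<epsilon>>0.
    (let u = (\<lambda>x. min (kappa q (- \<alpha>) x) \<epsilon>);
         w = (\<lambda>x. frac_laplacian p \<sigma> u x / u x powr (p - 1))
     in superharmonic p \<sigma> u \<and>
        optimal_hardy_weight p \<sigma> w \<and>
        (\<exists>C1>0. \<exists>C2>0. \<exists>R. \<forall>x. \<bar>x\<bar> \<ge> R \<longrightarrow>
           C1 * of_int \<bar>x\<bar> powr (- (p * \<sigma>)) \<le> w x \<and>
           w x \<le> C2 * of_int \<bar>x\<bar> powr (- (p * \<sigma>))))"
proof -
  interpret frac_profile p \<sigma> q \<alpha>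
    by unfold_locales (use assms in auto)
  show ?thesis
    using optimal_truncation by blast
qed

end
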